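(* Let \[ \mathbb{U}=\left\{ z\in\mathbb{C}:|\operatorname{Re} z|<1,\ \operatorname{Im} z>h(\operatorname{Re} z)\right\}, \qquad h(x)=-\frac{2}{\pi}\log\left(2\cos\frac{\pi}{2} x\right),\quad |x|<1. \] Then under $\mathbb{P}_0$ we have $\operatorname{Re} W_{\tau_{\mathbb{U}}}\sim \mathrm{U}[-1,1]$. Moreover, $\mathbb{U}$ is a minimal rate solution to the conformal Skorokhod embedding problem for $\mathrm{U}[-1,1]$; that is, $\mathbb{U}$ solves the conformal Skorokhod embedding problem for $\mathrm{U}[-1,1]$, and if $D\subset\mathbb{C}$ is another solution to the conformal Skorokhod embedding problem for $\mathrm{U}[-1,1]$, then $\lambda(\mathbb{U})\leq\lambda(D)$.
   Context: $\mathrm{U}[-1,1]$ denotes the uniform distribution on $[-1,1]$. Let $W=(W_t:t\ge0)$ be a standard complex Brownian motion (generator $\frac12\Delta$ on $\mathbb{C}\cong\mathbb{R}^2$), started at $0$ under $\mathbb{P}_0$. For an open set $D\subset\mathbb{C}$ containing $0$, $\tau_D=\inf\{t\ge0:W_t\notin D\}$. Conformal Skorokhod embedding problem (CSEP): for a probability distribution $\mu$ on $\mathbb{R}$ with zero mean and finite nonzero variance, a simply connected domain $D\subset\mathbb{C}$ containing $0$ is said to solve the CSEP for $\mu$ if, under $\mathbb{P}_0$, $\operatorname{Re}W_{\tau_D}\sim\mu$ and $\mathbb{E}_0[\tau_D]<\infty$. Rate: $\lambda(D)=-\lim_{t\to\infty}\frac1t\log\mathbb{P}_0(\tau_D>t)$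 (the limit exists, is nonnegative and finite; $2\lambda(D)$ is the bottom of the spectrum of the Dirichlet Laplacian $-\Delta$ on $D$). *)

theory Defs
  imports "HOL-Probability.Probability"
begin

text \<open>
  Processes are indexed by \<^typ>\<open>real\<close>; only times \<open>t \<ge> 0\<close> are constrained or used.
  All paths (not just almost all) are continuous, so that the exit time from an open set is
  measurable without completing \<open>M\<close>.
\<close>

definition std_real_BM :: "'a measure \<Rightarrow> (real \<Rightarrow> 'a \<Rightarrow> real) \<Rightarrow> bool" where
  "std_real_BM M B \<longleftrightarrow>
     prob_space M \<and>
     (\<forall>t\<ge>0. B t \<in> borel_measurable M) \<and>
     (AE \<omega> in M. B 0 \<omega> = 0) \<and>
     (\<forall>\<omega>\<in>space M. continuous_on {0..} (\<lambda>t. B t \<omega>)) \<and>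
     (\<forall>s t. 0 \<le> s \<longrightarrow> s < t \<longrightarrow>
        distributed M lborel (\<lambda>\<omega>. B t \<omega> - B s \<omega>) (normal_density 0 (sqrt (t - s)))) \<and>
     (\<forall>(t :: nat \<Rightarrow> real) n. 0 \<le> t 0 \<longrightarrow> mono t \<longrightarrow>
        prob_space.indep_vars M (\<lambda>_. borel) (\<lambda>i \<omega>. B (t (Suc i)) \<omega> - B (t i) \<omega>) {..<n})"

text \<open>Each component has variance \<open>t\<close> at time \<open>t\<close>, i.e. the generator is half the Laplacian.\<close>

definition std_complex_BM :: "'a measure \<Rightarrow> (real \<Rightarrow> 'a \<Rightarrow> complex) \<Rightarrow> bool" where
  "std_complex_BM M W \<longleftrightarrow>
     std_real_BM M (\<lambda>t \<omega>. Re (W t \<omega>)) \<and>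
     std_real_BM M (\<lambda>t \<omega>. Im (W t \<omega>)) \<and>
     prob_space.indep_var M
       (Pi\<^sub>M {0..} (\<lambda>_. borel)) (\<lambda>\<omega>. \<lambda>t\<in>{0..}. Re (W t \<omega>))
       (Pi\<^sub>M {0..} (\<lambda>_. borel)) (\<lambda>\<omega>. \<lambda>t\<in>{0..}. Im (W t \<omega>))"

text \<open>The infimum of the empty set is \<open>\<infinity>\<close>.\<close>

definition exit_time :: "(real \<Rightarrow> 'a \<Rightarrow> complex) \<Rightarrow> complex set \<Rightarrow> 'a \<Rightarrow> ennreal" where
  "exit_time W D \<omega> = (INF t\<in>{t. 0 \<le> t \<and> W t \<omega> \<notin> D}. ennreal t)"

text \<open>
  The value is only meaningful where the exit time is finite; on the event that it is infinite,
  this is \<open>W 0 \<omega>\<close>.  That event is null whenever the exit time is integrable.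
\<close>

definition exit_position :: "(real \<Rightarrow> 'a \<Rightarrow> complex) \<Rightarrow> complex set \<Rightarrow> 'a \<Rightarrow> complex" where
  "exit_position W D \<omega> = W (enn2real (exit_time W D \<omega>)) \<omega>"

definition has_law :: "'a measure \<Rightarrow> ('a \<Rightarrow> real) \<Rightarrow> real measure \<Rightarrow> bool" where
  "has_law M X \<mu> \<longleftrightarrow> X \<in> borel_measurable M \<and> distr M borel X = \<mu>"

text \<open>With zero mean, the variance is the second moment.\<close>

definition CSEP_target :: "real measure \<Rightarrow> bool" where
  "CSEP_target \<mu> \<longleftrightarrow>
     prob_space \<mu> \<and> sets \<mu> = sets borel \<and>
     integrable \<mu> (\<lambda>x. x\<^sup>2) \<and> (LINT x|\<mu>. x) = 0 \<and> (LINT x|\<mu>. x\<^sup>2) \<noteq> 0"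

definition solves_CSEP ::
  "'a measure \<Rightarrow> (real \<Rightarrow> 'a \<Rightarrow> complex) \<Rightarrow> real measure \<Rightarrow> complex set \<Rightarrow> bool" where
  "solves_CSEP M W \<mu> D \<longleftrightarrow>
     CSEP_target \<mu> \<and>
     open D \<and> connected D \<and> simply_connected D \<and> 0 \<in> D \<and>
     has_law M (\<lambda>\<omega>. Re (exit_position W D \<omega>)) \<mu> \<and>
     (\<integral>\<^sup>+\<omega>. exit_time W D \<omega> \<partial>M) < \<infinity>"

definition rate :: "'a measure \<Rightarrow> (real \<Rightarrow> 'a \<Rightarrow> complex) \<Rightarrow> complex set \<Rightarrow> real" where
  "rate M W D =
     - Lim at_top (\<lambda>t::real. 1 / t * ln (measure M {\<omega>\<in>space M. exit_time W D \<omega> > ennreal t}))"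

definition minimal_rate_solution ::
  "'a measure \<Rightarrow> (real \<Rightarrow> 'a \<Rightarrow> complex) \<Rightarrow> real measure \<Rightarrow> complex set \<Rightarrow> bool" where
  "minimal_rate_solution M W \<mu> D \<longleftrightarrow>
     solves_CSEP M W \<mu> D \<and> (\<forall>D'. solves_CSEP M W \<mu> D' \<longrightarrow> rate M W D \<le> rate M W D')"

definition h_U :: "real \<Rightarrow> real" where
  "h_U x = - (2 / pi) * ln (2 * cos (pi / 2 * x))"

definition U_domain :: "complex set" where
  "U_domain = {z. \<bar>Re z\<bar> < 1 \<and> Im z > h_U (Re z)}"

end

theory Submission
  imports Defs
begin

text \<open>
  \<^bold>\<open>The law.\<close> Put \<open>\<zeta> = exp (\<i> * pi / 2 * z)\<close>. Inside the strip \<open>\<bar>Re z\<bar> < 1\<close> the inequality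
  \<open>Im z > h_U (Re z)\<close> says \<open>\<bar>\<zeta>\<bar> < 2 * cos (arg \<zeta>)\<close>, that is \<open>\<bar>\<zeta> - 1\<bar> < 1\<close>. So \<open>\<zeta> - 1\<close> maps the domain
  onto the unit disc and sends \<open>0\<close> to \<open>0\<close>, and it takes the value \<open>cis (pi * x)\<close> at the boundary point with
  abscissa \<open>x\<close>. Its powers are bounded holomorphic functions on the domain; stopping them at the
  exit of Brownian motion gives \<open>E cis (n * pi * Re W) = 0\<close> at the exit for all \<open>n \<ge> 1\<close>
  (\<open>exit_U_trig\<close>). These trigonometric moments determine a law on \<open>(-1, 1)\<close>, and they are those of the
  uniform distribution (\<open>trig_uniform_unique\<close>).

  \<^bold>\<open>The two rates.\<close> Both are compared with \<open>pi\<^sup>2 / 8\<close>, the rate of the strip \<open>\<bar>Re z\<bar> < 1\<close>.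
  Let \<open>D\<close> be any solution, with exit time \<open>\<tau>\<close>. As \<open>\<tau>\<close> is integrable, \<open>Re W\<close> stopped at \<open>\<tau>\<close> is a
  martingale bounded in mean square. Its terminal value lies in \<open>[-1, 1]\<close>, hence so does the whole stopped process:
  the path never leaves the strip before \<open>\<tau>\<close> (\<open>confined_to_strip\<close>), which bounds \<open>P (\<tau> > t)\<close> by the
  decay in strips that are slightly wider (\<open>strip_survival_le\<close>).
  Conversely the domain of the theorem contains, far up, rectangles of width almost \<open>2\<close> and of
  any height; the path reaches them with positive probability (\<open>reaches_upper_part\<close>) and then stays
  inside with a probability that decays with the rate of the rectangle (\<open>rectangle_survival\<close>).

  \<^bold>\<open>Existence of the rate.\<close> The rate is a limit, so it has to be shown that the limit
  exists for every solution. By symmetry and the Cauchy-Schwarz inequality the killed heat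
  kernel \<open>k\<^sub>t(0, 0)\<close> is log-convex in \<open>t\<close>. It controls survival from both sides: \<open>2 * pi * k\<^bsub>t + 1\<^esub>(0, 0) \<le> P (\<tau> > t)\<close>,
  because the kernel at time \<open>1\<close> is at most \<open>1 / (2 * pi)\<close>, while \<open>P (\<tau> > t)\<close> is at most
  \<open>(A * k\<^bsub>2 t\<^esub>(0, 0)) powr (1 / 2)\<close> up to the probability that \<open>W\<^sub>t\<close> lies outside a square of area \<open>A\<close>.
  This is done for the path observed on a finite grid, where the kernel is an iterated integral; only
  the resulting inequality between survival probabilities (\<open>survival_inequality\<close>) is taken to the limit.
  It implies convergence (\<open>decay_rate_exists\<close>).

  \<^bold>\<open>Martingales.\<close> All martingales and submartingales are of the form \<open>u (t, W\<^sub>t)\<close> with \<open>u\<close> explicit: combinations of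
  products of cosines and exponentials, \<open>(Re z)\<^sup>2 - t\<close>, and the distance to the strip. Optional stopping
  (\<open>optional_stopping\<close>) is proved for such \<open>u\<close> from the Markov property.
\<close>

section \<open>Planar Gaussian measures\<close>

definition gauss_density :: "real \<Rightarrow> complex \<Rightarrow> real" where
  "gauss_density d z = normal_density 0 (sqrt d) (Re z) * normal_density 0 (sqrt d) (Im z)"

definition gauss :: "real \<Rightarrow> complex measure" where
  "gauss d = density lborel (gauss_density d)"

lemma borel_measurable_Complex_pair [measurable]:
  "(\<lambda>(x, y). Complex x y) \<in> borel_measurable (borel \<Otimes>\<^sub>M borel)"
  by (simp add: borel_measurable_complex_iff case_prod_beta)

lemma borel_measurable_gauss_density [measurable]: "gauss_density d \<in> borel_measurable borel"
  unfolding gauss_density_def by measurable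

lemma gauss_density_nonneg [simp]: "0 \<le> gauss_density d z"
  by (simp add: gauss_density_def)

lemma gauss_density_even: "gauss_density d (x - y) = gauss_density d (y - x)"
  by (simp add: gauss_density_def normal_density_def power2_commute)

lemma gauss_density_le: "0 < d \<Longrightarrow> gauss_density d z \<le> 1 / (2 * pi * d)"
proof -
  assume d: "0 < d"
  have *: "normal_density 0 (sqrt d) x \<le> 1 / sqrt (2 * pi * d)" for x
    using d by (auto simp: normal_density_def intro!: divide_right_mono)
  have "gauss_density d z \<le> 1 / sqrt (2 * pi * d) * (1 / sqrt (2 * pi * d))"
    unfolding gauss_density_def using d by (intro mult_mono * ) auto
  also have "\<dots> = 1 / (2 * pi * d)" using d by simp
  finally show ?thesis .
qed

lemma lborel_complex: "lborel = distr (lborel \<Otimes>\<^sub>M lborel) borel (\<lambda>(x, y). Complex x y)"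
proof (rule lborel_eqI)
  fix l u :: complex
  assume *: "\<And>b. b \<in> Basis \<Longrightarrow> l \<bullet> b \<le> u \<bullet> b"
  have lu: "Re l \<le> Re u" "Im l \<le> Im u"
    using *[of 1] *[of \<i>] by (auto simp: Basis_complex_def)
  have "emeasure (distr (lborel \<Otimes>\<^sub>M lborel) borel (\<lambda>(x, y). Complex x y)) (box l u)
    = emeasure (lborel \<Otimes>\<^sub>M lborel) ((\<lambda>(x, y). Complex x y) -` box l u \<inter> space (lborel \<Otimes>\<^sub>M lborel))"
    by (subst emeasure_distr) auto
  also have "(\<lambda>(x, y). Complex x y) -` box l u \<inter> space (lborel \<Otimes>\<^sub>M lborel)
    = {Re l<..<Re u} \<times> {Im l<..<Im u}"
    by (auto simp: box_def Basis_complex_def space_pair_measure)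
  also have "emeasure (lborel \<Otimes>\<^sub>M lborel) \<dots> = ennreal (Re u - Re l) * ennreal (Im u - Im l)"
    using lu by (subst lborel.emeasure_pair_measure_Times) auto
  also have "\<dots> = (\<Prod>b\<in>Basis. (u - l) \<bullet> b)"
    using lu by (simp add: Basis_complex_def ennreal_mult)
  finally show "emeasure (distr (lborel \<Otimes>\<^sub>M lborel) borel (\<lambda>(x, y). Complex x y)) (box l u)
    = (\<Prod>b\<in>Basis. (u - l) \<bullet> b)" .
qed simp

lemma gauss_eq_distr:
  "gauss d = distr (density lborel (normal_density 0 (sqrt d)) \<Otimes>\<^sub>M density lborel (normal_density 0 (sqrt d)))
     borel (\<lambda>(x, y). Complex x y)" if "0 < d"
proof -
  let ?n = "\<lambda>x. ennreal (normal_density 0 (sqrt d) x)"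
  interpret N: prob_space "density lborel ?n" using that by (intro prob_space_normal_density) auto
  have "density lborel ?n \<Otimes>\<^sub>M density lborel ?n = density (lborel \<Otimes>\<^sub>M lborel) (\<lambda>(x, y). ?n x * ?n y)"
    by (intro pair_measure_density) (auto intro: lborel.sigma_finite_measure_axioms N.sigma_finite_measure_axioms)
  also have "\<dots> = density (lborel \<Otimes>\<^sub>M lborel) (\<lambda>p. ennreal (gauss_density d (case p of (x, y) \<Rightarrow> Complex x y)))"
    by (simp add: gauss_density_def ennreal_mult case_prod_unfold)
  finally show ?thesis
    unfolding gauss_def
    by (subst lborel_complex) (simp add: density_distr)
qed

lemma space_gauss [simp]: "space (gauss d) = UNIV"
  and sets_gauss [simp, measurable_cong]: "sets (gauss d) = sets borel"
  by (auto simp: gauss_def)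

lemma prob_space_gauss: "0 < d \<Longrightarrow> prob_space (gauss d)"
proof -
  assume d: "0 < d"
  let ?n = "density lborel (\<lambda>x. ennreal (normal_density 0 (sqrt d) x))"
  interpret N: prob_space ?n using d by (intro prob_space_normal_density) auto
  interpret P: pair_prob_space ?n ?n ..
  show ?thesis unfolding gauss_eq_distr[OF d] by (rule P.prob_space_distr) measurable
qed

section \<open>Planar Brownian motion\<close>

locale planar_BM =
  fixes M :: "'a measure" and W :: "real \<Rightarrow> 'a \<Rightarrow> complex"
  assumes BM: "std_complex_BM M W"
begin

lemma BM_Re: "std_real_BM M (\<lambda>t \<omega>. Re (W t \<omega>))" and BM_Im: "std_real_BM M (\<lambda>t \<omega>. Im (W t \<omega>))"
  using BM by (auto simp: std_complex_BM_def)

sublocale prob_space M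
  using BM_Re by (simp add: std_real_BM_def)

lemma measurable_W [measurable]: "0 \<le> t \<Longrightarrow> W t \<in> borel_measurable M"
  using BM_Re BM_Im by (subst borel_measurable_complex_iff) (auto simp: std_real_BM_def)

lemma continuous_path: "\<omega> \<in> space M \<Longrightarrow> continuous_on {0..} (\<lambda>t. W t \<omega>)"
proof -
  assume "\<omega> \<in> space M"
  then have "continuous_on {0..} (\<lambda>t. Re (W t \<omega>))" "continuous_on {0..} (\<lambda>t. Im (W t \<omega>))"
    using BM_Re BM_Im by (simp_all add: std_real_BM_def)
  then have "continuous_on {0..} (\<lambda>t. of_real (Re (W t \<omega>)) + \<i> * of_real (Im (W t \<omega>)))"
    by (intro continuous_on_add continuous_on_mult continuous_on_const continuous_on_of_real)
  then show ?thesis by (simp add: complex_eq[symmetric])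
qed

lemma AE_start: "AE \<omega> in M. W 0 \<omega> = 0"
proof -
  have "AE \<omega> in M. Re (W 0 \<omega>) = 0" "AE \<omega> in M. Im (W 0 \<omega>) = 0"
    using BM_Re BM_Im by (auto simp: std_real_BM_def)
  then show ?thesis by eventually_elim (simp add: complex_eq_iff)
qed

text \<open>Each of the two conditions involves one coordinate path only, and the coordinate paths are independent.\<close>

lemma prob_Re_Im:
  assumes J: "finite J" and st: "\<And>i. i \<in> J \<Longrightarrow> 0 \<le> s i \<and> 0 \<le> t i"
    and A: "\<And>i. i \<in> J \<Longrightarrow> A i \<in> sets borel" and B: "\<And>i. i \<in> J \<Longrightarrow> B i \<in> sets borel"
  shows "prob {\<omega> \<in> space M. (\<forall>i\<in>J. Re (W (t i) \<omega>) - Re (W (s i) \<omega>) \<in> A i) \<and>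
                            (\<forall>i\<in>J. Im (W (t i) \<omega>) - Im (W (s i) \<omega>) \<in> B i)}
     = prob {\<omega> \<in> space M. \<forall>i\<in>J. Re (W (t i) \<omega>) - Re (W (s i) \<omega>) \<in> A i} *
       prob {\<omega> \<in> space M. \<forall>i\<in>J. Im (W (t i) \<omega>) - Im (W (s i) \<omega>) \<in> B i}"
proof -
  let ?P = "Pi\<^sub>M {0..} (\<lambda>_. borel) :: (real \<Rightarrow> real) measure"
  have ind: "indep_var ?P (\<lambda>\<omega>. \<lambda>t\<in>{0..}. Re (W t \<omega>)) ?P (\<lambda>\<omega>. \<lambda>t\<in>{0..}. Im (W t \<omega>))"
    using BM by (simp add: std_complex_BM_def)
  have meas: "{x \<in> space ?P. \<forall>i\<in>J. x (t i) - x (s i) \<in> A' i} \<in> sets ?P"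
    if "\<And>i. i \<in> J \<Longrightarrow> A' i \<in> sets borel" for A' :: "_ \<Rightarrow> real set"
  proof -
    have [measurable]: "(\<lambda>x. x (t i)) \<in> borel_measurable ?P" "(\<lambda>x. x (s i)) \<in> borel_measurable ?P" "A' i \<in> sets borel"
      if "i \<in> J" for i
      using st[OF that] \<open>\<And>i. i \<in> J \<Longrightarrow> A' i \<in> sets borel\<close>[OF that]
      by (auto intro!: measurable_component_singleton)
    show ?thesis using J by measurable
  qed
  note * = indep_varD[OF ind meas[of A, OF A] meas[of B, OF B]]
  have 1: "(\<lambda>\<omega>. \<lambda>t\<in>{0..}. f (W t \<omega>)) -` {x \<in> space ?P. \<forall>i\<in>J. x (t i) - x (s i) \<in> A' i} \<inter> space M
     = {\<omega> \<in> space M. \<forall>i\<in>J. f (W (t i) \<omega>) - f (W (s i) \<omega>) \<in> A' i}"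
    for f and A' :: "_ \<Rightarrow> real set"
    using st by (auto simp: space_PiM)
  have 2: "(\<lambda>\<omega>. (\<lambda>t\<in>{0..}. Re (W t \<omega>), \<lambda>t\<in>{0..}. Im (W t \<omega>))) -`
     ({x \<in> space ?P. \<forall>i\<in>J. x (t i) - x (s i) \<in> A i} \<times> {x \<in> space ?P. \<forall>i\<in>J. x (t i) - x (s i) \<in> B i}) \<inter> space M
     = {\<omega> \<in> space M. (\<forall>i\<in>J. Re (W (t i) \<omega>) - Re (W (s i) \<omega>) \<in> A i) \<and>
                            (\<forall>i\<in>J. Im (W (t i) \<omega>) - Im (W (s i) \<omega>) \<in> B i)}"
    using st by (auto simp: space_PiM)
  show ?thesis using * unfolding 1 2 .
qed

lemma distr_increment:
  assumes "0 \<le> s" "s < t"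
  shows "distr M borel (\<lambda>\<omega>. W t \<omega> - W s \<omega>) = gauss (t - s)"
proof -
  let ?X = "\<lambda>\<omega>. Re (W t \<omega>) - Re (W s \<omega>)" and ?Y = "\<lambda>\<omega>. Im (W t \<omega>) - Im (W s \<omega>)"
  let ?N = "density lborel (normal_density 0 (sqrt (t - s)))"
  have m[measurable]: "W t \<in> borel_measurable M" "W s \<in> borel_measurable M" using assms by auto
  have X: "distr M borel ?X = ?N" and Y: "distr M borel ?Y = ?N"
    using BM_Re BM_Im assms by (auto simp: std_real_BM_def distributed_def cong: distr_cong)
  have "indep_var borel ?X borel ?Y"
    unfolding indep_var_distribution_eq
  proof (intro conjI pair_measure_eqI)
    fix A B :: "real set" assume "A \<in> sets (distr M borel ?X)" "B \<in> sets (distr M borel ?Y)"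
    then have [measurable]: "A \<in> sets borel" "B \<in> sets borel" by auto
    have "emeasure (distr M borel ?X) A * emeasure (distr M borel ?Y) B =
      ennreal (prob {\<omega>\<in>space M. ?X \<omega> \<in> A} * prob {\<omega>\<in>space M. ?Y \<omega> \<in> B})"
      by (simp add: emeasure_distr emeasure_eq_measure ennreal_mult vimage_def Int_def conj_commute)
    also have "\<dots> = ennreal (prob {\<omega>\<in>space M. ?X \<omega> \<in> A \<and> ?Y \<omega> \<in> B})"
      using prob_Re_Im[of "{()}" "\<lambda>_. s" "\<lambda>_. t" "\<lambda>_. A" "\<lambda>_. B"] assms by simp
    also have "\<dots> = emeasure (distr M (borel \<Otimes>\<^sub>M borel) (\<lambda>\<omega>. (?X \<omega>, ?Y \<omega>))) (A \<times> B)"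
      by (simp add: emeasure_distr emeasure_eq_measure vimage_def Int_def conj_commute)
    finally show "emeasure (distr M borel ?X) A * emeasure (distr M borel ?Y) B =
      emeasure (distr M (borel \<Otimes>\<^sub>M borel) (\<lambda>\<omega>. (?X \<omega>, ?Y \<omega>))) (A \<times> B)" .
  qed (auto intro!: prob_space_imp_sigma_finite prob_space_distr)
  then have "?N \<Otimes>\<^sub>M ?N = distr M (borel \<Otimes>\<^sub>M borel) (\<lambda>\<omega>. (?X \<omega>, ?Y \<omega>))"
    unfolding indep_var_distribution_eq X Y by simp
  then have "gauss (t - s) = distr (distr M (borel \<Otimes>\<^sub>M borel) (\<lambda>\<omega>. (?X \<omega>, ?Y \<omega>))) borel (\<lambda>(x, y). Complex x y)"
    using assms by (simp add: gauss_eq_distr)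
  also have "\<dots> = distr M borel (\<lambda>\<omega>. W t \<omega> - W s \<omega>)"
    by (subst distr_distr) (auto intro!: distr_cong simp: complex_eq_iff)
  finally show ?thesis by simp
qed

text \<open>Sets of the form \<open>{z. Re z \<in> A \<and> Im z \<in> B}\<close> are an intersection-stable generator of the Borel sets of
  the plane. On them independence reduces to that of the increments of each coordinate.\<close>

lemma indep_vars_increments:
  fixes t :: "nat \<Rightarrow> real"
  assumes t: "0 \<le> t 0" "mono t"
  shows "indep_vars (\<lambda>_. borel) (\<lambda>i \<omega>. W (t (Suc i)) \<omega> - W (t i) \<omega>) {..<n}"
proof (cases "n = 0")
  case True then show ?thesis by (simp add: indep_vars_def indep_sets_def)
next
  case False
  have t0: "0 \<le> t i" for i using t(1) monoD[OF t(2), of 0 i] by simp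
  note [measurable] = measurable_W[OF t0]
  let ?E = "{{z. Re z \<in> A \<and> Im z \<in> B} | A B. A \<in> sets borel \<and> B \<in> sets borel} :: complex set set"
  have E: "sets (borel :: complex measure) = sigma_sets UNIV ?E"
  proof (rule antisym)
    have "box l u \<in> ?E" for l u :: complex
      by (rule CollectI, rule exI[of _ "{Re l<..<Re u}"], rule exI[of _ "{Im l<..<Im u}"])
         (auto simp: box_def Basis_complex_def)
    then have "sigma_sets UNIV (range (\<lambda>(a, b). box a b)) \<subseteq> sigma_sets UNIV ?E"
      by (intro sigma_sets_mono') auto
    then show "sets (borel :: complex measure) \<subseteq> sigma_sets UNIV ?E"
      by (subst borel_eq_box) simp
    have "{z. Re z \<in> A \<and> Im z \<in> B} \<in> sets (borel :: complex measure)"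
      if [measurable]: "A \<in> sets borel" "B \<in> sets borel" for A B by measurable
    then have "?E \<subseteq> sets (borel :: complex measure)" by blast
    from sets.sigma_sets_subset[OF this]
    show "sigma_sets UNIV ?E \<subseteq> sets (borel :: complex measure)" unfolding space_borel .
  qed
  have ind: "indep_vars (\<lambda>_. borel) (\<lambda>i \<omega>. Re (W (t (Suc i)) \<omega>) - Re (W (t i) \<omega>)) {..<n}"
       "indep_vars (\<lambda>_. borel) (\<lambda>i \<omega>. Im (W (t (Suc i)) \<omega>) - Im (W (t i) \<omega>)) {..<n}"
    using BM_Re BM_Im t by (auto simp: std_real_BM_def)
  show ?thesis
  proof (subst indep_vars_finite[where E = "\<lambda>_. ?E"])
    show "Int_stable ?E"
    proof (rule Int_stableI, clarsimp)
      fix A B C D :: "real set" assume "A \<in> sets borel" "B \<in> sets borel" "C \<in> sets borel" "D \<in> sets borel"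
      then show "\<exists>A' B'. {z. Re z \<in> A \<and> Im z \<in> B} \<inter> {z. Re z \<in> C \<and> Im z \<in> D} = {z. Re z \<in> A' \<and> Im z \<in> B'} \<and>
            A' \<in> sets borel \<and> B' \<in> sets borel"
        by (intro exI[of _ "A \<inter> C"] exI[of _ "B \<inter> D"]) auto
    qed
    show "space borel \<in> ?E" by (auto intro!: exI[of _ UNIV])
    show "\<forall>A\<in>{..<n} \<rightarrow> ?E. prob (\<Inter>j\<in>{..<n}. (\<lambda>\<omega>. W (t (Suc j)) \<omega> - W (t j) \<omega>) -` A j \<inter> space M) =
         (\<Prod>j\<in>{..<n}. prob ((\<lambda>\<omega>. W (t (Suc j)) \<omega> - W (t j) \<omega>) -` A j \<inter> space M))"
    proof
      fix C assume "C \<in> {..<n} \<rightarrow> ?E"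
      then have "\<forall>i\<in>{..<n}. \<exists>A B. C i = {z. Re z \<in> A \<and> Im z \<in> B} \<and> A \<in> sets borel \<and> B \<in> sets borel"
        by auto
      then obtain A B where AB: "\<And>i. i < n \<Longrightarrow> C i = {z. Re z \<in> A i \<and> Im z \<in> B i}"
         "\<And>i. i < n \<Longrightarrow> A i \<in> sets borel" "\<And>i. i < n \<Longrightarrow> B i \<in> sets borel"
        unfolding bchoice_iff by auto
      let ?X = "\<lambda>i \<omega>. Re (W (t (Suc i)) \<omega>) - Re (W (t i) \<omega>)"
      let ?Y = "\<lambda>i \<omega>. Im (W (t (Suc i)) \<omega>) - Im (W (t i) \<omega>)"
      have "(\<Inter>j\<in>{..<n}. (\<lambda>\<omega>. W (t (Suc j)) \<omega> - W (t j) \<omega>) -` C j \<inter> space M)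
        = {\<omega>\<in>space M. (\<forall>i\<in>{..<n}. ?X i \<omega> \<in> A i) \<and> (\<forall>i\<in>{..<n}. ?Y i \<omega> \<in> B i)}"
        using False AB by auto
      also have "prob \<dots> = prob {\<omega>\<in>space M. \<forall>i\<in>{..<n}. ?X i \<omega> \<in> A i} * prob {\<omega>\<in>space M. \<forall>i\<in>{..<n}. ?Y i \<omega> \<in> B i}"
        using AB t0 by (intro prob_Re_Im) auto
      also have "{\<omega>\<in>space M. \<forall>i\<in>{..<n}. ?X i \<omega> \<in> A i} = (\<Inter>i\<in>{..<n}. ?X i -` A i \<inter> space M)"
        using False by auto
      also have "prob \<dots> = (\<Prod>i<n. prob (?X i -` A i \<inter> space M))"
        using False AB by (intro indep_varsD[OF ind(1)]) auto
      also have "{\<omega>\<in>space M. \<forall>i\<in>{..<n}. ?Y i \<omega> \<in> B i} = (\<Inter>i\<in>{..<n}. ?Y i -` B i \<inter> space M)"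
        using False by auto
      also have "prob \<dots> = (\<Prod>i<n. prob (?Y i -` B i \<inter> space M))"
        using False AB by (intro indep_varsD[OF ind(2)]) auto
      also have "(\<Prod>i<n. prob (?X i -` A i \<inter> space M)) * (\<Prod>i<n. prob (?Y i -` B i \<inter> space M))
         = (\<Prod>i<n. prob ((\<lambda>\<omega>. W (t (Suc i)) \<omega> - W (t i) \<omega>) -` C i \<inter> space M))"
      proof (subst prod.distrib[symmetric], intro prod.cong refl)
        fix i assume "i \<in> {..<n}"
        then show "prob (?X i -` A i \<inter> space M) * prob (?Y i -` B i \<inter> space M) =
             prob ((\<lambda>\<omega>. W (t (Suc i)) \<omega> - W (t i) \<omega>) -` C i \<inter> space M)"
          using prob_Re_Im[of "{i}" t "\<lambda>i. t (Suc i)" A B] AB t0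
          by (simp add: vimage_def Int_def conj_commute)
      qed
      finally show "prob (\<Inter>j\<in>{..<n}. (\<lambda>\<omega>. W (t (Suc j)) \<omega> - W (t j) \<omega>) -` C j \<inter> space M) =
         (\<Prod>j\<in>{..<n}. prob ((\<lambda>\<omega>. W (t (Suc j)) \<omega> - W (t j) \<omega>) -` C j \<inter> space M))" .
    qed
  qed (use False E in auto)
qed


section \<open>The Markov property\<close>

text \<open>A measure space for the sigma-algebra of the past, so that it can serve as the domain of measurable functions.\<close>

definition history :: "real \<Rightarrow> 'a measure" where
  "history s = sigma (space M) {W r -` A \<inter> space M | r A. r \<in> {0..s} \<and> A \<in> sets borel}"

text \<open>An intersection-stable generator of \<open>history s\<close>.\<close>

definition cylinders :: "real \<Rightarrow> 'a set set" where
  "cylinders s = {{\<omega> \<in> space M. \<forall>r\<in>R. W r \<omega> \<in> A r} | R A. finite R \<and> R \<subseteq> {0..s} \<and> (\<forall>r. A r \<in> sets borel)}"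

lemma space_history [simp]: "space (history s) = space M"
  by (simp add: history_def space_measure_of_conv)

lemma sets_history: "sets (history s) = sigma_sets (space M) {W r -` A \<inter> space M | r A. r \<in> {0..s} \<and> A \<in> sets borel}"
  unfolding history_def by (subst sets_measure_of) auto

lemma measurable_history_W: "r \<in> {0..s} \<Longrightarrow> W r \<in> borel_measurable (history s)"
  by (rule measurableI) (auto simp: sets_history)

lemma space_in_history: "space M \<in> sets (history s)"
  using sets.top[of "history s"] by simp

lemma history_mono: "s \<le> t \<Longrightarrow> sets (history s) \<subseteq> sets (history t)"
  unfolding sets_history by (rule sigma_sets_mono') force

lemma history_events: "sets (history s) \<subseteq> events"
  unfolding sets_history by (rule sets.sigma_sets_subset) (auto intro!: measurable_sets)

lemma history_sets: "H \<in> sets (history s) \<Longrightarrow> H \<in> events"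
  using history_events by auto

lemma Int_stable_cylinders: "Int_stable (cylinders s)"
proof (rule Int_stableI)
  fix a b assume "a \<in> cylinders s" "b \<in> cylinders s"
  then obtain R A S B where "a = {\<omega> \<in> space M. \<forall>r\<in>R. W r \<omega> \<in> A r}" "finite R" "R \<subseteq> {0..s}" "\<forall>r. A r \<in> sets borel"
     and "b = {\<omega> \<in> space M. \<forall>r\<in>S. W r \<omega> \<in> B r}" "finite S" "S \<subseteq> {0..s}" "\<forall>r. B r \<in> sets borel"
    unfolding cylinders_def by auto
  then show "a \<inter> b \<in> cylinders s"
    unfolding cylinders_def
    by (intro CollectI exI[of _ "R \<union> S"] exI[of _ "\<lambda>r. (if r \<in> R then A r else UNIV) \<inter> (if r \<in> S then B r else UNIV)"])
       (auto split: if_splits)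
qed

lemma sets_history_cylinders: "sets (history s) \<subseteq> sigma_sets (space M) (cylinders s)"
proof -
  have "W r -` A \<inter> space M \<in> cylinders s" if "r \<in> {0..s}" "A \<in> sets borel" for r A
    unfolding cylinders_def using that
    by (intro CollectI exI[of _ "{r}"] exI[of _ "\<lambda>_. A"]) auto
  then show ?thesis unfolding sets_history by (intro sigma_sets_mono') auto
qed

lemma cylinders_events: "cylinders s \<subseteq> events"
proof
  fix a assume "a \<in> cylinders s"
  then obtain R A where a: "a = {\<omega> \<in> space M. \<forall>r\<in>R. W r \<omega> \<in> A r}" "finite R" "R \<subseteq> {0..s}" "\<forall>r. A r \<in> sets borel"
    unfolding cylinders_def by auto
  then have [measurable]: "W r \<in> borel_measurable M" "A r \<in> sets borel" if "r \<in> R" for r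
    using that by auto
  show "a \<in> events" unfolding a(1) using a(2) by measurable
qed

text \<open>List the finitely many observation times in order, together with \<open>0\<close> and \<open>s\<close>. Almost surely the path
  starts at \<open>0\<close>, so its values at these times are sums of increments up to time \<open>s\<close>, and these are
  independent of the increment from \<open>s\<close> to \<open>t\<close>.\<close>

lemma cylinder_indep_increment:
  assumes s: "0 \<le> s" "s < t" and C: "C \<in> cylinders s" and B [measurable]: "B \<in> sets borel"
  shows "prob (C \<inter> ((\<lambda>\<omega>. W t \<omega> - W s \<omega>) -` B \<inter> space M)) = prob C * prob ((\<lambda>\<omega>. W t \<omega> - W s \<omega>) -` B \<inter> space M)"
proof -
  obtain R A where R: "finite R" "R \<subseteq> {0..s}" and A[measurable]: "\<And>r. A r \<in> sets borel"
    and Ceq: "C = {\<omega> \<in> space M. \<forall>r\<in>R. W r \<omega> \<in> A r}"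
    using C unfolding cylinders_def by auto
  define L where "L = sorted_list_of_set (insert 0 (insert s R))"
  have L: "set L = insert 0 (insert s R)" "sorted L"
    unfolding L_def using R by (subst set_sorted_list_of_set; simp) (rule sorted_sorted_list_of_set)
  define n where "n = length L - 1"
  have len: "length L = Suc n" using L(1) by (cases L) (auto simp: n_def)
  define \<tau> where "\<tau> k = (if k \<le> n then L ! k else t)" for k
  have Lle: "0 \<le> L ! k" "L ! k \<le> s" if "k \<le> n" for k
    using nth_mem[of k L] that len L(1) R s by auto
  have \<tau>_mono: "mono \<tau>"
    by (rule monoI) (use L(2) len s Lle(2) in \<open>force simp: \<tau>_def sorted_nth_mono\<close>)
  have idx: "\<exists>k\<le>n. \<tau> k = r" if "r \<in> insert 0 (insert s R)" for r
    using that unfolding L(1)[symmetric] in_set_conv_nth by (auto simp: \<tau>_def len less_Suc_eq_le)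
  have \<tau>0: "\<tau> 0 = 0"
  proof -
    obtain k where "k \<le> n" "\<tau> k = 0" using idx[of 0] by auto
    then show ?thesis using monoD[OF \<tau>_mono, of 0 k] Lle(1)[of 0] by (simp add: \<tau>_def)
  qed
  have \<tau>n: "\<tau> n = s"
  proof -
    obtain k where "k \<le> n" "\<tau> k = s" using idx[of s] by auto
    then show ?thesis using monoD[OF \<tau>_mono, of k n] Lle(2)[of n] by (simp add: \<tau>_def)
  qed
  have \<tau>Sn: "\<tau> (Suc n) = t" by (simp add: \<tau>_def)
  have \<tau>_nonneg: "0 \<le> \<tau> k" for k using monoD[OF \<tau>_mono, of 0 k] \<tau>0 by simp
  note [measurable] = measurable_W[OF \<tau>_nonneg]
  have [measurable]: "W 0 \<in> borel_measurable M" "W s \<in> borel_measurable M" "W t \<in> borel_measurable M"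
    using s by auto
  obtain \<iota> where \<iota>: "\<And>r. r \<in> R \<Longrightarrow> \<iota> r \<le> n \<and> \<tau> (\<iota> r) = r"
    using idx by (metis insertCI)
  define X where "X i \<omega> = W (\<tau> (Suc i)) \<omega> - W (\<tau> i) \<omega>" for i \<omega>
  have tele: "W (\<tau> k) \<omega> = W 0 \<omega> + (\<Sum>i<k. X i \<omega>)" for k \<omega>
    unfolding X_def by (subst sum_lessThan_telescope) (simp add: \<tau>0)
  have [measurable]: "X i \<in> borel_measurable M" for i unfolding X_def by measurable
  have "indep_vars (\<lambda>_. borel) X {..<Suc n}"
    unfolding X_def[abs_def] by (rule indep_vars_increments) (use \<tau>0 \<tau>_mono in auto)
  then have ind: "indep_var (Pi\<^sub>M {..<n} (\<lambda>_. borel)) (\<lambda>\<omega>. restrict (\<lambda>i. X i \<omega>) {..<n})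
      (Pi\<^sub>M {n} (\<lambda>_. borel)) (\<lambda>\<omega>. restrict (\<lambda>i. X i \<omega>) {n})"
    by (rule indep_var_restrict) auto
  let ?XA = "{x \<in> space (Pi\<^sub>M {..<n} (\<lambda>_. borel)). \<forall>r\<in>R. (\<Sum>i<\<iota> r. x i) \<in> A r}"
  let ?XB = "{x \<in> space (Pi\<^sub>M {n} (\<lambda>_. borel)). x n \<in> B}"
  have 1: "?XA \<in> sets (Pi\<^sub>M {..<n} (\<lambda>_. borel))"
  proof -
    have [measurable]: "(\<lambda>x. \<Sum>i<\<iota> r. x i) \<in> borel_measurable (Pi\<^sub>M {..<n} (\<lambda>_. borel :: complex measure))" if "r \<in> R" for r
      using \<iota>[OF that] by (intro borel_measurable_sum measurable_component_singleton) auto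
    show ?thesis using R(1) by measurable
  qed
  have 2: "?XB \<in> sets (Pi\<^sub>M {n} (\<lambda>_. borel))" by measurable
  define C' where "C' = {\<omega> \<in> space M. \<forall>r\<in>R. (\<Sum>i<\<iota> r. X i \<omega>) \<in> A r}"
  have Ce: "C \<in> events" using C cylinders_events by (rule subsetD[rotated])
  have eqs: "(\<lambda>\<omega>. restrict (\<lambda>i. X i \<omega>) {..<n}) -` ?XA \<inter> space M = C'"
    "(\<lambda>\<omega>. restrict (\<lambda>i. X i \<omega>) {n}) -` ?XB \<inter> space M = (\<lambda>\<omega>. W t \<omega> - W s \<omega>) -` B \<inter> space M"
    "(\<lambda>\<omega>. (restrict (\<lambda>i. X i \<omega>) {..<n}, restrict (\<lambda>i. X i \<omega>) {n})) -` (?XA \<times> ?XB) \<inter> space M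
      = C' \<inter> ((\<lambda>\<omega>. W t \<omega> - W s \<omega>) -` B \<inter> space M)"
  proof -
    have *: "(restrict (\<lambda>i. X i \<omega>) {..<n} \<in> ?XA) = (\<forall>r\<in>R. (\<Sum>i<\<iota> r. X i \<omega>) \<in> A r)" for \<omega>
    proof -
      have "(\<Sum>i<\<iota> r. restrict (\<lambda>i. X i \<omega>) {..<n} i) = (\<Sum>i<\<iota> r. X i \<omega>)" if "r \<in> R" for r
        using \<iota>[OF that] by (intro sum.cong) auto
      moreover have "restrict (\<lambda>i. X i \<omega>) {..<n} \<in> space (Pi\<^sub>M {..<n} (\<lambda>_. borel))"
        by (simp add: space_PiM)
      ultimately show ?thesis by (simp del: restrict_apply)
    qed
    have **: "(restrict (\<lambda>i. X i \<omega>) {n} \<in> ?XB) = (W t \<omega> - W s \<omega> \<in> B)" for \<omega>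
      by (simp add: space_PiM X_def \<tau>n \<tau>Sn)
    show "(\<lambda>\<omega>. restrict (\<lambda>i. X i \<omega>) {..<n}) -` ?XA \<inter> space M = C'"
      "(\<lambda>\<omega>. restrict (\<lambda>i. X i \<omega>) {n}) -` ?XB \<inter> space M = (\<lambda>\<omega>. W t \<omega> - W s \<omega>) -` B \<inter> space M"
      "(\<lambda>\<omega>. (restrict (\<lambda>i. X i \<omega>) {..<n}, restrict (\<lambda>i. X i \<omega>) {n})) -` (?XA \<times> ?XB) \<inter> space M
      = C' \<inter> ((\<lambda>\<omega>. W t \<omega> - W s \<omega>) -` B \<inter> space M)"
      unfolding set_eq_iff Int_iff vimage_eq mem_Sigma_iff * **
      unfolding C'_def mem_Collect_eq by blast+
  qed
  have C'e: "C' \<in> events"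
    unfolding eqs(1)[symmetric] by (rule measurable_sets[OF indep_var_rv1[OF ind] 1])
  from indep_varD[OF ind 1 2, unfolded eqs]
  have 3: "prob (C' \<inter> ((\<lambda>\<omega>. W t \<omega> - W s \<omega>) -` B \<inter> space M)) = prob C' * prob ((\<lambda>\<omega>. W t \<omega> - W s \<omega>) -` B \<inter> space M)"
 .
  have Be: "(\<lambda>\<omega>. W t \<omega> - W s \<omega>) -` B \<inter> space M \<in> events" by (intro measurable_sets[OF _ B]) simp
  have AE: "AE \<omega> in M. \<omega> \<in> C \<longleftrightarrow> \<omega> \<in> C'"
    using AE_start
  proof eventually_elim
    case (elim \<omega>)
    have "W r \<omega> = (\<Sum>i<\<iota> r. X i \<omega>)" if "r \<in> R" for r
      using tele[of "\<iota> r" \<omega>] \<iota>[OF that] elim by simp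
    then show ?case by (auto simp: Ceq C'_def)
  qed
  have "prob C = prob C'"
    using AE Ce C'e by (intro finite_measure_eq_AE) auto
  moreover have "prob (C \<inter> ((\<lambda>\<omega>. W t \<omega> - W s \<omega>) -` B \<inter> space M)) = prob (C' \<inter> ((\<lambda>\<omega>. W t \<omega> - W s \<omega>) -` B \<inter> space M))"
    using AE Ce C'e Be by (intro finite_measure_eq_AE) auto
  ultimately show ?thesis using 3 by simp
qed

lemma history_indep_increment:
  assumes s: "0 \<le> s" "s < t" and H: "H \<in> sets (history s)" and B: "B \<in> sets borel"
  shows "prob (H \<inter> ((\<lambda>\<omega>. W t \<omega> - W s \<omega>) -` B \<inter> space M)) = prob H * prob ((\<lambda>\<omega>. W t \<omega> - W s \<omega>) -` B \<inter> space M)"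
proof -
  let ?D = "{(\<lambda>\<omega>. W t \<omega> - W s \<omega>) -` B \<inter> space M | B. B \<in> sets borel}"
  have [measurable]: "W s \<in> borel_measurable M" "W t \<in> borel_measurable M" using s by auto
  have "indep_set (cylinders s) ?D"
    using cylinders_events s by (intro indep_setI) (auto intro!: cylinder_indep_increment)
  moreover have "Int_stable ?D"
  proof (rule Int_stableI, clarsimp)
    fix B B' :: "complex set" assume "B \<in> sets borel" "B' \<in> sets borel"
    then show "\<exists>Ba. (\<lambda>\<omega>. W t \<omega> - W s \<omega>) -` B \<inter> space M \<inter> ((\<lambda>\<omega>. W t \<omega> - W s \<omega>) -` B' \<inter> space M) =
            (\<lambda>\<omega>. W t \<omega> - W s \<omega>) -` Ba \<inter> space M \<and> Ba \<in> sets borel"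
      by (intro exI[of _ "B \<inter> B'"]) auto
  qed
  ultimately have "indep_set (sigma_sets (space M) (cylinders s)) (sigma_sets (space M) ?D)"
    by (intro indep_set_sigma_sets Int_stable_cylinders)
  then show ?thesis
    by (rule indep_setD) (use subsetD[OF sets_history_cylinders H] B in \<open>auto intro!: sigma_sets.Basic\<close>)
qed

text \<open>The Markov property: restricted to an event of the past, the present position and the next increment
  are independent. The two lemmas after this one are its integrated forms.\<close>

lemma markov_distr:
  assumes s: "0 \<le> s" "s < t" and H: "H \<in> sets (history s)"
  shows "distr (density M (indicator H)) (borel \<Otimes>\<^sub>M borel) (\<lambda>\<omega>. (W s \<omega>, W t \<omega> - W s \<omega>))
    = distr (density M (indicator H)) borel (W s) \<Otimes>\<^sub>M gauss (t - s)"
proof (rule pair_measure_eqI[symmetric])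
  have [measurable]: "W s \<in> borel_measurable M" "W t \<in> borel_measurable M" "H \<in> events"
    using s history_sets[OF H] by auto
  interpret G: prob_space "gauss (t - s)" using s by (intro prob_space_gauss) auto
  show "sigma_finite_measure (gauss (t - s))" by (rule G.sigma_finite_measure_axioms)
  show "sigma_finite_measure (distr (density M (indicator H)) borel (W s))"
  proof (intro finite_measure.sigma_finite_measure finite_measureI)
    show "emeasure (distr (density M (indicator H)) borel (W s)) (space (distr (density M (indicator H)) borel (W s))) \<noteq> \<infinity>"
      by (simp add: emeasure_distr emeasure_restricted emeasure_eq_measure)
  qed
  fix A B assume "A \<in> sets (distr (density M (indicator H)) borel (W s))" "B \<in> sets (gauss (t - s))"
  then have [measurable]: "A \<in> sets borel" "B \<in> sets borel" by auto
  let ?X = "(\<lambda>\<omega>. W t \<omega> - W s \<omega>) -` B \<inter> space M"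
  have HA: "H \<inter> (W s -` A \<inter> space M) \<in> sets (history s)"
    using H measurable_sets[OF measurable_history_W[of s s], of A] s by (auto intro!: sets.Int)
  have "emeasure (distr (density M (indicator H)) borel (W s)) A = emeasure M (H \<inter> (W s -` A \<inter> space M))"
    by (simp add: emeasure_distr emeasure_restricted)
  moreover have "emeasure (gauss (t - s)) B = emeasure M ?X"
    unfolding distr_increment[OF s, symmetric] by (simp add: emeasure_distr)
  moreover have "emeasure (distr (density M (indicator H)) (borel \<Otimes>\<^sub>M borel) (\<lambda>\<omega>. (W s \<omega>, W t \<omega> - W s \<omega>))) (A \<times> B)
    = emeasure M (H \<inter> ((\<lambda>\<omega>. (W s \<omega>, W t \<omega> - W s \<omega>)) -` (A \<times> B) \<inter> space M))"
    by (simp add: emeasure_distr emeasure_restricted)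
  moreover have "H \<inter> ((\<lambda>\<omega>. (W s \<omega>, W t \<omega> - W s \<omega>)) -` (A \<times> B) \<inter> space M) = (H \<inter> (W s -` A \<inter> space M)) \<inter> ?X"
    by auto
  ultimately show "emeasure (distr (density M (indicator H)) borel (W s)) A * emeasure (gauss (t - s)) B =
    emeasure (distr (density M (indicator H)) (borel \<Otimes>\<^sub>M borel) (\<lambda>\<omega>. (W s \<omega>, W t \<omega> - W s \<omega>))) (A \<times> B)"
    using history_indep_increment[OF s HA, of B]
    by (simp add: emeasure_eq_measure ennreal_mult)
qed simp

lemma markov_nn_integral:
  assumes s: "0 \<le> s" "s < t" and H: "H \<in> sets (history s)"
    and G [measurable]: "G \<in> borel_measurable (borel \<Otimes>\<^sub>M borel)"
  shows "(\<integral>\<^sup>+\<omega>. indicator H \<omega> * G (W s \<omega>, W t \<omega> - W s \<omega>) \<partial>M)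
    = (\<integral>\<^sup>+\<omega>. indicator H \<omega> * (\<integral>\<^sup>+y. G (W s \<omega>, y) \<partial>gauss (t - s)) \<partial>M)"
proof -
  have [measurable]: "W s \<in> borel_measurable M" "W t \<in> borel_measurable M" "H \<in> events"
    using s history_sets[OF H] by auto
  interpret G: prob_space "gauss (t - s)" using s by (intro prob_space_gauss) auto
  let ?M = "density M (indicator H)"
  have "(\<integral>\<^sup>+\<omega>. indicator H \<omega> * G (W s \<omega>, W t \<omega> - W s \<omega>) \<partial>M)
    = (\<integral>\<^sup>+p. G p \<partial>distr ?M (borel \<Otimes>\<^sub>M borel) (\<lambda>\<omega>. (W s \<omega>, W t \<omega> - W s \<omega>)))"
    by (simp add: nn_integral_distr nn_integral_density)
  also have "\<dots> = (\<integral>\<^sup>+x. \<integral>\<^sup>+y. G (x, y) \<partial>gauss (t - s) \<partial>distr ?M borel (W s))"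
    unfolding markov_distr[OF s H] by (rule G.nn_integral_fst[symmetric]) simp
  also have "\<dots> = (\<integral>\<^sup>+\<omega>. indicator H \<omega> * (\<integral>\<^sup>+y. G (W s \<omega>, y) \<partial>gauss (t - s)) \<partial>M)"
    by (simp add: nn_integral_distr nn_integral_density)
  finally show ?thesis .
qed

lemma markov_integral:
  fixes G :: "complex \<times> complex \<Rightarrow> real"
  assumes s: "0 \<le> s" "s < t" and H: "H \<in> sets (history s)"
    and G [measurable]: "G \<in> borel_measurable (borel \<Otimes>\<^sub>M borel)"
    and int: "integrable M (\<lambda>\<omega>. G (W s \<omega>, W t \<omega> - W s \<omega>))"
  shows "integrable M (\<lambda>\<omega>. indicator H \<omega> * (\<integral>y. G (W s \<omega>, y) \<partial>gauss (t - s)))" (is ?A)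
    and "(\<integral>\<omega>. indicator H \<omega> * G (W s \<omega>, W t \<omega> - W s \<omega>) \<partial>M)
    = (\<integral>\<omega>. indicator H \<omega> * (\<integral>y. G (W s \<omega>, y) \<partial>gauss (t - s)) \<partial>M)" (is ?B)
proof -
  have [measurable]: "W s \<in> borel_measurable M" "W t \<in> borel_measurable M" "H \<in> events"
    using s history_sets[OF H] by auto
  interpret G: prob_space "gauss (t - s)" using s by (intro prob_space_gauss) auto
  let ?M = "density M (\<lambda>\<omega>. ennreal (indicator H \<omega>))"
  have ind: "?M = density M (indicator H)" by (rule density_cong) (auto simp: indicator_def)
  interpret X: finite_measure "distr ?M borel (W s)"
    by (rule finite_measureI) (simp add: ind emeasure_distr emeasure_restricted emeasure_eq_measure)
  interpret P: pair_sigma_finite "distr ?M borel (W s)" "gauss (t - s)" ..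
  have "integrable M (\<lambda>\<omega>. indicator H \<omega> * G (W s \<omega>, W t \<omega> - W s \<omega>))"
    by (rule Bochner_Integration.integrable_bound[OF int]) (auto simp: indicator_def)
  then have "integrable (distr ?M (borel \<Otimes>\<^sub>M borel) (\<lambda>\<omega>. (W s \<omega>, W t \<omega> - W s \<omega>))) G"
    by (subst integrable_distr_eq) (auto simp: integrable_density)
  then have I: "integrable (distr ?M borel (W s) \<Otimes>\<^sub>M gauss (t - s)) G"
    using markov_distr[OF s H] unfolding ind by simp
  show ?A
    using P.integrable_fst'[OF I] by (subst (asm) integrable_distr_eq) (auto simp: integrable_density)
  have "(\<integral>\<omega>. indicator H \<omega> * G (W s \<omega>, W t \<omega> - W s \<omega>) \<partial>M)
    = (\<integral>p. G p \<partial>distr ?M (borel \<Otimes>\<^sub>M borel) (\<lambda>\<omega>. (W s \<omega>, W t \<omega> - W s \<omega>)))"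
    by (simp add: integral_distr integral_density)
  also have "\<dots> = (\<integral>p. G p \<partial>(distr ?M borel (W s) \<Otimes>\<^sub>M gauss (t - s)))"
    using markov_distr[OF s H] unfolding ind by simp
  also have "\<dots> = (\<integral>x. \<integral>y. G (x, y) \<partial>gauss (t - s) \<partial>distr ?M borel (W s))"
    by (rule P.integral_fst'[OF I, symmetric])
  also have "\<dots> = (\<integral>\<omega>. indicator H \<omega> * (\<integral>y. G (W s \<omega>, y) \<partial>gauss (t - s)) \<partial>M)"
    by (simp add: integral_distr integral_density)
  finally show ?B .
qed

end

section \<open>Gaussian averages of trigonometric and exponential functions\<close>

lemma cos_mult_abs: "cos (c * \<bar>x\<bar>) = cos (c * x)" for c x :: real
  by (auto simp: abs_if)

lemma exp_abs_le_cosh: "exp \<bar>x\<bar> \<le> 2 * cosh x" for x :: real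
  by (cases "0 \<le> x") (auto simp: cosh_field_def)

abbreviation normal :: "real \<Rightarrow> real measure" where
  "normal d \<equiv> density lborel (\<lambda>x. ennreal (normal_density 0 (sqrt d) x))"

lemma gauss_product:
  fixes f g :: "real \<Rightarrow> real"
  assumes d: "0 < d" and f: "integrable (normal d) f" and g: "integrable (normal d) g"
  shows "has_bochner_integral (gauss d) (\<lambda>z. f (Re z) * g (Im z)) ((\<integral>x. f x \<partial>normal d) * (\<integral>x. g x \<partial>normal d))"
proof -
  interpret N: prob_space "normal d" using d by (intro prob_space_normal_density) auto
  interpret P: pair_prob_space "normal d" "normal d" ..
  have [measurable]: "f \<in> borel_measurable borel" "g \<in> borel_measurable borel"
    using f g by (auto dest: borel_measurable_integrable)
  have I: "integrable (normal d \<Otimes>\<^sub>M normal d) (\<lambda>p. f (fst p) * g (snd p))"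
    by (rule P.Fubini_integrable) (use f g in \<open>auto simp: abs_mult\<close>)
  have "integrable (gauss d) (\<lambda>z. f (Re z) * g (Im z))"
    unfolding gauss_eq_distr[OF d] using I by (subst integrable_distr_eq) (auto simp: case_prod_unfold)
  moreover have "(\<integral>z. f (Re z) * g (Im z) \<partial>gauss d) = (\<integral>x. f x \<partial>normal d) * (\<integral>x. g x \<partial>normal d)"
  proof -
    have "(\<integral>z. f (Re z) * g (Im z) \<partial>gauss d) = (\<integral>p. f (fst p) * g (snd p) \<partial>(normal d \<Otimes>\<^sub>M normal d))"
      unfolding gauss_eq_distr[OF d] by (subst integral_distr) (auto simp: case_prod_unfold)
    also have "\<dots> = (\<integral>x. (\<integral>y. f x * g y \<partial>normal d) \<partial>normal d)"
      using P.integral_fst'[OF I] by simp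
    finally show ?thesis by simp
  qed
  ultimately show ?thesis by (simp add: has_bochner_integral_iff)
qed

lemma normal_exp:
  assumes d: "0 < d"
  shows "has_bochner_integral (normal d) (\<lambda>x. exp (c * x)) (exp (c\<^sup>2 * d / 2))"
proof -
  have eq: "normal_density 0 (sqrt d) x * exp (c * x) = exp (c\<^sup>2 * d / 2) * normal_density (c * d) (sqrt d) x" for x
  proof -
    have "- (x\<^sup>2 / (2 * d)) + c * x = c\<^sup>2 * d / 2 - (x - c * d)\<^sup>2 / (2 * d)"
      using d by (simp add: field_simps power2_eq_square)
    then show ?thesis using d by (simp add: normal_density_def exp_add[symmetric] field_simps)
  qed
  have "has_bochner_integral lborel (\<lambda>x. exp (c\<^sup>2 * d / 2) * normal_density (c * d) (sqrt d) x) (exp (c\<^sup>2 * d / 2) * 1)"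
    using d by (intro has_bochner_integral_mult_right) (auto simp: has_bochner_integral_iff)
  then show ?thesis
    using d by (intro has_bochner_integral_density) (auto simp: eq)
qed

lemma normal_cos_sin:
  assumes d: "0 < d"
  shows "has_bochner_integral (normal d) (\<lambda>x. cos (c * x)) (exp (- c\<^sup>2 * d / 2))"
    and "has_bochner_integral (normal d) (\<lambda>x. sin (c * x)) 0"
proof -
  interpret S: prob_space std_normal_distribution by (rule prob_space_normal_density) simp
  have N: "normal d = distr std_normal_distribution borel (\<lambda>x. sqrt d * x)"
  proof -
    have "distributed std_normal_distribution lborel (\<lambda>x. 0 + sqrt d * x) (normal_density (0 + sqrt d * 0) (\<bar>sqrt d\<bar> * 1))"
      using d by (intro S.normal_density_affine) (auto simp: distributed_def intro!: distr_id2)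
    then show ?thesis using d by (simp add: distributed_def cong: distr_cong)
  qed
  have "char std_normal_distribution (c * sqrt d) = complex_of_real (exp (- (c\<^sup>2 * d) / 2))"
    using d by (simp add: char_std_normal_distribution power_mult_distrib)
  then have *: "(CLINT x|normal d. iexp (c * x)) = complex_of_real (exp (- (c\<^sup>2 * d) / 2))"
    unfolding N char_def by (subst integral_distr) (auto simp: mult_ac)
  interpret N: prob_space "normal d" using d by (intro prob_space_normal_density) auto
  have I: "complex_integrable (normal d) (\<lambda>x. iexp (c * x))"
    by (rule N.integrable_const_bound[of _ 1]) auto
  have "integrable (normal d) (\<lambda>x. cos (c * x))" "integrable (normal d) (\<lambda>x. sin (c * x))"
    by (auto intro!: N.integrable_const_bound[of _ 1])
  moreover have "(\<integral>x. cos (c * x) \<partial>normal d) = exp (- c\<^sup>2 * d / 2)"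
    using integral_Re[OF I] * by (simp add: Re_exp)
  moreover have "(\<integral>x. sin (c * x) \<partial>normal d) = 0"
    using integral_Im[OF I] * by (simp add: Im_exp)
  ultimately show "has_bochner_integral (normal d) (\<lambda>x. cos (c * x)) (exp (- c\<^sup>2 * d / 2))"
    "has_bochner_integral (normal d) (\<lambda>x. sin (c * x)) 0"
    by (auto simp: has_bochner_integral_iff)
qed

text \<open>Eigenfunctions of averaging over all centred normal distributions. A product of two of them, one in each
  coordinate, turns into a martingale along planar Brownian motion when it is multiplied by an exponential function of time.\<close>

definition normal_eigen :: "real \<Rightarrow> (real \<Rightarrow> real) \<Rightarrow> bool" where
  "normal_eigen \<kappa> f \<longleftrightarrow> continuous_on UNIV f \<and> (\<forall>d>0. \<forall>x. has_bochner_integral (normal d) (\<lambda>y. f (x + y)) (exp (\<kappa> * d) * f x))"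

lemma normal_eigen_cos: "normal_eigen (- c\<^sup>2 / 2) (\<lambda>x. cos (c * x + p))"
  unfolding normal_eigen_def
proof (intro conjI allI impI)
  fix d x :: real assume d: "0 < d"
  have "has_bochner_integral (normal d) (\<lambda>y. cos (c * x + p) * cos (c * y) - sin (c * x + p) * sin (c * y))
    (cos (c * x + p) * exp (- c\<^sup>2 * d / 2) - sin (c * x + p) * 0)"
    using normal_cos_sin[OF d] by (intro has_bochner_integral_diff has_bochner_integral_mult_right) auto
  moreover have "cos (c * (x + y) + p) = cos (c * x + p) * cos (c * y) - sin (c * x + p) * sin (c * y)" for y
  proof -
    have "c * (x + y) + p = (c * x + p) + c * y" by (simp add: algebra_simps)
    then show ?thesis by (simp only: cos_add)
  qed
  ultimately show "has_bochner_integral (normal d) (\<lambda>y. cos (c * (x + y) + p)) (exp (- c\<^sup>2 / 2 * d) * cos (c * x + p))"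
    by (simp add: mult.commute)
qed (intro continuous_intros)

lemma normal_eigen_exp: "normal_eigen (c\<^sup>2 / 2) (\<lambda>x. exp (c * x))"
  unfolding normal_eigen_def
proof (intro conjI allI impI)
  fix d x :: real assume d: "0 < d"
  have "has_bochner_integral (normal d) (\<lambda>y. exp (c * x) * exp (c * y)) (exp (c * x) * exp (c\<^sup>2 * d / 2))"
    using normal_exp[OF d] by (intro has_bochner_integral_mult_right) auto
  then show "has_bochner_integral (normal d) (\<lambda>y. exp (c * (x + y))) (exp (c\<^sup>2 / 2 * d) * exp (c * x))"
    by (simp add: exp_add[symmetric] algebra_simps)
qed (intro continuous_intros)

lemma normal_eigen_cosh: "normal_eigen (c\<^sup>2 / 2) (\<lambda>x. cosh (c * x))"
  unfolding normal_eigen_def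
proof (intro conjI allI impI)
  fix d x :: real assume d: "0 < d"
  have "has_bochner_integral (normal d) (\<lambda>y. (exp (c * (x + y)) + exp ((-c) * (x + y))) / 2)
     ((exp (c\<^sup>2 / 2 * d) * exp (c * x) + exp ((-c)\<^sup>2 / 2 * d) * exp ((-c) * x)) / 2)"
    using d normal_eigen_exp[of c] normal_eigen_exp[of "-c"]
    by (intro has_bochner_integral_divide has_bochner_integral_add) (auto simp: normal_eigen_def)
  then show "has_bochner_integral (normal d) (\<lambda>y. cosh (c * (x + y))) (exp (c\<^sup>2 / 2 * d) * cosh (c * x))"
    by (simp add: cosh_field_def algebra_simps)
qed (auto simp: cosh_field_def intro!: continuous_intros)

lemma gauss_eigen:
  assumes "0 < d" "normal_eigen \<kappa> f" "normal_eigen \<kappa>' g"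
  shows "has_bochner_integral (gauss d) (\<lambda>y. f (Re (z + y)) * g (Im (z + y))) (exp ((\<kappa> + \<kappa>') * d) * (f (Re z) * g (Im z)))"
proof -
  have f: "has_bochner_integral (normal d) (\<lambda>y. f (Re z + y)) (exp (\<kappa> * d) * f (Re z))"
    and g: "has_bochner_integral (normal d) (\<lambda>y. g (Im z + y)) (exp (\<kappa>' * d) * g (Im z))"
    using assms by (auto simp: normal_eigen_def)
  have "has_bochner_integral (gauss d) (\<lambda>y. f (Re z + Re y) * g (Im z + Im y))
     ((exp (\<kappa> * d) * f (Re z)) * (exp (\<kappa>' * d) * g (Im z)))"
    using gauss_product[OF assms(1), of "\<lambda>y. f (Re z + y)" "\<lambda>y. g (Im z + y)"] f g
    by (simp add: has_bochner_integral_iff)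
  moreover have "(exp (\<kappa> * d) * f (Re z)) * (exp (\<kappa>' * d) * g (Im z)) = exp ((\<kappa> + \<kappa>') * d) * (f (Re z) * g (Im z))"
    by (simp add: exp_add ring_distribs mult_ac)
  ultimately show ?thesis by simp
qed

section \<open>Convergence of expectations under a second moment bound\<close>

text \<open>Beyond the level \<open>R\<close> a function is dominated by its square divided by \<open>R\<close>, so a bound on second moments makes
  the tails uniformly small. For stopped processes this avoids a common integrable majorant, for which
  a maximal inequality would be needed.\<close>

lemma (in prob_space) L2_bounded_convergence:
  fixes X :: "nat \<Rightarrow> 'a \<Rightarrow> real"
  assumes X [measurable]: "\<And>n. X n \<in> borel_measurable M"
    and lim: "AE \<omega> in M. (\<lambda>n. X n \<omega>) \<longlonglongrightarrow> Y \<omega>" and Y [measurable]: "Y \<in> borel_measurable M"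
    and int: "\<And>n. integrable M (\<lambda>\<omega>. (X n \<omega>)\<^sup>2)" and B: "\<And>n. (\<integral>\<omega>. (X n \<omega>)\<^sup>2 \<partial>M) \<le> B"
  shows "integrable M Y" "(\<lambda>n. \<integral>\<omega>. X n \<omega> \<partial>M) \<longlonglongrightarrow> (\<integral>\<omega>. Y \<omega> \<partial>M)"
proof -
  have B0: "0 \<le> B" by (rule order_trans[OF _ B[of 0]]) simp
  have nn: "(\<integral>\<^sup>+\<omega>. ennreal ((X n \<omega>)\<^sup>2) \<partial>M) \<le> ennreal B" for n
    using int[of n] B[of n] by (subst nn_integral_eq_integral) (auto intro: ennreal_leI)
  have "(\<integral>\<^sup>+\<omega>. ennreal ((Y \<omega>)\<^sup>2) \<partial>M) = (\<integral>\<^sup>+\<omega>. liminf (\<lambda>n. ennreal ((X n \<omega>)\<^sup>2)) \<partial>M)"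
  proof (rule nn_integral_cong_AE)
    show "AE \<omega> in M. ennreal ((Y \<omega>)\<^sup>2) = liminf (\<lambda>n. ennreal ((X n \<omega>)\<^sup>2))"
      using lim
    proof eventually_elim
      case (elim \<omega>)
      then have "(\<lambda>n. ennreal ((X n \<omega>)\<^sup>2)) \<longlonglongrightarrow> ennreal ((Y \<omega>)\<^sup>2)"
        by (intro tendsto_intros)
      from lim_imp_Liminf[OF trivial_limit_sequentially this] show ?case by (rule sym)
    qed
  qed
  also have "\<dots> \<le> liminf (\<lambda>n. \<integral>\<^sup>+\<omega>. ennreal ((X n \<omega>)\<^sup>2) \<partial>M)"
    by (rule nn_integral_liminf) simp
  also have "\<dots> \<le> ennreal B"
  proof -
    have "liminf (\<lambda>n. \<integral>\<^sup>+\<omega>. ennreal ((X n \<omega>)\<^sup>2) \<partial>M) \<le> liminf (\<lambda>n::nat. ennreal B)"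
      by (intro Liminf_mono always_eventually allI nn)
    then show ?thesis by (simp add: Liminf_const)
  qed
  finally have nnY: "(\<integral>\<^sup>+\<omega>. ennreal ((Y \<omega>)\<^sup>2) \<partial>M) \<le> ennreal B" .
  have Y2: "integrable M (\<lambda>\<omega>. (Y \<omega>)\<^sup>2)"
    using nnY by (intro integrableI_bounded) (auto simp: less_top[symmetric] top_unique)
  have Y2B: "(\<integral>\<omega>. (Y \<omega>)\<^sup>2 \<partial>M) \<le> B"
    using nnY B0 by (subst (asm) nn_integral_eq_integral[OF Y2]) (auto simp: ennreal_le_iff)
  show Yi: "integrable M Y" by (rule square_integrable_imp_integrable[OF Y Y2])
  have Xi: "integrable M (X n)" for n by (rule square_integrable_imp_integrable[OF X int])
  show "(\<lambda>n. \<integral>\<omega>. X n \<omega> \<partial>M) \<longlonglongrightarrow> (\<integral>\<omega>. Y \<omega> \<partial>M)"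
  proof (rule LIMSEQ_I)
    fix e :: real assume e: "0 < e"
    define R where "R = (8 * B + 1) / e"
    have R: "0 < R" using e B0 by (simp add: R_def)
    have trunc: "(\<lambda>n. \<integral>\<omega>. min \<bar>X n \<omega> - Y \<omega>\<bar> R \<partial>M) \<longlonglongrightarrow> (\<integral>\<omega>. 0 \<partial>M)"
    proof (rule integral_dominated_convergence[where w = "\<lambda>_. R"])
      show "AE \<omega> in M. (\<lambda>n. min \<bar>X n \<omega> - Y \<omega>\<bar> R) \<longlonglongrightarrow> 0"
        using lim
      proof eventually_elim
        case (elim \<omega>)
        have "(\<lambda>n. min \<bar>X n \<omega> - Y \<omega>\<bar> R) \<longlonglongrightarrow> min \<bar>Y \<omega> - Y \<omega>\<bar> R"
          using elim by (intro tendsto_intros)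
        then show ?case using R by simp
      qed
      show "AE \<omega> in M. norm (min \<bar>X i \<omega> - Y \<omega>\<bar> R) \<le> R" for i using R by auto
    qed auto
    then have "eventually (\<lambda>n. \<bar>\<integral>\<omega>. min \<bar>X n \<omega> - Y \<omega>\<bar> R \<partial>M\<bar> < e / 2) sequentially"
      using e by (auto simp: tendsto_iff dist_real_def dest!: spec[of _ "e/2"])
    then obtain N where N: "\<And>n. n \<ge> N \<Longrightarrow> \<bar>\<integral>\<omega>. min \<bar>X n \<omega> - Y \<omega>\<bar> R \<partial>M\<bar> < e / 2"
      by (auto simp: eventually_sequentially)
    show "\<exists>N. \<forall>n\<ge>N. norm ((\<integral>\<omega>. X n \<omega> \<partial>M) - (\<integral>\<omega>. Y \<omega> \<partial>M)) < e"
    proof (intro exI allI impI)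
      fix n assume n: "N \<le> n"
      have mi: "integrable M (\<lambda>\<omega>. min \<bar>X n \<omega> - Y \<omega>\<bar> R)"
        by (rule integrable_const_bound[of _ R]) (use R in auto)
      have si: "integrable M (\<lambda>\<omega>. (2 * (X n \<omega>)\<^sup>2 + 2 * (Y \<omega>)\<^sup>2) / R)"
        using int Y2 by auto
      \<comment> \<open>above the level \<open>R\<close> the square divided by \<open>R\<close> dominates the function itself\<close>
      have pt: "\<bar>a - b\<bar> \<le> min \<bar>a - b\<bar> R + (2 * a\<^sup>2 + 2 * b\<^sup>2) / R" for a b :: real
      proof (cases "\<bar>a - b\<bar> \<le> R")
        case True then show ?thesis using R by (auto simp: min_def)
      next
        case False
        have "\<bar>a - b\<bar> * R \<le> \<bar>a - b\<bar> * \<bar>a - b\<bar>" using False by (intro mult_left_mono) auto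
        also have "\<dots> = (a - b)\<^sup>2" by (simp add: power2_eq_square)
        also have "\<dots> \<le> 2 * a\<^sup>2 + 2 * b\<^sup>2"
          using zero_le_power2[of "a + b"] by (simp add: power2_eq_square algebra_simps)
        finally have "\<bar>a - b\<bar> \<le> (2 * a\<^sup>2 + 2 * b\<^sup>2) / R" using R by (simp add: pos_le_divide_eq)
        then show ?thesis using R by (auto simp: min_def)
      qed
      have "\<bar>(\<integral>\<omega>. X n \<omega> \<partial>M) - (\<integral>\<omega>. Y \<omega> \<partial>M)\<bar> = \<bar>\<integral>\<omega>. X n \<omega> - Y \<omega> \<partial>M\<bar>"
        using Xi Yi by simp
      also have "\<dots> \<le> (\<integral>\<omega>. \<bar>X n \<omega> - Y \<omega>\<bar> \<partial>M)" by (rule integral_abs_bound)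
      also have "\<dots> \<le> (\<integral>\<omega>. min \<bar>X n \<omega> - Y \<omega>\<bar> R + (2 * (X n \<omega>)\<^sup>2 + 2 * (Y \<omega>)\<^sup>2) / R \<partial>M)"
        using Xi Yi mi si by (intro integral_mono pt) auto
      also have "\<dots> = (\<integral>\<omega>. min \<bar>X n \<omega> - Y \<omega>\<bar> R \<partial>M) + (2 * (\<integral>\<omega>. (X n \<omega>)\<^sup>2 \<partial>M) + 2 * (\<integral>\<omega>. (Y \<omega>)\<^sup>2 \<partial>M)) / R"
        using mi si int Y2 by simp
      also have "\<dots> < e / 2 + (2 * B + 2 * B) / R"
        using N[OF n] B[of n] Y2B R by (intro add_less_le_mono divide_right_mono add_mono mult_left_mono) auto
      also have "\<dots> \<le> e / 2 + e / 2"
        using e B0 by (auto simp: R_def field_simps)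
      finally show "norm ((\<integral>\<omega>. X n \<omega> \<partial>M) - (\<integral>\<omega>. Y \<omega> \<partial>M)) < e" by simp
    qed
  qed
qed

section \<open>Exit times\<close>

text \<open>The points with distance at least \<open>r\<close> from the complement of \<open>D\<close>. Staying in an open set is reduced to staying in
  one of these closed sets, because for a closed set it suffices to observe a continuous path at a dense set of times.\<close>

definition core :: "real \<Rightarrow> complex set \<Rightarrow> complex set" where
  "core r D = {z. \<forall>p. p \<notin> D \<longrightarrow> r \<le> dist z p}"

lemma closed_core: "closed (core r D)"
proof -
  have "core r D = (\<Inter>p\<in>-D. {z. r \<le> dist z p})" by (auto simp: core_def)
  then show ?thesis by (auto intro!: closed_INT closed_Collect_le continuous_intros)
qed

lemma core_subset: "0 < r \<Longrightarrow> core r D \<subseteq> D"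
  by (force simp: core_def)

lemma core_antimono: "r \<le> s \<Longrightarrow> core s D \<subseteq> core r D"
  by (force simp: core_def)

lemma compact_subset_core:
  assumes "compact C" "open D" "C \<subseteq> D"
  shows "\<exists>n. C \<subseteq> core (inverse (real (Suc n))) D"
proof -
  obtain d where d: "d > 0" "\<And>x y. x \<in> C \<Longrightarrow> y \<in> - D \<Longrightarrow> d \<le> dist x y"
    using separate_compact_closed[OF assms(1) closed_Compl[OF assms(2)]] assms(3) by blast
  obtain n where n: "inverse (real (Suc n)) < d" using reals_Archimedean[OF d(1)] by auto
  then show ?thesis using d by (intro exI[of _ n]) (force simp: core_def)
qed

context planar_BM
begin

definition stays :: "real \<Rightarrow> real \<Rightarrow> complex set \<Rightarrow> 'a set" where
  "stays a b D = {\<omega> \<in> space M. \<forall>r\<in>{a..b}. W r \<omega> \<in> D}"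

definition exit_after :: "real \<Rightarrow> complex set \<Rightarrow> 'a \<Rightarrow> ennreal" where
  "exit_after a D \<omega> = (INF t\<in>{t. a \<le> t \<and> W t \<omega> \<notin> D}. ennreal t)"

lemma exit_time_eq: "exit_time W D = exit_after 0 D"
  by (simp add: exit_after_def exit_time_def fun_eq_iff)

definition stop_time :: "real \<Rightarrow> complex set \<Rightarrow> real \<Rightarrow> 'a \<Rightarrow> real" where
  "stop_time a D t \<omega> = enn2real (min (exit_after a D \<omega>) (ennreal t))"

definition stopped :: "real \<Rightarrow> complex set \<Rightarrow> real \<Rightarrow> 'a \<Rightarrow> complex" where
  "stopped a D t \<omega> = W (stop_time a D t \<omega>) \<omega>"

text \<open>The times after \<open>a\<close> at which the path is outside \<open>D\<close> form a closed set, so a first one exists if there is any.\<close>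

lemma exit_after_cases:
  assumes D: "open D" and a: "0 \<le> a" and \<omega>: "\<omega> \<in> space M"
  obtains (never) "exit_after a D \<omega> = \<infinity>" "\<And>t. a \<le> t \<Longrightarrow> W t \<omega> \<in> D"
  | (exit) t0 where "exit_after a D \<omega> = ennreal t0" "a \<le> t0" "W t0 \<omega> \<notin> D" "\<And>t. a \<le> t \<Longrightarrow> t < t0 \<Longrightarrow> W t \<omega> \<in> D"
proof (cases "{t. a \<le> t \<and> W t \<omega> \<notin> D} = {}")
  case True
  then show ?thesis using never by (auto simp: exit_after_def)
next
  case False
  let ?S = "{t. a \<le> t \<and> W t \<omega> \<notin> D}"
  have "continuous_on {a..} (\<lambda>t. W t \<omega>)"
    by (rule continuous_on_subset[OF continuous_path[OF \<omega>]]) (use a in auto)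
  then have "closed ({a..} \<inter> (\<lambda>t. W t \<omega>) -` (- D))"
    using D by (intro continuous_closed_preimage) auto
  also have "{a..} \<inter> (\<lambda>t. W t \<omega>) -` (- D) = ?S" by auto
  finally have cl: "closed ?S" .
  have bdd: "bdd_below ?S" by (auto intro!: bdd_belowI[of _ a])
  have I: "Inf ?S \<in> ?S" by (rule closed_contains_Inf[OF False bdd cl])
  have le: "Inf ?S \<le> t" if "t \<in> ?S" for t using cInf_lower[OF that bdd] .
  have "exit_after a D \<omega> = ennreal (Inf ?S)"
    unfolding exit_after_def
  proof (rule antisym)
    show "(INF t\<in>?S. ennreal t) \<le> ennreal (Inf ?S)" using I by (rule INF_lower)
    show "ennreal (Inf ?S) \<le> (INF t\<in>?S. ennreal t)" using le by (intro INF_greatest ennreal_leI)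
  qed
  then show ?thesis
    using I le by (intro exit[of "Inf ?S"]) force+
qed

lemma exit_after_gt_iff:
  assumes "open D" "0 \<le> a" "a \<le> s" "\<omega> \<in> space M"
  shows "ennreal s < exit_after a D \<omega> \<longleftrightarrow> \<omega> \<in> stays a s D"
  using assms(1,2,4)
proof (cases rule: exit_after_cases)
  case never then show ?thesis using assms by (auto simp: stays_def)
next
  case (exit t0) then show ?thesis using assms by (force simp: stays_def ennreal_less_iff not_less)
qed

lemma stop_time_cases:
  assumes D: "open D" and a: "0 \<le> a" "a \<le> t" and \<omega>: "\<omega> \<in> space M"
  obtains (stay) "\<omega> \<in> stays a t D" "stop_time a D t \<omega> = t" "ennreal t < exit_after a D \<omega>"
  | (exit) t0 where "stop_time a D t \<omega> = t0" "a \<le> t0" "t0 \<le> t" "W t0 \<omega> \<notin> D"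
      "\<And>s. a \<le> s \<Longrightarrow> s < t0 \<Longrightarrow> W s \<omega> \<in> D" "exit_after a D \<omega> = ennreal t0" "\<omega> \<notin> stays a t D"
  using D a(1) \<omega>
proof (cases rule: exit_after_cases)
  case never then show ?thesis using stay \<omega> a by (auto simp: stays_def stop_time_def)
next
  case (exit t0)
  note ex = this
  show ?thesis
  proof (cases "t0 \<le> t")
    case True then show ?thesis using that(2)[of t0] ex a by (force simp: stop_time_def stays_def min_def)
  next
    case False then show ?thesis using that(1) ex a \<omega> by (auto simp: stop_time_def stays_def min_def ennreal_less_iff)
  qed
qed

lemma stop_time_bounds:
  assumes D: "open D" and a: "0 \<le> a" "a \<le> t" and \<omega>: "\<omega> \<in> space M"
  shows "a \<le> stop_time a D t \<omega>" "stop_time a D t \<omega> \<le> t"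
  using stop_time_cases[OF assms] a by (metis order_refl)+

lemma stays_dense:
  assumes K: "closed K" and a: "0 \<le> a" and S: "{a..b} \<subseteq> closure S" "S \<subseteq> {a..b}"
    and \<omega>: "\<omega> \<in> space M" and "\<And>r. r \<in> S \<Longrightarrow> W r \<omega> \<in> K"
  shows "\<omega> \<in> stays a b K"
proof -
  have S': "closure S \<subseteq> {a..b}" using S(2) by (rule closure_minimal) simp
  have "continuous_on (closure S) (\<lambda>t. W t \<omega>)"
    by (rule continuous_on_subset[OF continuous_path[OF \<omega>]]) (use S' a in auto)
  then have "(\<lambda>t. W t \<omega>) ` closure S \<subseteq> K"
    using assms by (intro image_closure_subset) auto
  then show ?thesis using S(1) \<omega> by (auto simp: stays_def)
qed

lemma stays_core:
  assumes D: "open D" and a: "0 \<le> a"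
  shows "stays a b D = (\<Union>n. stays a b (core (inverse (real (Suc n))) D))"
proof
  show "stays a b D \<subseteq> (\<Union>n. stays a b (core (inverse (real (Suc n))) D))"
  proof
    fix \<omega> assume \<omega>: "\<omega> \<in> stays a b D"
    have "continuous_on {a..b} (\<lambda>t. W t \<omega>)"
      using continuous_path[of \<omega>] \<omega> a by (auto simp: stays_def elim!: continuous_on_subset)
    then have "compact ((\<lambda>t. W t \<omega>) ` {a..b})" by (intro compact_continuous_image) auto
    moreover have "(\<lambda>t. W t \<omega>) ` {a..b} \<subseteq> D" using \<omega> by (auto simp: stays_def)
    ultimately obtain n where "(\<lambda>t. W t \<omega>) ` {a..b} \<subseteq> core (inverse (real (Suc n))) D"
      using compact_subset_core D by blast
    then show "\<omega> \<in> (\<Union>n. stays a b (core (inverse (real (Suc n))) D))" using \<omega> by (auto simp: stays_def)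
  qed
  have "core (inverse (real (Suc n))) D \<subseteq> D" for n by (rule core_subset) simp
  then show "(\<Union>n. stays a b (core (inverse (real (Suc n))) D)) \<subseteq> stays a b D"
    by (auto simp: stays_def)
qed

lemma stays_closed_in_history:
  assumes K: "closed K" and a: "0 \<le> a" "a \<le> b"
  shows "stays a b K \<in> sets (history b)"
proof -
  obtain S where S: "countable S" "{a..b} \<subseteq> closure S" "S \<subseteq> {a..b}"
  proof (cases "a = b")
    case True then show ?thesis using that[of "{a}"] by auto
  next
    case False
    let ?S = "{a..b} \<inter> (\<Union>k m. {real m / 2^k})"
    have "closure ?S = closure {a..b}"
      using False a by (intro closure_dyadic_rationals_in_convex_set_pos_1) auto
    moreover have "countable ?S" by (intro countable_Int2 countable_UN) auto
    ultimately show ?thesis using that[of ?S] by auto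
  qed
  have ne: "S \<noteq> {}" using S(2) a by auto
  have eq: "stays a b K = (\<Inter>r\<in>S. W r -` K \<inter> space M)"
    using stays_dense[OF K a(1) S(2,3)] S(3) ne by (auto simp: stays_def)
  have "W r -` K \<inter> space (history b) \<in> sets (history b)" if "r \<in> S" for r
    using S a that K by (intro measurable_sets[OF measurable_history_W]) auto
  then show ?thesis unfolding eq using S(1) ne by (intro sets.countable_INT') auto
qed

lemma stays_in_history:
  assumes D: "open D" and a: "0 \<le> a" "a \<le> b"
  shows "stays a b D \<in> sets (history b)"
  unfolding stays_core[OF D a(1)]
  by (intro sets.countable_UN) (auto intro: stays_closed_in_history[OF closed_core a])

lemma stays_events: "open D \<Longrightarrow> 0 \<le> a \<Longrightarrow> a \<le> b \<Longrightarrow> stays a b D \<in> events"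
  by (rule history_sets[OF stays_in_history])

text \<open>Rounding the random time up to a multiple of \<open>1 / (n + 1)\<close> leaves countably many values, and by continuity
  the path at the rounded times converges.\<close>

lemma measurable_path_at_random_time:
  assumes T [measurable]: "T \<in> borel_measurable M" and T0: "\<And>\<omega>. \<omega> \<in> space M \<Longrightarrow> 0 \<le> T \<omega>"
  shows "(\<lambda>\<omega>. W (T \<omega>) \<omega>) \<in> borel_measurable M"
proof (rule borel_measurable_LIMSEQ_metric)
  let ?T = "\<lambda>n \<omega>. real (nat \<lceil>real (Suc n) * T \<omega>\<rceil>) / real (Suc n)"
  fix n
  have 1: "(\<lambda>\<omega>. W (real k / real (Suc n)) \<omega>) \<in> borel_measurable M" for k
    by (rule measurable_W) simp
  have 2: "(\<lambda>\<omega>. nat \<lceil>real (Suc n) * T \<omega>\<rceil>) \<in> measurable M (count_space UNIV)"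
    by measurable
  show "(\<lambda>\<omega>. W (?T n \<omega>) \<omega>) \<in> borel_measurable M"
    by (rule measurable_compose_countable[where f = "\<lambda>k \<omega>. W (real k / real (Suc n)) \<omega>", OF 1 2])
next
  let ?T = "\<lambda>n \<omega>. real (nat \<lceil>real (Suc n) * T \<omega>\<rceil>) / real (Suc n)"
  fix \<omega> assume \<omega>: "\<omega> \<in> space M"
  have b: "T \<omega> \<le> ?T n \<omega>" "?T n \<omega> \<le> T \<omega> + inverse (real (Suc n))" for n
  proof -
    have "real (nat \<lceil>real (Suc n) * T \<omega>\<rceil>) = real_of_int \<lceil>real (Suc n) * T \<omega>\<rceil>"
    proof (rule of_nat_nat)
      have "0 \<le> real (Suc n) * T \<omega>" using T0[OF \<omega>] by simp
      then show "0 \<le> \<lceil>real (Suc n) * T \<omega>\<rceil>" by linarith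
    qed
    then have "real (Suc n) * T \<omega> \<le> real (nat \<lceil>real (Suc n) * T \<omega>\<rceil>)"
      "real (nat \<lceil>real (Suc n) * T \<omega>\<rceil>) \<le> real (Suc n) * T \<omega> + 1"
      by linarith+
    then show "T \<omega> \<le> ?T n \<omega>" "?T n \<omega> \<le> T \<omega> + inverse (real (Suc n))"
      by (auto simp: field_simps simp del: of_nat_Suc)
  qed
  have "(\<lambda>n. T \<omega> + inverse (real (Suc n))) \<longlonglongrightarrow> T \<omega> + 0"
    by (intro tendsto_intros LIMSEQ_inverse_real_of_nat)
  then have lim: "(\<lambda>n. ?T n \<omega>) \<longlonglongrightarrow> T \<omega>"
    using b by (intro tendsto_sandwich[OF _ _ tendsto_const, of "T \<omega>" "\<lambda>n. ?T n \<omega>"]) auto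
  show "(\<lambda>n. W (?T n \<omega>) \<omega>) \<longlonglongrightarrow> W (T \<omega>) \<omega>"
  proof (rule continuous_on_tendsto_compose[OF continuous_path[OF \<omega>] lim])
    show "T \<omega> \<in> {0..}" using T0[OF \<omega>] by simp
    show "\<forall>\<^sub>F n in sequentially. ?T n \<omega> \<in> {0..}"
      unfolding atLeast_iff by (intro always_eventually allI order_trans[OF T0[OF \<omega>] b(1)])
  qed
qed

lemma measurable_exit_after:
  assumes D: "open D" and a: "0 \<le> a"
  shows "exit_after a D \<in> borel_measurable M"
proof (rule borel_measurableI_greater)
  fix y :: ennreal
  show "{\<omega> \<in> space M. y < exit_after a D \<omega>} \<in> events"
  proof (cases y rule: ennreal_cases)
    case (real s)
    show ?thesis
    proof (cases "a \<le> s")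
      case True
      have "{\<omega> \<in> space M. y < exit_after a D \<omega>} = stays a s D"
        using exit_after_gt_iff[OF D a True] real by (auto simp: stays_def)
      then show ?thesis using stays_events[OF D a True] by simp
    next
      case False
      have "y < exit_after a D \<omega>" if "\<omega> \<in> space M" for \<omega>
        using D a that
      proof (cases rule: exit_after_cases)
        case never then show ?thesis using real by simp
      next
        case (exit t0) then show ?thesis using real False by (auto simp: ennreal_less_iff)
      qed
      then have "{\<omega> \<in> space M. y < exit_after a D \<omega>} = space M" by auto
      then show ?thesis by simp
    qed
  qed simp
qed

lemma measurable_exit_time: "open D \<Longrightarrow> exit_time W D \<in> borel_measurable M"
  unfolding exit_time_eq by (rule measurable_exit_after) simp_all

lemma AE_exit_time_finite:
  assumes "open D" "(\<integral>\<^sup>+\<omega>. exit_time W D \<omega> \<partial>M) < \<infinity>"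
  shows "AE \<omega> in M. exit_time W D \<omega> \<noteq> \<infinity>"
  using assms by (intro nn_integral_PInf_AE measurable_exit_time) auto

lemma measurable_stop_time:
  assumes "open D" "0 \<le> a"
  shows "stop_time a D t \<in> borel_measurable M"
  using measurable_exit_after[OF assms] unfolding stop_time_def[abs_def] by measurable

lemma measurable_stopped:
  assumes "open D" "0 \<le> a"
  shows "stopped a D t \<in> borel_measurable M"
  unfolding stopped_def[abs_def]
  by (rule measurable_path_at_random_time[OF measurable_stop_time[OF assms]]) (simp add: stop_time_def)

lemma measurable_exit_position:
  assumes "open D"
  shows "exit_position W D \<in> borel_measurable M"
  unfolding exit_position_def[abs_def] exit_time_eq
  using measurable_exit_after[OF assms, of 0]
  by (intro measurable_path_at_random_time) auto

end

section \<open>Optional stopping\<close>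

text \<open>The growth bound for all functions to be stopped. Gaussian averaging multiplies it by a constant, and
  its square is bounded by a function of the same kind; so the bound yields integrability and second moments.\<close>

definition cosh2 :: "real \<Rightarrow> complex \<Rightarrow> real" where
  "cosh2 c z = cosh (c * Re z) * cosh (c * Im z)"

lemma cosh2_ge_1: "1 \<le> cosh2 c z"
  using mult_mono[OF cosh_real_ge_1 cosh_real_ge_1, of "c * Re z" "c * Im z"] by (simp add: cosh2_def)

lemma cosh2_0 [simp]: "cosh2 c 0 = 1"
  by (simp add: cosh2_def)

lemma cosh2_square_le: "(cosh2 c z)\<^sup>2 \<le> cosh2 (2 * c) z"
proof -
  have *: "(cosh x)\<^sup>2 \<le> cosh (2 * x)" for x :: real by (simp add: cosh_double)
  have "(cosh2 c z)\<^sup>2 = (cosh (c * Re z))\<^sup>2 * (cosh (c * Im z))\<^sup>2"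
    by (simp add: cosh2_def power_mult_distrib)
  also have "\<dots> \<le> cosh (2 * (c * Re z)) * cosh (2 * (c * Im z))"
    by (intro mult_mono * ) auto
  finally show ?thesis by (simp add: cosh2_def mult.assoc)
qed

lemma continuous_on_cosh2 [continuous_intros]: "continuous_on S f \<Longrightarrow> continuous_on S (\<lambda>x. cosh2 c (f x))"
  by (auto simp: cosh2_def cosh_field_def intro!: continuous_intros)

lemma borel_measurable_cosh2 [measurable]: "cosh2 c \<in> borel_measurable borel"
  by (rule borel_measurable_continuous_onI) (intro continuous_intros)

lemma gauss_cosh2:
  assumes "0 < d"
  shows "has_bochner_integral (gauss d) (\<lambda>y. cosh2 c (z + y)) (exp (c\<^sup>2 * d) * cosh2 c z)"
  using gauss_eigen[OF assms normal_eigen_cosh[of c] normal_eigen_cosh[of c], of z] by (simp add: cosh2_def)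

text \<open>Functions of time and position whose mean along Brownian motion does not decrease up to time \<open>t\<close>. The
  condition is stated by Gaussian averages and not by the heat operator, so that it also covers functions that are not smooth.\<close>

definition subcaloric :: "real \<Rightarrow> (real \<Rightarrow> complex \<Rightarrow> real) \<Rightarrow> bool" where
  "subcaloric t u \<longleftrightarrow> continuous_on UNIV (\<lambda>p. u (fst p) (snd p)) \<and>
     (\<exists>C c. \<forall>s\<in>{0..t}. \<forall>z. \<bar>u s z\<bar> \<le> C * cosh2 c z) \<and>
     (\<forall>s d z. 0 \<le> s \<longrightarrow> 0 < d \<longrightarrow> s + d \<le> t \<longrightarrow> u s z \<le> (\<integral>y. u (s + d) (z + y) \<partial>gauss d))"

definition caloric :: "real \<Rightarrow> (real \<Rightarrow> complex \<Rightarrow> real) \<Rightarrow> bool" where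
  "caloric t u \<longleftrightarrow> subcaloric t u \<and> subcaloric t (\<lambda>s z. - u s z)"

lemma subcaloric_cosh2: "0 \<le> C \<Longrightarrow> subcaloric t (\<lambda>s. \<lambda>z. C * cosh2 c z)"
  unfolding subcaloric_def
proof (intro conjI allI impI)
  assume C: "0 \<le> C"
  have "\<bar>C * cosh2 c z\<bar> \<le> C * cosh2 c z" for z
    using C cosh2_ge_1[of c z] by simp
  then show "\<exists>C' c'. \<forall>s\<in>{0..t}. \<forall>z. \<bar>C * cosh2 c z\<bar> \<le> C' * cosh2 c' z"
    by blast
  fix s d z assume "0 < (d::real)"
  then have "(\<integral>y. cosh2 c (z + y) \<partial>gauss d) = exp (c\<^sup>2 * d) * cosh2 c z"
    using gauss_cosh2[of d c z] by (simp add: has_bochner_integral_iff)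
  moreover have "cosh2 c z \<le> exp (c\<^sup>2 * d) * cosh2 c z"
    using cosh2_ge_1[of c z] \<open>0 < d\<close> mult_right_mono[of 1 "exp (c\<^sup>2 * d)" "cosh2 c z"] by simp
  ultimately show "C * cosh2 c z \<le> (\<integral>y. C * cosh2 c (z + y) \<partial>gauss d)"
    using C by (simp add: mult_left_mono)
qed (intro continuous_intros)

context planar_BM
begin

lemma integrable_growth:
  fixes f :: "complex \<Rightarrow> real"
  assumes f [measurable]: "f \<in> borel_measurable borel" and le: "\<And>z. \<bar>f z\<bar> \<le> C * cosh2 c z" and t: "0 \<le> t"
  shows "integrable M (\<lambda>\<omega>. f (W t \<omega>))"
proof (cases "t = 0")
  case True
  show ?thesis
  proof (rule integrable_const_bound[of _ C])
    show "AE \<omega> in M. norm (f (W t \<omega>)) \<le> C"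
      using AE_start by eventually_elim (use le[of 0] True in auto)
  qed (use t in measurable)
next
  case False
  then have t: "0 < t" using t by simp
  note [measurable] = measurable_W[of 0, simplified] measurable_W[OF less_imp_le[OF t]]
  have "integrable (gauss t) (\<lambda>z. C * cosh2 c z)"
    using gauss_cosh2[OF t, of c 0] by (simp add: has_bochner_integral_iff)
  then have "integrable (gauss t) f"
    by (rule Bochner_Integration.integrable_bound) (use le in \<open>auto intro: order_trans[OF _ abs_ge_self]\<close>)
  then have "integrable (distr M borel (\<lambda>\<omega>. W t \<omega> - W 0 \<omega>)) f"
    using distr_increment[of 0 t] t by simp
  then have "integrable M (\<lambda>\<omega>. f (W t \<omega> - W 0 \<omega>))"
    by (rule integrable_distr[rotated]) simp
  moreover have "AE \<omega> in M. f (W t \<omega> - W 0 \<omega>) = f (W t \<omega>)"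
    using AE_start by eventually_elim simp
  ultimately show ?thesis
    by (subst (asm) integrable_cong_AE) auto
qed

lemma subcaloric_meas:
  assumes "subcaloric t u"
  shows "u s \<in> borel_measurable borel"
proof (rule borel_measurable_continuous_onI)
  have "continuous_on UNIV ((\<lambda>p. u (fst p) (snd p)) \<circ> (\<lambda>z. (s, z)))"
    using assms unfolding subcaloric_def
    by (intro continuous_on_compose continuous_intros) (auto elim: continuous_on_subset)
  then show "continuous_on UNIV (u s)" by (simp add: o_def)
qed

lemma subcaloric_integrable:
  assumes "subcaloric t u" "s \<in> {0..t}"
  shows "integrable M (\<lambda>\<omega>. u s (W s \<omega>))"
proof -
  obtain C c where "\<And>z. \<bar>u s z\<bar> \<le> C * cosh2 c z"
    using assms unfolding subcaloric_def by blast
  then show ?thesis using subcaloric_meas[OF assms(1)] assms(2) by (intro integrable_growth) auto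
qed

lemma subcaloric_step:
  assumes u: "subcaloric t u" and s: "0 \<le> s" "s \<le> s'" "s' \<le> t" and H: "H \<in> sets (history s)"
  shows "(\<integral>\<omega>. indicator H \<omega> * u s (W s \<omega>) \<partial>M) \<le> (\<integral>\<omega>. indicator H \<omega> * u s' (W s' \<omega>) \<partial>M)"
proof (cases "s = s'")
  case False
  then have ss: "s < s'" using s by simp
  note [measurable] = subcaloric_meas[OF u] history_sets[OF H]
  have I: "integrable M (\<lambda>\<omega>. u s' (W s' \<omega>))" and I': "integrable M (\<lambda>\<omega>. u s (W s \<omega>))"
    using s by (auto intro!: subcaloric_integrable[OF u])
  have G: "(\<lambda>p. u s' (fst p + snd p)) \<in> borel_measurable (borel \<Otimes>\<^sub>M borel)" by measurable
  have "(\<integral>\<omega>. indicator H \<omega> * u s (W s \<omega>) \<partial>M) \<le> (\<integral>\<omega>. indicator H \<omega> * (\<integral>y. u s' (W s \<omega> + y) \<partial>gauss (s' - s)) \<partial>M)"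
  proof (rule integral_mono)
    show "integrable M (\<lambda>\<omega>. indicator H \<omega> * u s (W s \<omega>))"
      by (rule Bochner_Integration.integrable_bound[OF I']) (use s in \<open>auto simp: indicator_def\<close>)
    show "integrable M (\<lambda>\<omega>. indicator H \<omega> * (\<integral>y. u s' (W s \<omega> + y) \<partial>gauss (s' - s)))"
      using markov_integral(1)[OF s(1) ss H G] I by simp
    fix \<omega>
    have "u s (W s \<omega>) \<le> (\<integral>y. u (s + (s' - s)) (W s \<omega> + y) \<partial>gauss (s' - s))"
      using u s ss unfolding subcaloric_def
      by (elim conjE allE[of _ s] allE[of _ "s' - s"] allE[of _ "W s \<omega>"]) auto
    then show "indicator H \<omega> * u s (W s \<omega>) \<le> indicator H \<omega> * (\<integral>y. u s' (W s \<omega> + y) \<partial>gauss (s' - s))"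
      by (auto simp: indicator_def)
  qed
  also have "\<dots> = (\<integral>\<omega>. indicator H \<omega> * u s' (W s' \<omega>) \<partial>M)"
    using markov_integral(2)[OF s(1) ss H G] I by simp
  finally show ?thesis .
qed simp

definition grid :: "real \<Rightarrow> real \<Rightarrow> nat \<Rightarrow> nat \<Rightarrow> real" where
  "grid a t N k = a + real k * (t - a) / real (Suc N)"

text \<open>The value of \<open>u\<close> at the first point of the grid that is not before the exit, or at \<open>t\<close> if there is none. In the
  form of a telescoping sum, each summand is an increment of \<open>u\<close> times the indicator of an event of the
  past, and its mean is non-negative by \<open>subcaloric_step\<close>.\<close>

definition grid_stopped :: "real \<Rightarrow> complex set \<Rightarrow> real \<Rightarrow> (real \<Rightarrow> complex \<Rightarrow> real) \<Rightarrow> nat \<Rightarrow> 'a \<Rightarrow> real" where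
  "grid_stopped a D t u N \<omega> = u a (W a \<omega>) +
     (\<Sum>k\<le>N. indicator (stays a (grid a t N k) D) \<omega> *
        (u (grid a t N (Suc k)) (W (grid a t N (Suc k)) \<omega>) - u (grid a t N k) (W (grid a t N k) \<omega>)))"

lemma grid_simps [simp]: "grid a t N 0 = a" "grid a t N (Suc N) = t"
  by (auto simp: grid_def field_simps)

lemma grid_mono: "a \<le> t \<Longrightarrow> i \<le> j \<Longrightarrow> grid a t N i \<le> grid a t N j"
  by (auto simp: grid_def intro!: divide_right_mono mult_right_mono)

lemma grid_bounds: "a \<le> t \<Longrightarrow> k \<le> Suc N \<Longrightarrow> a \<le> grid a t N k \<and> grid a t N k \<le> t"
  using grid_mono[of a t 0 k N] grid_mono[of a t k "Suc N" N] by simp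

lemma grid_Suc: "grid a t N (Suc k) = grid a t N k + (t - a) / real (Suc N)"
  by (simp add: grid_def distrib_right add_divide_distrib)

lemma grid_stopped_eq:
  assumes D: "open D" and a: "0 \<le> a" "a \<le> t" and \<omega>: "\<omega> \<in> space M"
  shows "\<exists>\<rho>. stop_time a D t \<omega> \<le> \<rho> \<and> \<rho> \<le> stop_time a D t \<omega> + (t - a) / real (Suc N) \<and> \<rho> \<le> t \<and>
    (\<forall>u. grid_stopped a D t u N \<omega> = u \<rho> (W \<rho> \<omega>))"
  using assms
proof (cases rule: stop_time_cases)
  case stay
  have "indicator (stays a (grid a t N k) D) \<omega> = (1::real)" if "k \<in> {..N}" for k
    using stay(1) that grid_bounds[OF a(2), of k N] by (auto simp: stays_def indicator_def)
  then have "grid_stopped a D t u N \<omega> = u a (W a \<omega>) +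
     (\<Sum>k\<le>N. u (grid a t N (Suc k)) (W (grid a t N (Suc k)) \<omega>) - u (grid a t N k) (W (grid a t N k) \<omega>))" for u
    unfolding grid_stopped_def by (intro arg_cong2[where f = "(+)"] refl sum.cong) (auto simp del: atMost_iff)
  then have "grid_stopped a D t u N \<omega> = u t (W t \<omega>)" for u
    unfolding lessThan_Suc_atMost[symmetric] by (subst (asm) sum_lessThan_telescope) simp
  then show ?thesis using stay a by (intro exI[of _ t]) auto
next
  case (exit t0)
  define j where "j = (LEAST k. t0 \<le> grid a t N k)"
  have exN: "t0 \<le> grid a t N (Suc N)" using exit by simp
  have j: "t0 \<le> grid a t N j" unfolding j_def by (rule LeastI[of _ "Suc N"]) (rule exN)
  have jN: "j \<le> Suc N" unfolding j_def by (rule Least_le) (rule exN)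
  have less: "grid a t N k < t0" if "k < j" for k
    using not_less_Least[of k "\<lambda>k. t0 \<le> grid a t N k"] that by (simp add: j_def not_le)
  have ind: "indicator (stays a (grid a t N k) D) \<omega> = (if k < j then 1 else 0 :: real)" for k
  proof (cases "k < j")
    case True
    then show ?thesis using less[OF True] exit(5) \<omega> by (auto simp: stays_def)
  next
    case False
    then have "t0 \<le> grid a t N k" using j grid_mono[OF a(2), of j k N] by simp
    then have "\<omega> \<notin> stays a (grid a t N k) D" using exit(2,4) by (auto simp: stays_def)
    then show ?thesis using False by simp
  qed
  have "grid_stopped a D t u N \<omega> = u (grid a t N j) (W (grid a t N j) \<omega>)" for u
  proof -
    let ?f = "\<lambda>k. u (grid a t N k) (W (grid a t N k) \<omega>)"
    have "(\<Sum>k\<le>N. indicator (stays a (grid a t N k) D) \<omega> * (?f (Suc k) - ?f k)) = (\<Sum>k<j. ?f (Suc k) - ?f k)"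
      using jN by (intro sum.mono_neutral_cong_right) (auto simp: ind)
    also have "(\<Sum>k<j. ?f (Suc k) - ?f k) = ?f j - ?f 0" by (rule sum_lessThan_telescope)
    finally show ?thesis unfolding grid_stopped_def by simp
  qed
  moreover have "grid a t N j \<le> t0 + (t - a) / real (Suc N)"
  proof (cases j)
    case 0 then show ?thesis using exit(2) a by (auto intro: add_increasing2)
  next
    case (Suc i) then show ?thesis using less[of i] grid_Suc[of a t N i] by simp
  qed
  ultimately show ?thesis
    using j exit(1) grid_bounds[OF a(2) jN] by (intro exI[of _ "grid a t N j"]) auto
qed

lemma indicator_mult_integrable:
  fixes f :: "'a \<Rightarrow> real"
  assumes "integrable M f" "A \<in> events"
  shows "integrable M (\<lambda>\<omega>. indicator A \<omega> * f \<omega>)"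
  using integrable_mult_indicator[OF assms(2,1)] by simp

text \<open>The means of the grid approximations satisfy the inequality, by telescoping. As the mesh vanishes the
  approximations converge pointwise. Their squares are dominated by the grid approximations of
  \<open>C\<^sup>2 * cosh2 (2 * c)\<close>, which is again subcaloric, so that their means are at most the mean at the final time \<open>t\<close>.
  This is the second moment bound that permits passing to the limit.\<close>

lemma optional_stopping:
  assumes D: "open D" and a: "0 \<le> a" "a \<le> t" and u: "subcaloric t u" and H: "H \<in> sets (history a)"
  shows "integrable M (\<lambda>\<omega>. u (stop_time a D t \<omega>) (stopped a D t \<omega>))"
    and "(\<integral>\<omega>. indicator H \<omega> * u a (W a \<omega>) \<partial>M) \<le> (\<integral>\<omega>. indicator H \<omega> * u (stop_time a D t \<omega>) (stopped a D t \<omega>) \<partial>M)"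
proof -
  let ?g = "grid a t" and ?X = "\<lambda>u. grid_stopped a D t u"
  have gb: "0 \<le> ?g N k" "a \<le> ?g N k" "?g N k \<le> t" if "k \<le> Suc N" for N k
    using grid_bounds[OF a(2) that] a by auto
  have st: "stays a (?g N k) D \<in> sets (history (?g N k))" if "k \<le> Suc N" for N k
    using gb[OF that] by (intro stays_in_history D a)
  have st': "stays a (?g N k) D \<in> events" if "k \<le> Suc N" for N k
    by (rule history_sets[OF st[OF that]])
  have Hg: "H \<in> sets (history (?g N k))" if "k \<le> Suc N" for N k
    using history_mono[OF gb(2)[OF that]] H by auto
  note [measurable] = history_sets[OF H]
  have int: "integrable M (\<lambda>\<omega>. v (?g N k) (W (?g N k) \<omega>))" if "subcaloric t v" "k \<le> Suc N" for v N k
    using gb[OF that(2)] by (intro subcaloric_integrable[OF that(1)]) auto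
  have Xint: "integrable M (?X v N)" if v: "subcaloric t v" for v N
  proof -
    have "integrable M (\<lambda>\<omega>. v a (W a \<omega>))" using int[OF v, of 0 N] by simp
    then show ?thesis unfolding grid_stopped_def[abs_def]
      by (intro Bochner_Integration.integrable_add Bochner_Integration.integrable_sum
          indicator_mult_integrable Bochner_Integration.integrable_diff int[OF v] st') auto
  qed
  have incr: "(\<integral>\<omega>. indicator B \<omega> * (v (?g N (Suc k)) (W (?g N (Suc k)) \<omega>) - v (?g N k) (W (?g N k) \<omega>)) \<partial>M) \<ge> 0"
    if v: "subcaloric t v" and k: "k \<le> N" and B: "B \<in> sets (history (?g N k))" for v N k B
  proof -
    have [measurable]: "B \<in> events" by (rule history_sets[OF B])
    have "(\<integral>\<omega>. indicator B \<omega> * (v (?g N (Suc k)) (W (?g N (Suc k)) \<omega>) - v (?g N k) (W (?g N k) \<omega>)) \<partial>M)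
      = (\<integral>\<omega>. indicator B \<omega> * v (?g N (Suc k)) (W (?g N (Suc k)) \<omega>) \<partial>M) - (\<integral>\<omega>. indicator B \<omega> * v (?g N k) (W (?g N k) \<omega>) \<partial>M)"
      using k unfolding right_diff_distrib
      by (intro Bochner_Integration.integral_diff indicator_mult_integrable int[OF v]) auto
    also have "\<dots> \<ge> 0"
      using subcaloric_step[OF v, of "?g N k" "?g N (Suc k)" B] gb[of k N] gb[of "Suc k" N] grid_mono[OF a(2), of k "Suc k" N] k B
      by auto
    finally show ?thesis .
  qed
  have lower: "(\<integral>\<omega>. indicator H \<omega> * u a (W a \<omega>) \<partial>M) \<le> (\<integral>\<omega>. indicator H \<omega> * ?X u N \<omega> \<partial>M)" for N
  proof -
    let ?d = "\<lambda>k \<omega>. u (?g N (Suc k)) (W (?g N (Suc k)) \<omega>) - u (?g N k) (W (?g N k) \<omega>)"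
    have Hs: "H \<inter> stays a (?g N k) D \<in> sets (history (?g N k))" if "k \<le> N" for k
      using Hg[of k N] st[of k N] that by auto
    have eq: "indicator H \<omega> * ?X u N \<omega> = indicator H \<omega> * u a (W a \<omega>) +
       (\<Sum>k\<le>N. indicator (H \<inter> stays a (?g N k) D) \<omega> * ?d k \<omega>)" for \<omega>
      by (simp only: grid_stopped_def distrib_left sum_distrib_left indicator_inter_arith mult.assoc)
    have i1: "integrable M (\<lambda>\<omega>. indicator H \<omega> * u a (W a \<omega>))"
      using int[OF u, of 0 N] by (intro indicator_mult_integrable) auto
    have i2: "integrable M (\<lambda>\<omega>. indicator (H \<inter> stays a (?g N k) D) \<omega> * ?d k \<omega>)" if "k \<le> N" for k
      using that history_sets[OF Hs[OF that]]
      by (intro indicator_mult_integrable Bochner_Integration.integrable_diff int[OF u]) auto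
    have "(\<integral>\<omega>. indicator H \<omega> * ?X u N \<omega> \<partial>M) = (\<integral>\<omega>. indicator H \<omega> * u a (W a \<omega>) \<partial>M) +
      (\<Sum>k\<le>N. (\<integral>\<omega>. indicator (H \<inter> stays a (?g N k) D) \<omega> * ?d k \<omega> \<partial>M))"
    proof -
      have i3: "integrable M (\<lambda>\<omega>. \<Sum>k\<le>N. indicator (H \<inter> stays a (?g N k) D) \<omega> * ?d k \<omega>)"
        by (rule Bochner_Integration.integrable_sum) (rule i2, simp)
      show ?thesis
        unfolding eq Bochner_Integration.integral_add[OF i1 i3]
        by (subst Bochner_Integration.integral_sum) (rule i2, simp, rule refl)
    qed
    moreover have "(\<Sum>k\<le>N. (\<integral>\<omega>. indicator (H \<inter> stays a (?g N k) D) \<omega> * ?d k \<omega> \<partial>M)) \<ge> 0"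
      by (intro sum_nonneg incr[OF u] Hs) auto
    ultimately show ?thesis by linarith
  qed
  obtain C c where bnd: "\<And>s z. s \<in> {0..t} \<Longrightarrow> \<bar>u s z\<bar> \<le> C * cosh2 c z"
    using u unfolding subcaloric_def by blast
  define v where "v s z = C\<^sup>2 * cosh2 (2 * c) z" for s :: real and z
  have v: "subcaloric t v" unfolding v_def[abs_def] by (rule subcaloric_cosh2) simp
  have uv: "(u s z)\<^sup>2 \<le> v s z" if "s \<in> {0..t}" for s z
  proof -
    have "(u s z)\<^sup>2 \<le> (C * cosh2 c z)\<^sup>2" using power_mono[OF bnd[OF that, of z], of 2] by simp
    also have "\<dots> \<le> v s z" using cosh2_square_le[of c z] by (simp add: v_def power_mult_distrib mult_left_mono)
    finally show ?thesis .
  qed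
  have upper: "(\<integral>\<omega>. ?X v N \<omega> \<partial>M) \<le> (\<integral>\<omega>. v t (W t \<omega>) \<partial>M)" for N
  proof -
    let ?d = "\<lambda>k \<omega>. v (?g N (Suc k)) (W (?g N (Suc k)) \<omega>) - v (?g N k) (W (?g N k) \<omega>)"
    have Hs: "space M - stays a (?g N k) D \<in> sets (history (?g N k))" if "k \<le> N" for k
      using sets.compl_sets[OF st[of k N]] that by simp
    have tele: "v t (W t \<omega>) = v a (W a \<omega>) + (\<Sum>k\<le>N. ?d k \<omega>)" for \<omega>
      unfolding lessThan_Suc_atMost[symmetric] by (subst sum_lessThan_telescope) simp
    have eq: "?X v N \<omega> = v t (W t \<omega>) - (\<Sum>k\<le>N. indicator (space M - stays a (?g N k) D) \<omega> * ?d k \<omega>)" if "\<omega> \<in> space M" for \<omega>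
    proof -
      have "(\<Sum>k\<le>N. ?d k \<omega>) = (\<Sum>k\<le>N. indicator (stays a (?g N k) D) \<omega> * ?d k \<omega>) + (\<Sum>k\<le>N. indicator (space M - stays a (?g N k) D) \<omega> * ?d k \<omega>)"
        unfolding sum.distrib[symmetric] using that by (intro sum.cong) (auto simp: indicator_def)
      then show ?thesis unfolding tele grid_stopped_def by linarith
    qed
    have i2: "integrable M (\<lambda>\<omega>. indicator (space M - stays a (?g N k) D) \<omega> * ?d k \<omega>)" if "k \<le> N" for k
      using that history_sets[OF Hs[OF that]]
      by (intro indicator_mult_integrable Bochner_Integration.integrable_diff int[OF v]) auto
    have i1: "integrable M (\<lambda>\<omega>. v t (W t \<omega>))" using int[OF v, of "Suc N" N] by simp
    have "(\<integral>\<omega>. ?X v N \<omega> \<partial>M) = (\<integral>\<omega>. v t (W t \<omega>) - (\<Sum>k\<le>N. indicator (space M - stays a (?g N k) D) \<omega> * ?d k \<omega>) \<partial>M)"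
      by (intro Bochner_Integration.integral_cong eq refl)
    also have "\<dots> = (\<integral>\<omega>. v t (W t \<omega>) \<partial>M) - (\<Sum>k\<le>N. (\<integral>\<omega>. indicator (space M - stays a (?g N k) D) \<omega> * ?d k \<omega> \<partial>M))"
    proof -
      have i3: "integrable M (\<lambda>\<omega>. \<Sum>k\<le>N. indicator (space M - stays a (?g N k) D) \<omega> * ?d k \<omega>)"
        by (rule Bochner_Integration.integrable_sum) (rule i2, simp)
      show ?thesis
        unfolding Bochner_Integration.integral_diff[OF i1 i3]
        by (subst Bochner_Integration.integral_sum) (rule i2, simp, rule refl)
    qed
    moreover have "(\<Sum>k\<le>N. (\<integral>\<omega>. indicator (space M - stays a (?g N k) D) \<omega> * ?d k \<omega> \<partial>M)) \<ge> 0"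
      by (intro sum_nonneg incr[OF v] Hs) auto
    ultimately show ?thesis by linarith
  qed
  have XX: "(?X u N \<omega>)\<^sup>2 \<le> ?X v N \<omega>" if \<omega>: "\<omega> \<in> space M" for N \<omega>
  proof -
    obtain \<rho> where "stop_time a D t \<omega> \<le> \<rho>" "\<rho> \<le> t" "\<And>u. ?X u N \<omega> = u \<rho> (W \<rho> \<omega>)"
      using grid_stopped_eq[OF D a \<omega>] by blast
    then show ?thesis using uv[of \<rho>] stop_time_bounds[OF D a \<omega>] a by auto
  qed
  let ?Y = "\<lambda>\<omega>. u (stop_time a D t \<omega>) (stopped a D t \<omega>)"
  have cont: "continuous_on UNIV (\<lambda>p. u (fst p) (snd p))" using u by (simp add: subcaloric_def)
  have lim: "(\<lambda>N. ?X u N \<omega>) \<longlonglongrightarrow> ?Y \<omega>" if \<omega>: "\<omega> \<in> space M" for \<omega>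
  proof -
    obtain \<rho> where \<rho>: "\<And>N. stop_time a D t \<omega> \<le> \<rho> N" "\<And>N. \<rho> N \<le> stop_time a D t \<omega> + (t - a) / real (Suc N)"
      "\<And>N u. ?X u N \<omega> = u (\<rho> N) (W (\<rho> N) \<omega>)"
      using grid_stopped_eq[OF D a \<omega>] by metis
    have "(\<lambda>N. stop_time a D t \<omega> + (t - a) * inverse (real (Suc N))) \<longlonglongrightarrow> stop_time a D t \<omega> + (t - a) * 0"
      by (intro tendsto_intros LIMSEQ_inverse_real_of_nat)
    then have \<rho>lim: "\<rho> \<longlonglongrightarrow> stop_time a D t \<omega>"
      using \<rho> by (intro tendsto_sandwich[OF _ _ tendsto_const, of "stop_time a D t \<omega>" \<rho>]) (auto simp: field_simps)
    have "(\<lambda>N. W (\<rho> N) \<omega>) \<longlonglongrightarrow> W (stop_time a D t \<omega>) \<omega>"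
    proof (rule continuous_on_tendsto_compose[OF continuous_path[OF \<omega>] \<rho>lim])
      show "stop_time a D t \<omega> \<in> {0..}" using stop_time_bounds[OF D a \<omega>] a by auto
      then have "0 \<le> stop_time a D t \<omega>" by simp
      then show "\<forall>\<^sub>F N in sequentially. \<rho> N \<in> {0..}"
        unfolding atLeast_iff by (intro always_eventually allI order_trans[OF _ \<rho>(1)])
    qed
    then have "(\<lambda>N. (\<rho> N, W (\<rho> N) \<omega>)) \<longlonglongrightarrow> (stop_time a D t \<omega>, stopped a D t \<omega>)"
      unfolding stopped_def by (intro tendsto_intros \<rho>lim)
    from continuous_on_tendsto_compose[OF cont this]
    have "(\<lambda>N. u (\<rho> N) (W (\<rho> N) \<omega>)) \<longlonglongrightarrow> ?Y \<omega>" by (simp add: always_eventually)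
    then show ?thesis by (simp only: \<rho>(3))
  qed
  have Xm [measurable]: "?X u N \<in> borel_measurable M" for N using Xint[OF u] by auto
  have Ym [measurable]: "?Y \<in> borel_measurable M"
    by (rule borel_measurable_LIMSEQ_real[OF lim Xm])
  have sq: "integrable M (\<lambda>\<omega>. (indicator G \<omega> * ?X u N \<omega>)\<^sup>2)"
    "(\<integral>\<omega>. (indicator G \<omega> * ?X u N \<omega>)\<^sup>2 \<partial>M) \<le> (\<integral>\<omega>. v t (W t \<omega>) \<partial>M)" if [measurable]: "G \<in> events" for N G
  proof -
    have le: "(indicator G \<omega> * ?X u N \<omega>)\<^sup>2 \<le> ?X v N \<omega>" if "\<omega> \<in> space M" for \<omega>
      using XX[OF that, of N] order_trans[OF zero_le_power2 XX[OF that, of N]] by (auto simp: indicator_def)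
    show *: "integrable M (\<lambda>\<omega>. (indicator G \<omega> * ?X u N \<omega>)\<^sup>2)"
      by (rule Bochner_Integration.integrable_bound[OF Xint[OF v, of N]])
         (use le in \<open>auto intro!: order_trans[OF _ abs_ge_self]\<close>)
    show "(\<integral>\<omega>. (indicator G \<omega> * ?X u N \<omega>)\<^sup>2 \<partial>M) \<le> (\<integral>\<omega>. v t (W t \<omega>) \<partial>M)"
      by (rule order_trans[OF _ upper[of N]]) (rule integral_mono[OF * Xint[OF v] le])
  qed
  show "integrable M ?Y"
  proof (rule L2_bounded_convergence(1)[of "\<lambda>N \<omega>. indicator (space M) \<omega> * ?X u N \<omega>" ?Y])
    show "AE \<omega> in M. (\<lambda>N. indicator (space M) \<omega> * ?X u N \<omega>) \<longlonglongrightarrow> ?Y \<omega>"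
      using lim by (intro AE_I2) simp
  qed (use sq[of "space M"] in auto)
  have "(\<lambda>N. \<integral>\<omega>. indicator H \<omega> * ?X u N \<omega> \<partial>M) \<longlonglongrightarrow> (\<integral>\<omega>. indicator H \<omega> * ?Y \<omega> \<partial>M)"
  proof (rule L2_bounded_convergence(2))
    show "AE \<omega> in M. (\<lambda>N. indicator H \<omega> * ?X u N \<omega>) \<longlonglongrightarrow> indicator H \<omega> * ?Y \<omega>"
      by (intro AE_I2 tendsto_mult tendsto_const lim)
  qed (use sq[of H] history_sets[OF H] in auto)
  then show "(\<integral>\<omega>. indicator H \<omega> * u a (W a \<omega>) \<partial>M) \<le> (\<integral>\<omega>. indicator H \<omega> * ?Y \<omega> \<partial>M)"
    by (rule LIMSEQ_le_const) (use lower in auto)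
qed

lemma optional_stopping_eq:
  assumes D: "open D" and a: "0 \<le> a" "a \<le> t" and u: "caloric t u" and H: "H \<in> sets (history a)"
  shows "(\<integral>\<omega>. indicator H \<omega> * u (stop_time a D t \<omega>) (stopped a D t \<omega>) \<partial>M) = (\<integral>\<omega>. indicator H \<omega> * u a (W a \<omega>) \<partial>M)"
  using optional_stopping(2)[OF D a _ H, of u] optional_stopping(2)[OF D a _ H, of "\<lambda>s z. - u s z"] u
  by (simp add: caloric_def)

lemma optional_stopping_start:
  assumes D: "open D" and t: "0 \<le> t" and u: "caloric t u"
  shows "(\<integral>\<omega>. u (stop_time 0 D t \<omega>) (stopped 0 D t \<omega>) \<partial>M) = u 0 0"
proof -
  have [measurable]: "u 0 \<in> borel_measurable borel" using u by (auto simp: caloric_def intro: subcaloric_meas)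
  have "(\<integral>\<omega>. u (stop_time 0 D t \<omega>) (stopped 0 D t \<omega>) \<partial>M)
    = (\<integral>\<omega>. indicator (space M) \<omega> * u (stop_time 0 D t \<omega>) (stopped 0 D t \<omega>) \<partial>M)"
    by (intro Bochner_Integration.integral_cong) auto
  also have "\<dots> = (\<integral>\<omega>. indicator (space M) \<omega> * u 0 (W 0 \<omega>) \<partial>M)"
    by (rule optional_stopping_eq[OF D _ t u space_in_history]) simp
  also have "\<dots> = (\<integral>\<omega>. u 0 0 \<partial>M)"
  proof (rule integral_cong_AE)
    show "AE \<omega> in M. indicator (space M) \<omega> * u 0 (W 0 \<omega>) = u 0 0"
      using AE_start AE_space by eventually_elim simp
  qed auto
  also have "\<dots> = u 0 0" by (simp add: prob_space)
  finally show ?thesis .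
qed

end

section \<open>Discretely killed heat kernels\<close>

text \<open>Otherwise \<open>f\<close> exceeds \<open>c\<close> by a fixed amount on a bounded set of positive measure.\<close>

lemma AE_le_if_nn_integral_le:
  fixes f :: "complex \<Rightarrow> ennreal"
  assumes f [measurable]: "f \<in> borel_measurable borel" and c: "0 \<le> c"
    and le: "\<And>A. A \<in> sets borel \<Longrightarrow> (\<integral>\<^sup>+y. f y * indicator A y \<partial>lborel) \<le> ennreal c * emeasure lborel A"
  shows "AE y in lborel. f y \<le> ennreal c"
proof -
  let ?A = "\<lambda>n. {y \<in> ball 0 (real n). ennreal (c + inverse (real (Suc n))) \<le> f y}"
  have [measurable]: "?A n \<in> sets borel" for n by measurable
  have "emeasure lborel (?A n) = 0" for n
  proof (rule ccontr)
    assume nz: "emeasure lborel (?A n) \<noteq> 0"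
    have "emeasure lborel (?A n) \<le> emeasure lborel (ball (0::complex) (real n))"
      by (rule emeasure_mono) auto
    also have "\<dots> < \<infinity>" by (rule emeasure_bounded_finite) simp
    finally have fin: "emeasure lborel (?A n) < \<infinity>" .
    have "ennreal (c + inverse (real (Suc n))) * emeasure lborel (?A n)
        = (\<integral>\<^sup>+y. ennreal (c + inverse (real (Suc n))) * indicator (?A n) y \<partial>lborel)"
      by (simp add: nn_integral_cmult_indicator)
    also have "\<dots> \<le> (\<integral>\<^sup>+y. f y * indicator (?A n) y \<partial>lborel)"
      by (rule nn_integral_mono) (auto simp: indicator_def)
    also have "\<dots> \<le> ennreal c * emeasure lborel (?A n)" by (rule le) measurable
    finally have "ennreal (c + inverse (real (Suc n))) \<le> ennreal c"
      using nz fin ennreal_mult_le_mult_iff[of "emeasure lborel (?A n)"] by (simp add: mult.commute)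
    then show False using c by (simp add: ennreal_le_iff)
  qed
  then have "AE y in lborel. \<forall>n. y \<notin> ?A n"
    by (intro AE_all_countable[THEN iffD2] allI AE_not_in null_setsI) auto
  then show ?thesis
  proof eventually_elim
    case (elim y)
    show ?case
    proof (rule ccontr)
      assume "\<not> f y \<le> ennreal c"
      then obtain x where x: "ennreal c < x" "x < f y" using dense[of "ennreal c" "f y"] by (auto simp: not_le)
      then have "x \<noteq> \<infinity>" by auto
      then obtain b where "x = ennreal b" "0 \<le> b" by (cases x rule: ennreal_cases) auto
      then have b: "ennreal c < ennreal b" "ennreal b \<le> f y" "0 \<le> b" using x by auto
      then have "0 < b - c" using c by (simp add: ennreal_less_iff)
      then obtain n where n: "inverse (real (Suc n)) < b - c" using reals_Archimedean by blast
      obtain k where k: "norm y < real k" using reals_Archimedean2 by blast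
      let ?n = "max n k"
      have "inverse (real (Suc ?n)) \<le> inverse (real (Suc n))" by (intro le_imp_inverse_le) auto
      then have "ennreal (c + inverse (real (Suc ?n))) \<le> ennreal b" using n by (intro ennreal_leI) linarith
      then have "y \<in> ?A ?n" using b(2) k by (auto simp: dist_norm intro: order_trans)
      then show False using elim by blast
    qed
  qed
qed

text \<open>The density of the position after \<open>n + 1\<close> Gaussian steps of variance \<open>d\<close> per coordinate, started at \<open>0\<close>, on the event that
  the positions after \<open>1, \<dots>, n\<close> steps lie in \<open>K\<close>; there is no condition on the last position. This is \<open>kern_law\<close> below.\<close>

primrec kern :: "real \<Rightarrow> complex set \<Rightarrow> nat \<Rightarrow> complex \<Rightarrow> ennreal" where
  "kern d K 0 = (\<lambda>y. ennreal (gauss_density d y))"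
| "kern d K (Suc n) = (\<lambda>y. \<integral>\<^sup>+z. kern d K n z * indicator K z * ennreal (gauss_density d (y - z)) \<partial>lborel)"

text \<open>By symmetry of the steps, the density of a return to \<open>0\<close> after \<open>n + m + 2\<close> steps with all positions in
  between in \<open>K\<close>. That it depends on \<open>n + m\<close> only is \<open>kern_inner_eq\<close>, and then
  \<open>kern_inner_Cauchy_Schwarz\<close> says that it is log-convex.\<close>

definition kern_inner :: "real \<Rightarrow> complex set \<Rightarrow> nat \<Rightarrow> nat \<Rightarrow> ennreal" where
  "kern_inner d K n m = (\<integral>\<^sup>+z. kern d K n z * kern d K m z * indicator K z \<partial>lborel)"

lemma measurable_kern [measurable]:
  assumes [measurable]: "K \<in> sets borel"
  shows "kern d K n \<in> borel_measurable borel"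
proof (induction n)
  case (Suc n)
  note [measurable] = Suc
  have "(\<lambda>y. \<integral>\<^sup>+z. kern d K n z * indicator K z * ennreal (gauss_density d (y - z)) \<partial>lborel) \<in> borel_measurable borel"
    by measurable
  then show ?case by simp
qed simp

lemma kern_inner_shift:
  assumes [measurable]: "K \<in> sets borel"
  shows "kern_inner d K n (Suc m) = kern_inner d K (Suc n) m"
proof -
  let ?g = "\<lambda>z w. ennreal (gauss_density d (z - w))"
  have "kern_inner d K n (Suc m) = (\<integral>\<^sup>+z. \<integral>\<^sup>+w. kern d K n z * indicator K z * (kern d K m w * indicator K w * ?g z w) \<partial>lborel \<partial>lborel)"
    unfolding kern_inner_def by (subst nn_integral_cmult) (auto simp: mult_ac)
  also have "\<dots> = (\<integral>\<^sup>+w. \<integral>\<^sup>+z. kern d K n z * indicator K z * (kern d K m w * indicator K w * ?g z w) \<partial>lborel \<partial>lborel)"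
    by (rule lborel_pair.Fubini') measurable
  also have "\<dots> = (\<integral>\<^sup>+w. \<integral>\<^sup>+z. (kern d K m w * indicator K w) * (kern d K n z * indicator K z * ?g w z) \<partial>lborel \<partial>lborel)"
    by (simp add: mult_ac gauss_density_even)
  also have "\<dots> = kern_inner d K (Suc n) m"
    unfolding kern_inner_def by (subst nn_integral_cmult) (auto simp: mult_ac)
  finally show ?thesis .
qed

lemma kern_inner_eq:
  assumes K: "K \<in> sets borel" and "n + m = n' + m'"
  shows "kern_inner d K n m = kern_inner d K n' m'"
proof -
  have *: "kern_inner d K n m = kern_inner d K (n + m) 0" for n m
    by (induction m arbitrary: n) (simp_all add: kern_inner_shift[OF K])
  show ?thesis using *[of n m] *[of n' m'] assms(2) by simp
qed

lemma kern_inner_Cauchy_Schwarz: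
  assumes [measurable]: "K \<in> sets borel"
  shows "(kern_inner d K n m)\<^sup>2 \<le> kern_inner d K n n * kern_inner d K m m"
proof -
  have ind: "indicator K z * indicator K z = (indicator K z :: ennreal)" for z by (auto simp: indicator_def)
  have "kern_inner d K n m = (\<integral>\<^sup>+z. (kern d K n z * indicator K z) * (kern d K m z * indicator K z) \<partial>lborel)" for n m
    unfolding kern_inner_def by (intro nn_integral_cong) (auto simp: indicator_def)
  then show ?thesis
    using Cauchy_Schwarz_nn_integral[of "\<lambda>z. kern d K n z * indicator K z" lborel "\<lambda>z. kern d K m z * indicator K z"]
    by (simp add: power2_eq_square)
qed

text \<open>Log-convexity makes the successive ratios increase, so \<open>\<gamma> i * \<gamma> j \<le> \<gamma> 0 * \<gamma> (i + j)\<close>. The ratios are compared in the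
  form of products, since terms may vanish.\<close>

lemma logconvex_power_le:
  fixes \<gamma> :: "nat \<Rightarrow> real"
  assumes nonneg: "\<And>i. 0 \<le> \<gamma> i" and conv: "\<And>i. (\<gamma> (Suc i))\<^sup>2 \<le> \<gamma> i * \<gamma> (Suc (Suc i))"
    and le1: "\<gamma> 0 \<le> 1" and k: "1 \<le> k"
  shows "\<gamma> m ^ k \<le> \<gamma> (m * k)"
proof -
  have cross: "\<gamma> (Suc i) * \<gamma> j \<le> \<gamma> i * \<gamma> (Suc j)" if "i \<le> j" for i j
    using that
  proof (induction j rule: dec_induct)
    case base then show ?case by (simp add: mult.commute)
  next
    case (step j)
    show ?case
    proof (cases "\<gamma> j = 0 \<or> \<gamma> (Suc j) = 0")
      case True
      then have "\<gamma> (Suc j) = 0" using conv[of j] by auto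
      then show ?thesis using nonneg by simp
    next
      case False
      then have pos: "0 < \<gamma> j * \<gamma> (Suc j)" using nonneg[of j] nonneg[of "Suc j"] by (simp add: less_le)
      have "(\<gamma> (Suc i) * \<gamma> j) * (\<gamma> (Suc j))\<^sup>2 \<le> (\<gamma> i * \<gamma> (Suc j)) * (\<gamma> j * \<gamma> (Suc (Suc j)))"
        by (intro mult_mono step.IH conv mult_nonneg_nonneg nonneg zero_le_power2)
      then have "(\<gamma> (Suc i) * \<gamma> (Suc j)) * (\<gamma> j * \<gamma> (Suc j)) \<le> (\<gamma> i * \<gamma> (Suc (Suc j))) * (\<gamma> j * \<gamma> (Suc j))"
        by (simp add: power2_eq_square mult_ac)
      then show ?thesis using pos by (simp only: mult_le_cancel_right)
    qed
  qed
  have super': "\<gamma> i * \<gamma> j \<le> \<gamma> 0 * \<gamma> (i + j)" if "i \<le> j" for i j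
    using that
  proof (induction i arbitrary: j)
    case (Suc i)
    then show ?case using cross[of i j] Suc.IH[of "Suc j"] by simp
  qed simp
  have super: "\<gamma> i * \<gamma> j \<le> \<gamma> (i + j)" for i j
  proof -
    have "\<gamma> i * \<gamma> j \<le> \<gamma> 0 * \<gamma> (i + j)"
      using super'[of i j] super'[of j i] by (cases "i \<le> j") (auto simp: mult.commute add.commute)
    also have "\<dots> \<le> 1 * \<gamma> (i + j)" by (intro mult_right_mono le1 nonneg)
    finally show ?thesis by simp
  qed
  show ?thesis using k
  proof (induction k rule: dec_induct)
    case (step k)
    have "\<gamma> m ^ Suc k \<le> \<gamma> (m * k) * \<gamma> m" using step.IH nonneg by (simp add: mult.commute mult_left_mono)
    also have "\<dots> \<le> \<gamma> (m * Suc k)" using super[of "m * k" m] by (simp add: add.commute)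
    finally show ?case .
  qed simp
qed

context planar_BM
begin

definition visits :: "real \<Rightarrow> complex set \<Rightarrow> nat \<Rightarrow> 'a set" where
  "visits d K n = {\<omega> \<in> space M. \<forall>i\<in>{1..n}. W (real i * d) \<omega> \<in> K}"

lemma visits_Suc: "\<omega> \<in> visits d K (Suc n) \<longleftrightarrow> \<omega> \<in> visits d K n \<and> W (real (Suc n) * d) \<omega> \<in> K"
proof -
  have "{1..Suc n} = insert (Suc n) {1..n}" by auto
  then show ?thesis by (auto simp: visits_def simp del: of_nat_Suc)
qed

lemma visits_in_history:
  assumes "0 < d" "K \<in> sets borel"
  shows "visits d K n \<in> sets (history (real n * d))"
proof (cases "n = 0")
  case True
  then show ?thesis using sets.top[of "history (real n * d)"] by (simp add: visits_def)
next
  case False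
  then have eq: "visits d K n = (\<Inter>i\<in>{1..n}. W (real i * d) -` K \<inter> space M)"
    by (auto simp: visits_def)
  have "W (real i * d) -` K \<inter> space M \<in> sets (history (real n * d))" if "i \<in> {1..n}" for i
    using measurable_sets[OF measurable_history_W[of "real i * d" "real n * d"] assms(2)] that assms(1) by simp
  then show ?thesis unfolding eq using False by (intro sets.finite_INT) auto
qed

lemma visits_events: "0 < d \<Longrightarrow> K \<in> sets borel \<Longrightarrow> visits d K n \<in> events"
  by (rule history_sets[OF visits_in_history])

lemma nn_integral_W:
  assumes t: "0 < t" and [measurable]: "f \<in> borel_measurable borel"
  shows "(\<integral>\<^sup>+\<omega>. f (W t \<omega>) \<partial>M) = (\<integral>\<^sup>+y. ennreal (gauss_density t y) * f y \<partial>lborel)"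
proof -
  note [measurable] = measurable_W[of 0, simplified] measurable_W[OF less_imp_le[OF t]]
  have "(\<integral>\<^sup>+\<omega>. f (W t \<omega>) \<partial>M) = (\<integral>\<^sup>+\<omega>. f (W t \<omega> - W 0 \<omega>) \<partial>M)"
    by (rule nn_integral_cong_AE) (use AE_start in eventually_elim, simp)
  also have "\<dots> = (\<integral>\<^sup>+y. f y \<partial>gauss t)"
    using nn_integral_distr[of "\<lambda>\<omega>. W t \<omega> - W 0 \<omega>" M borel f] distr_increment[of 0 t] t by simp
  also have "\<dots> = (\<integral>\<^sup>+y. ennreal (gauss_density t y) * f y \<partial>lborel)"
    unfolding gauss_def by (subst nn_integral_density) auto
  finally show ?thesis .
qed

lemma kern_law:
  assumes d: "0 < d" and K [measurable]: "K \<in> sets borel" and f: "f \<in> borel_measurable borel"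
  shows "(\<integral>\<^sup>+\<omega>. indicator (visits d K n) \<omega> * f (W (real (Suc n) * d) \<omega>) \<partial>M) = (\<integral>\<^sup>+y. kern d K n y * f y \<partial>lborel)"
  using f
proof (induction n arbitrary: f)
  case 0
  have "(\<integral>\<^sup>+\<omega>. indicator (visits d K 0) \<omega> * f (W (real (Suc 0) * d) \<omega>) \<partial>M) = (\<integral>\<^sup>+\<omega>. f (W d \<omega>) \<partial>M)"
    by (intro nn_integral_cong) (auto simp: visits_def)
  then show ?case using nn_integral_W[OF d 0] by simp
next
  case (Suc n)
  note [measurable] = Suc.prems
  let ?s = "real (Suc n) * d" and ?t = "real (Suc (Suc n)) * d"
  have s: "0 \<le> ?s" "?s < ?t" "?t - ?s = d" using d by (auto simp: algebra_simps)
  define F where "F z = (\<integral>\<^sup>+y. f (z + y) \<partial>gauss d)" for z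
  interpret G: prob_space "gauss d" by (rule prob_space_gauss[OF d])
  have F [measurable]: "F \<in> borel_measurable borel" unfolding F_def by measurable
  have "(\<integral>\<^sup>+\<omega>. indicator (visits d K (Suc n)) \<omega> * f (W ?t \<omega>) \<partial>M) = (\<integral>\<^sup>+\<omega>. indicator (visits d K (Suc n)) \<omega> * F (W ?s \<omega>) \<partial>M)"
    using markov_nn_integral[OF s(1,2) visits_in_history[OF d K, of "Suc n"], of "\<lambda>p. f (fst p + snd p)"]
    unfolding s(3) F_def by simp
  also have "\<dots> = (\<integral>\<^sup>+\<omega>. indicator (visits d K n) \<omega> * (indicator K (W ?s \<omega>) * F (W ?s \<omega>)) \<partial>M)"
  proof (intro nn_integral_cong)
    fix \<omega>
    have "\<omega> \<in> visits d K (Suc n) \<longleftrightarrow> \<omega> \<in> visits d K n \<and> W ?s \<omega> \<in> K"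
      by (rule visits_Suc)
    then show "indicator (visits d K (Suc n)) \<omega> * F (W ?s \<omega>) = indicator (visits d K n) \<omega> * (indicator K (W ?s \<omega>) * F (W ?s \<omega>))"
      by (auto simp: indicator_def)
  qed
  also have "\<dots> = (\<integral>\<^sup>+z. kern d K n z * (indicator K z * F z) \<partial>lborel)"
    by (rule Suc.IH) measurable
  also have "\<dots> = (\<integral>\<^sup>+z. \<integral>\<^sup>+y. kern d K n z * indicator K z * (ennreal (gauss_density d (y - z)) * f y) \<partial>lborel \<partial>lborel)"
  proof (intro nn_integral_cong)
    fix z
    have "F z = (\<integral>\<^sup>+y. ennreal (gauss_density d y) * f (z + y) \<partial>lborel)"
      unfolding F_def gauss_def by (subst nn_integral_density) auto
    also have "\<dots> = (\<integral>\<^sup>+y. ennreal (gauss_density d (y - z)) * f y \<partial>distr lborel borel ((+) z))"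
      by (subst nn_integral_distr) auto
    also have "\<dots> = (\<integral>\<^sup>+y. ennreal (gauss_density d (y - z)) * f y \<partial>lborel)"
      by (simp add: lborel_distr_plus)
    finally have "kern d K n z * (indicator K z * F z) = kern d K n z * indicator K z * (\<integral>\<^sup>+y. ennreal (gauss_density d (y - z)) * f y \<partial>lborel)"
      by (simp add: mult.assoc)
    also have "\<dots> = (\<integral>\<^sup>+y. kern d K n z * indicator K z * (ennreal (gauss_density d (y - z)) * f y) \<partial>lborel)"
      by (rule nn_integral_cmult[symmetric]) measurable
    finally show "kern d K n z * (indicator K z * F z) = \<dots>" .
  qed
  also have "\<dots> = (\<integral>\<^sup>+y. \<integral>\<^sup>+z. kern d K n z * indicator K z * (ennreal (gauss_density d (y - z)) * f y) \<partial>lborel \<partial>lborel)"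
    by (rule lborel_pair.Fubini') measurable
  also have "\<dots> = (\<integral>\<^sup>+y. kern d K (Suc n) y * f y \<partial>lborel)"
    by (simp add: nn_integral_multc[symmetric] mult.assoc)
  finally show ?case .
qed

text \<open>Without the condition on the positions the density is that of a Gaussian of variance \<open>(n + 1) * d\<close> per coordinate,
  which \<open>gauss_density_le\<close> bounds.\<close>

lemma kern_AE_le:
  assumes d: "0 < d" and K [measurable]: "K \<in> sets borel"
  shows "AE y in lborel. kern d K n y \<le> ennreal (1 / (2 * pi * (real (Suc n) * d)))"
proof (rule AE_le_if_nn_integral_le)
  fix A :: "complex set" assume [measurable]: "A \<in> sets borel"
  let ?t = "real (Suc n) * d"
  have t: "0 < ?t" using d by simp
  have "(\<integral>\<^sup>+y. kern d K n y * indicator A y \<partial>lborel) = (\<integral>\<^sup>+\<omega>. indicator (visits d K n) \<omega> * indicator A (W ?t \<omega>) \<partial>M)"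
    by (rule kern_law[OF d K, symmetric]) measurable
  also have "\<dots> \<le> (\<integral>\<^sup>+\<omega>. indicator A (W ?t \<omega>) \<partial>M)"
    by (rule nn_integral_mono) (auto simp: indicator_def)
  also have "\<dots> = (\<integral>\<^sup>+y. ennreal (gauss_density ?t y) * indicator A y \<partial>lborel)"
    by (rule nn_integral_W[OF t]) measurable
  also have "\<dots> \<le> (\<integral>\<^sup>+y. ennreal (1 / (2 * pi * ?t)) * indicator A y \<partial>lborel)"
    by (intro nn_integral_mono mult_right_mono ennreal_leI gauss_density_le t) auto
  also have "\<dots> = ennreal (1 / (2 * pi * ?t)) * emeasure lborel A"
    by (rule nn_integral_cmult_indicator) simp
  finally show "(\<integral>\<^sup>+y. kern d K n y * indicator A y \<partial>lborel) \<le> ennreal (1 / (2 * pi * ?t)) * emeasure lborel A" .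
qed (use d in auto)

lemma prob_visits_Suc:
  assumes d: "0 < d" and K [measurable]: "K \<in> sets borel"
  shows "ennreal (prob (visits d K (Suc n))) = (\<integral>\<^sup>+y. kern d K n y * indicator K y \<partial>lborel)"
proof -
  have "(\<integral>\<^sup>+y. kern d K n y * indicator K y \<partial>lborel) = (\<integral>\<^sup>+\<omega>. indicator (visits d K n) \<omega> * indicator K (W (real (Suc n) * d) \<omega>) \<partial>M)"
    by (rule kern_law[OF d K, symmetric]) measurable
  also have "\<dots> = (\<integral>\<^sup>+\<omega>. indicator (visits d K (Suc n)) \<omega> \<partial>M)"
  proof (intro nn_integral_cong)
    fix \<omega>
    have "\<omega> \<in> visits d K (Suc n) \<longleftrightarrow> \<omega> \<in> visits d K n \<and> W (real (Suc n) * d) \<omega> \<in> K"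
      by (rule visits_Suc)
    then show "indicator (visits d K n) \<omega> * indicator K (W (real (Suc n) * d) \<omega>) = (indicator (visits d K (Suc n)) \<omega> :: ennreal)"
      by (auto simp: indicator_def)
  qed
  also have "\<dots> = ennreal (prob (visits d K (Suc n)))"
    using visits_events[OF d K] by (simp add: emeasure_eq_measure)
  finally show ?thesis ..
qed

text \<open>One of the two factors of the return density is replaced by its supremum; what remains is the survival probability.\<close>

lemma kern_inner_le_prob:
  assumes d: "0 < d" and K [measurable]: "K \<in> sets borel"
  shows "kern_inner d K n m \<le> ennreal (prob (visits d K (Suc n)) / (2 * pi * (real (Suc m) * d)))"
proof -
  let ?c = "1 / (2 * pi * (real (Suc m) * d))"
  have "kern_inner d K n m \<le> (\<integral>\<^sup>+y. ennreal ?c * (kern d K n y * indicator K y) \<partial>lborel)"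
    unfolding kern_inner_def
  proof (rule nn_integral_mono_AE)
    show "AE y in lborel. kern d K n y * kern d K m y * indicator K y \<le> ennreal ?c * (kern d K n y * indicator K y)"
      using kern_AE_le[OF d K, of m]
    proof eventually_elim
      case (elim y)
      then show ?case using mult_right_mono[OF elim, of "kern d K n y * indicator K y"] by (simp add: mult_ac)
    qed
  qed
  also have "\<dots> = ennreal ?c * ennreal (prob (visits d K (Suc n)))"
    unfolding prob_visits_Suc[OF d K] by (rule nn_integral_cmult) measurable
  also have "\<dots> = ennreal (prob (visits d K (Suc n)) / (2 * pi * (real (Suc m) * d)))"
    using d by (subst ennreal_mult[symmetric]) auto
  finally show ?thesis .
qed

text \<open>A surviving walk ends in \<open>G\<close> or not. The part of the density in \<open>G\<close> has a mass of at most the square root of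
  the area of \<open>G\<close> times its norm in \<open>L\<^sup>2\<close>, and the square of that norm is a return density.\<close>

lemma prob_visits_le_inner:
  assumes d: "0 < d" and K [measurable]: "K \<in> sets borel" and G [measurable]: "G \<in> sets borel"
    and V: "emeasure lborel G = ennreal V" "0 \<le> V" and \<beta>: "kern_inner d K n n = ennreal \<beta>" "0 \<le> \<beta>"
  shows "prob (visits d K (Suc n)) \<le> sqrt (V * \<beta>) + prob {\<omega>\<in>space M. W (real (Suc n) * d) \<omega> \<notin> G}"
proof -
  let ?t = "real (Suc n) * d"
  have [measurable]: "W ?t \<in> borel_measurable M" using d by simp
  note ve = visits_events[OF d K]
  have "(\<integral>\<^sup>+y. kern d K n y * (indicator K y * indicator G y) \<partial>lborel)\<^sup>2
     = (\<integral>\<^sup>+y. (kern d K n y * indicator K y) * indicator G y \<partial>lborel)\<^sup>2"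
    by (simp add: mult.assoc)
  also have "\<dots> \<le> (\<integral>\<^sup>+y. (kern d K n y * indicator K y)\<^sup>2 \<partial>lborel) * (\<integral>\<^sup>+y. (indicator G y)\<^sup>2 \<partial>lborel)"
    by (rule Cauchy_Schwarz_nn_integral) measurable
  also have "(\<integral>\<^sup>+y. (kern d K n y * indicator K y)\<^sup>2 \<partial>lborel) = kern_inner d K n n"
    unfolding kern_inner_def by (intro nn_integral_cong) (auto simp: indicator_def power2_eq_square)
  also have "(\<integral>\<^sup>+y. (indicator G y)\<^sup>2 \<partial>lborel) = (\<integral>\<^sup>+y. indicator G y \<partial>(lborel :: complex measure))"
    by (intro nn_integral_cong) (auto simp: indicator_def)
  finally have le: "(\<integral>\<^sup>+y. kern d K n y * (indicator K y * indicator G y) \<partial>lborel)\<^sup>2 \<le> ennreal (V * \<beta>)"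
    using V \<beta> by (simp add: ennreal_mult mult.commute)
  have E: "visits d K (Suc n) \<inter> (W ?t -` G \<inter> space M) \<in> events"
    by (intro sets.Int ve measurable_sets[OF _ G]) measurable
  have "ennreal (prob (visits d K (Suc n) \<inter> (W ?t -` G \<inter> space M)))
     = (\<integral>\<^sup>+\<omega>. indicator (visits d K (Suc n) \<inter> (W ?t -` G \<inter> space M)) \<omega> \<partial>M)"
    using E by (simp only: nn_integral_indicator emeasure_eq_measure)
  also have "\<dots> = (\<integral>\<^sup>+\<omega>. indicator (visits d K n) \<omega> * (indicator K (W ?t \<omega>) * indicator G (W ?t \<omega>)) \<partial>M)"
  proof (intro nn_integral_cong)
    fix \<omega> assume "\<omega> \<in> space M"
    have "\<omega> \<in> visits d K (Suc n) \<longleftrightarrow> \<omega> \<in> visits d K n \<and> W ?t \<omega> \<in> K"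
      by (rule visits_Suc)
    then show "indicator (visits d K (Suc n) \<inter> (W ?t -` G \<inter> space M)) \<omega> = (indicator (visits d K n) \<omega> * (indicator K (W ?t \<omega>) * indicator G (W ?t \<omega>)) :: ennreal)"
      using \<open>\<omega> \<in> space M\<close> by (auto simp: indicator_def)
  qed
  also have "\<dots> = (\<integral>\<^sup>+y. kern d K n y * (indicator K y * indicator G y) \<partial>lborel)"
    by (rule kern_law[OF d K]) measurable
  finally have "(ennreal (prob (visits d K (Suc n) \<inter> (W ?t -` G \<inter> space M))))\<^sup>2 \<le> ennreal (V * \<beta>)"
    using le by simp
  then have "(prob (visits d K (Suc n) \<inter> (W ?t -` G \<inter> space M)))\<^sup>2 \<le> V * \<beta>"
    using V \<beta> by (simp add: ennreal_power)
  then have 1: "prob (visits d K (Suc n) \<inter> (W ?t -` G \<inter> space M)) \<le> sqrt (V * \<beta>)"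
    by (rule real_le_rsqrt)
  have E2: "{\<omega>\<in>space M. W ?t \<omega> \<notin> G} \<in> events" by measurable
  have "prob (visits d K (Suc n)) \<le> prob ((visits d K (Suc n) \<inter> (W ?t -` G \<inter> space M)) \<union> {\<omega>\<in>space M. W ?t \<omega> \<notin> G})"
    by (rule finite_measure_mono[OF _ sets.Un[OF E E2]]) (auto simp: visits_def)
  also have "\<dots> \<le> prob (visits d K (Suc n) \<inter> (W ?t -` G \<inter> space M)) + prob {\<omega>\<in>space M. W ?t \<omega> \<notin> G}"
    by (rule measure_Un_le[OF E E2])
  finally show ?thesis using 1 by linarith
qed

end

section \<open>Existence of the exponential decay rate\<close>

context planar_BM
begin

text \<open>Survival up to time \<open>m + 1\<close> bounds the return density at time \<open>2 * (m + 1)\<close> from below. By log-convexity the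
  \<open>k\<close>-th power of that density is dominated by the return density at a time about \<open>k\<close> times as large, which in turn
  is bounded by a survival probability. The constants do not depend on the mesh \<open>1 / N\<close>.\<close>

lemma discrete_survival_inequality:
  fixes N m k :: nat
  assumes N: "1 \<le> N" and K [measurable]: "K \<in> sets borel" and k: "1 \<le> k" and G [measurable]: "G \<in> sets borel"
    and V: "emeasure lborel G = ennreal V" "0 < V"
  defines "P \<equiv> \<lambda>T. prob (visits (1 / real N) K (T * N))"
  shows "(2 * pi * (max 0 (P (Suc m) - prob {\<omega>\<in>space M. W (real (Suc m)) \<omega> \<notin> G}))\<^sup>2 / V) ^ k \<le> P (2 * m * k + 1)"
proof -
  let ?d = "1 / real N"
  have d: "0 < ?d" using N by simp
  \<comment> \<open>the kernel with index \<open>q T\<close> belongs to \<open>T * N\<close> steps, that is to time \<open>T\<close>\<close>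
  define q where "q T = T * N - 1" for T
  have Sq: "Suc (q T) = T * N" if "1 \<le> T" for T using that N by (simp add: q_def)
  have time: "real (Suc (q T)) * ?d = real T" if "1 \<le> T" for T
    using that N unfolding Sq[OF that] by simp
  define c where "c S T = kern_inner ?d K (q S) (q T)" for S T
  have c_eq: "c S T = c S' T'" if "S + T = S' + T'" "1 \<le> S" "1 \<le> T" "1 \<le> S'" "1 \<le> T'" for S T S' T'
  proof -
    have "Suc (q S) + Suc (q T) = Suc (q S') + Suc (q T')"
      using that by (simp only: Sq add_mult_distrib[symmetric])
    then show ?thesis unfolding c_def by (intro kern_inner_eq[OF K]) simp
  qed
  have c_CS: "(c S T)\<^sup>2 \<le> c S S * c T T" for S T
    unfolding c_def by (rule kern_inner_Cauchy_Schwarz[OF K])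
  have c_le: "c S T \<le> ennreal (P S / (2 * pi * real T))" if "1 \<le> S" "1 \<le> T" for S T
    using kern_inner_le_prob[OF d K, of "q S" "q T"] unfolding c_def time[OF that(2)] Sq[OF that(1)] P_def .
  have c_le1: "c S T \<le> ennreal (1 / (2 * pi))" if "1 \<le> S" "1 \<le> T" for S T
  proof -
    have "P S / (2 * pi * real T) \<le> 1 / (2 * pi * 1)"
      using that by (intro frac_le mult_left_mono) (auto simp: P_def)
    then show ?thesis using c_le[OF that] by (auto intro: order_trans ennreal_leI)
  qed
  define \<beta> where "\<beta> i = enn2real (c (Suc i) (Suc i))" for i
  have \<beta>: "c (Suc i) (Suc i) = ennreal (\<beta> i)" and \<beta>0: "0 \<le> \<beta> i" for i
    using le_less_trans[OF c_le1[of "Suc i" "Suc i"] ennreal_less_top] by (auto simp: \<beta>_def)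
  have conv: "(\<beta> (Suc i))\<^sup>2 \<le> \<beta> i * \<beta> (Suc (Suc i))" for i
  proof -
    have "c (Suc (Suc i)) (Suc (Suc i)) = c (Suc i) (Suc (Suc (Suc i)))" by (rule c_eq) auto
    then have "(ennreal (\<beta> (Suc i)))\<^sup>2 \<le> ennreal (\<beta> i) * ennreal (\<beta> (Suc (Suc i)))"
      using c_CS[of "Suc i" "Suc (Suc (Suc i))"] by (simp add: \<beta>)
    then show ?thesis using \<beta>0 by (simp add: ennreal_power ennreal_mult[symmetric])
  qed
  have upper: "2 * pi * \<beta> i \<le> P (2 * i + 1)" for i
  proof -
    have "c (Suc i) (Suc i) = c (2 * i + 1) 1" by (rule c_eq) auto
    also have "\<dots> \<le> ennreal (P (2 * i + 1) / (2 * pi * real 1))" by (rule c_le) auto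
    finally have "\<beta> i \<le> P (2 * i + 1) / (2 * pi)" by (simp add: \<beta> P_def)
    then show ?thesis by (simp add: pos_le_divide_eq mult.commute)
  qed
  have "(2 * pi * \<beta> m) ^ k \<le> 2 * pi * \<beta> (m * k)"
  proof (rule logconvex_power_le[of "\<lambda>i. 2 * pi * \<beta> i", OF _ _ _ k])
    show "(2 * pi * \<beta> (Suc i))\<^sup>2 \<le> 2 * pi * \<beta> i * (2 * pi * \<beta> (Suc (Suc i)))" for i
      using mult_left_mono[OF conv[of i], of "(2 * pi)\<^sup>2"] by (simp add: power2_eq_square mult_ac)
    show "2 * pi * \<beta> 0 \<le> 1" using upper[of 0] by (auto simp: P_def intro: order_trans)
  qed (use \<beta>0 in simp)
  also have "\<dots> \<le> P (2 * m * k + 1)" using upper[of "m * k"] by (simp add: mult.assoc)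
  finally have 1: "(2 * pi * \<beta> m) ^ k \<le> P (2 * m * k + 1)" .
  let ?e = "prob {\<omega>\<in>space M. W (real (Suc m)) \<omega> \<notin> G}"
  have "P (Suc m) \<le> sqrt (V * \<beta> m) + ?e"
    using prob_visits_le_inner[OF d K G V(1) less_imp_le[OF V(2)] _ \<beta>0[of m], of "q (Suc m)"] \<beta>[of m]
    unfolding c_def time[of "Suc m", simplified] Sq[of "Suc m", simplified] P_def
    using time[of "Suc m"] Sq[of "Suc m"] by simp
  then have "max 0 (P (Suc m) - ?e) \<le> sqrt (V * \<beta> m)"
    using V \<beta>0[of m] by simp
  then have "(max 0 (P (Suc m) - ?e))\<^sup>2 \<le> (sqrt (V * \<beta> m))\<^sup>2" by (intro power_mono) auto
  then have "(max 0 (P (Suc m) - ?e))\<^sup>2 / V \<le> \<beta> m" using V \<beta>0[of m] by (simp add: pos_divide_le_eq mult.commute)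
  from mult_left_mono[OF this, of "2 * pi"]
  have "2 * pi * (max 0 (P (Suc m) - ?e))\<^sup>2 / V \<le> 2 * pi * \<beta> m" by simp
  then have "(2 * pi * (max 0 (P (Suc m) - ?e))\<^sup>2 / V) ^ k \<le> (2 * pi * \<beta> m) ^ k"
    using V by (intro power_mono) auto
  then show ?thesis using 1 by linarith
qed

text \<open>The dyadic grids are nested, and a continuous path that lies in the closed set \<open>K\<close> at all positive dyadic times up to
  \<open>T\<close> stays in \<open>K\<close>.\<close>

lemma prob_visits_tendsto:
  assumes K: "closed K" and T: "1 \<le> T"
  shows "(\<lambda>r. prob (visits (1 / real (2 ^ r)) K (T * 2 ^ r))) \<longlonglongrightarrow> prob (stays 0 (real T) K)"
proof -
  let ?A = "\<lambda>r. visits (1 / real (2 ^ r)) K (T * 2 ^ r)"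
  have ev: "?A r \<in> events" for r using K by (intro visits_events) auto
  have dec: "decseq ?A"
  proof (rule decseq_SucI, rule subsetI)
    fix r \<omega> assume \<omega>: "\<omega> \<in> ?A (Suc r)"
    have "W (real i * (1 / real (2 ^ r))) \<omega> \<in> K" if "i \<in> {1..T * 2 ^ r}" for i
    proof -
      have "2 * i \<in> {1..T * 2 ^ Suc r}" using that by auto
      then have "W (real (2 * i) * (1 / real (2 ^ Suc r))) \<omega> \<in> K" using \<omega> unfolding visits_def by blast
      then show ?thesis by simp
    qed
    then show "\<omega> \<in> ?A r" using \<omega> by (auto simp: visits_def)
  qed
  have "(\<Inter>r. ?A r) = stays 0 (real T) K"
  proof (intro equalityI subsetI)
    fix \<omega> assume \<omega>: "\<omega> \<in> (\<Inter>r. ?A r)"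
    let ?S = "{0<..real T} \<inter> (\<Union>k m. {real m / 2^k})"
    have "closure ?S = closure {0<..real T}"
      using T by (intro closure_dyadic_rationals_in_convex_set_pos_1) auto
    then have cl: "{0..real T} \<subseteq> closure ?S" using T by simp
    show "\<omega> \<in> stays 0 (real T) K"
    proof (rule stays_dense[OF K order_refl cl])
      show "?S \<subseteq> {0..real T}" by auto
      show "\<omega> \<in> space M" using \<omega> by (auto simp: visits_def)
      fix s assume "s \<in> ?S"
      then obtain k m where s: "s = real m / 2 ^ k" "0 < s" "s \<le> real T" by auto
      have "real m \<le> real (T * 2 ^ k)" using s by (simp add: pos_divide_le_eq)
      then have "m \<le> T * 2 ^ k" by (simp only: of_nat_le_iff)
      moreover have "1 \<le> m" using s by (cases m) auto
      ultimately show "W s \<omega> \<in> K" using \<omega> s by (auto simp: visits_def)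
    qed
  next
    fix \<omega> assume \<omega>: "\<omega> \<in> stays 0 (real T) K"
    have "W (real i * (1 / real (2 ^ r))) \<omega> \<in> K" if "i \<in> {1..T * 2 ^ r}" for i r
    proof -
      have "real i \<le> real (T * 2 ^ r)" using that by (simp only: of_nat_le_iff) auto
      then have "real i * (1 / real (2 ^ r)) \<in> {0..real T}" by (simp add: pos_divide_le_eq)
      then show ?thesis using \<omega> unfolding stays_def by blast
    qed
    then show "\<omega> \<in> (\<Inter>r. ?A r)" using \<omega> by (auto simp: visits_def stays_def)
  qed
  then show ?thesis using finite_Lim_measure_decseq[OF _ dec] ev by auto
qed

text \<open>The discrete inequality passes to the limit for closed sets, by refining the grid, and then to open sets, by
  exhausting them with closed ones.\<close>

lemma survival_inequality:
  fixes m k :: nat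
  assumes D: "open D" and k: "1 \<le> k" and G: "G \<in> sets borel"
    and V: "emeasure lborel G = ennreal V" "0 < V"
  defines "p \<equiv> \<lambda>t. prob (stays 0 t D)"
  shows "(2 * pi * (max 0 (p (real (Suc m)) - prob {\<omega>\<in>space M. W (real (Suc m)) \<omega> \<notin> G}))\<^sup>2 / V) ^ k \<le> p (real (2 * m * k + 1))"
proof -
  let ?e = "prob {\<omega>\<in>space M. W (real (Suc m)) \<omega> \<notin> G}"
  let ?F = "\<lambda>x. (2 * pi * (max 0 (x - ?e))\<^sup>2 / V) ^ k"
  have closed: "?F (prob (stays 0 (real (Suc m)) K)) \<le> prob (stays 0 (real (2 * m * k + 1)) K)" if K: "closed K" for K
  proof (rule LIMSEQ_le)
    show "(\<lambda>r. ?F (prob (visits (1 / real (2 ^ r)) K (Suc m * 2 ^ r)))) \<longlonglongrightarrow> ?F (prob (stays 0 (real (Suc m)) K))"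
      using V by (intro tendsto_intros prob_visits_tendsto K) auto
    show "(\<lambda>r. prob (visits (1 / real (2 ^ r)) K ((2 * m * k + 1) * 2 ^ r))) \<longlonglongrightarrow> prob (stays 0 (real (2 * m * k + 1)) K)"
      by (intro prob_visits_tendsto K) auto
    show "\<exists>N. \<forall>r\<ge>N. ?F (prob (visits (1 / real (2 ^ r)) K (Suc m * 2 ^ r))) \<le> prob (visits (1 / real (2 ^ r)) K ((2 * m * k + 1) * 2 ^ r))"
      using K V by (intro exI[of _ 0] allI impI discrete_survival_inequality k G) auto
  qed
  let ?K = "\<lambda>n. core (inverse (real (Suc n))) D"
  have lim: "(\<lambda>n. prob (stays 0 (real T) (?K n))) \<longlonglongrightarrow> p (real T)" for T
    unfolding p_def stays_core[OF D order_refl]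
  proof (rule finite_Lim_measure_incseq)
    show "range (\<lambda>n. stays 0 (real T) (?K n)) \<subseteq> events" using history_sets[OF stays_closed_in_history[OF closed_core order_refl of_nat_0_le_iff]] by auto
    have "?K n \<subseteq> ?K (Suc n)" for n by (intro core_antimono le_imp_inverse_le) auto
    then show "incseq (\<lambda>n. stays 0 (real T) (?K n))" by (intro incseq_SucI) (auto simp: stays_def)
  qed
  show ?thesis
  proof (rule LIMSEQ_le)
    show "(\<lambda>n. ?F (prob (stays 0 (real (Suc m)) (?K n)))) \<longlonglongrightarrow> ?F (p (real (Suc m)))"
      using V by (intro tendsto_intros lim) auto
    show "(\<lambda>n. prob (stays 0 (real (2 * m * k + 1)) (?K n))) \<longlonglongrightarrow> p (real (2 * m * k + 1))" by (rule lim)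
    show "\<exists>N. \<forall>n\<ge>N. ?F (prob (stays 0 (real (Suc m)) (?K n))) \<le> prob (stays 0 (real (2 * m * k + 1)) (?K n))"
      using closed[OF closed_core] by blast
  qed
qed

lemma expectation_cosh2:
  assumes t: "0 < t"
  shows "(\<integral>\<omega>. cosh2 c (W t \<omega>) \<partial>M) = exp (c\<^sup>2 * t)"
proof -
  note [measurable] = measurable_W[of 0, simplified] measurable_W[OF less_imp_le[OF t]]
  have "(\<integral>\<omega>. cosh2 c (W t \<omega>) \<partial>M) = (\<integral>\<omega>. cosh2 c (W t \<omega> - W 0 \<omega>) \<partial>M)"
    by (rule integral_cong_AE) (use AE_start in \<open>auto elim: AE_mp\<close>)
  also have "\<dots> = (\<integral>y. cosh2 c y \<partial>gauss t)"
    using integral_distr[of "\<lambda>\<omega>. W t \<omega> - W 0 \<omega>" M borel "cosh2 c"] distr_increment[of 0 t] t by simp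
  also have "\<dots> = exp (c\<^sup>2 * t)"
    using gauss_cosh2[OF t, of c 0] by (simp add: has_bochner_integral_iff)
  finally show ?thesis .
qed

text \<open>Markov's inequality for \<open>cosh2 (R / 2)\<close>, whose mean is \<open>exp (R\<^sup>2 * t / 4)\<close>, while outside the square it is
  at least \<open>exp (R\<^sup>2 * t / 2) / 2\<close>.\<close>

lemma prob_W_outside_square:
  assumes R: "0 < R" and t: "0 < t"
  shows "prob {\<omega>\<in>space M. W t \<omega> \<notin> {z. \<bar>Re z\<bar> \<le> R * t \<and> \<bar>Im z\<bar> \<le> R * t}} \<le> 2 * exp (- R\<^sup>2 * t / 4)"
proof -
  let ?c = "R / 2"
  note [measurable] = measurable_W[OF less_imp_le[OF t]]
  have big: "exp (?c * (R * t)) / 2 \<le> cosh2 ?c z" if "z \<notin> {z. \<bar>Re z\<bar> \<le> R * t \<and> \<bar>Im z\<bar> \<le> R * t}" for z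
  proof -
    have ge: "exp (?c * (R * t)) / 2 \<le> cosh (?c * x)" if "R * t \<le> \<bar>x\<bar>" for x
    proof -
      have "exp (?c * (R * t)) \<le> exp (?c * \<bar>x\<bar>)" using that R by simp
      also have "\<dots> = exp \<bar>?c * x\<bar>" using R by (simp add: abs_mult)
      also have "\<dots> \<le> 2 * cosh (?c * x)" by (rule exp_abs_le_cosh)
      finally show ?thesis by simp
    qed
    have one: "1 \<le> cosh (?c * x)" for x by (rule cosh_real_ge_1)
    show ?thesis
    proof (cases "R * t \<le> \<bar>Re z\<bar>")
      case True
      have "exp (?c * (R * t)) / 2 * 1 \<le> cosh (?c * Re z) * cosh (?c * Im z)"
        by (rule mult_mono[OF ge[OF True] one]) auto
      then show ?thesis by (simp add: cosh2_def)
    next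
      case False
      then have *: "R * t \<le> \<bar>Im z\<bar>" using that by auto
      have "1 * (exp (?c * (R * t)) / 2) \<le> cosh (?c * Re z) * cosh (?c * Im z)"
        by (rule mult_mono[OF one ge[OF *]]) auto
      then show ?thesis by (simp add: cosh2_def)
    qed
  qed
  have I: "integrable M (\<lambda>\<omega>. cosh2 ?c (W t \<omega>))"
    using t cosh2_ge_1 by (intro integrable_growth[where C = 1 and c = ?c]) (auto intro: abs_of_nonneg order_trans[OF zero_le_one] simp: order_trans[OF zero_le_one])
  have "prob {\<omega>\<in>space M. W t \<omega> \<notin> {z. \<bar>Re z\<bar> \<le> R * t \<and> \<bar>Im z\<bar> \<le> R * t}}
     \<le> prob {\<omega>\<in>space M. exp (?c * (R * t)) / 2 \<le> cosh2 ?c (W t \<omega>)}"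
    by (rule finite_measure_mono) (use big in auto)
  also have "\<dots> \<le> (\<integral>\<omega>. cosh2 ?c (W t \<omega>) \<partial>M) / (exp (?c * (R * t)) / 2)"
    by (rule integral_Markov_inequality_measure[OF I, where A = "{}"]) (auto intro: order_trans[OF zero_le_one cosh2_ge_1])
  also have "\<dots> = 2 * exp (?c\<^sup>2 * t - ?c * (R * t))"
    by (simp add: expectation_cosh2[OF t] exp_diff)
  also have "?c\<^sup>2 * t - ?c * (R * t) = - R\<^sup>2 * t / 4" by (simp add: power2_eq_square field_simps)
  finally show ?thesis .
qed

end

text \<open>Taking logarithms, the last assumption bounds \<open>ln (p (2 * m * k + 1)) / (2 * m * k)\<close> from below by a quantity \<open>a m\<close> that
  differs from \<open>ln (p (m + 1)) / m\<close> by a term of order \<open>ln m / m\<close>. Letting \<open>k\<close> grow, and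
  filling the gaps between these times by monotonicity, the lower limit is at least every \<open>a m\<close>; the upper
  limit is at most their supremum. So the supremum is the limit.\<close>

lemma decay_rate_exists:
  fixes p :: "real \<Rightarrow> real"
  assumes mono: "\<And>s t. 0 \<le> s \<Longrightarrow> s \<le> t \<Longrightarrow> p t \<le> p s" and le1: "\<And>t. p t \<le> 1"
    and pos: "\<And>t. 0 \<le> t \<Longrightarrow> 0 < p t" and c: "0 < c"
    and sup: "\<And>m k. m0 \<le> m \<Longrightarrow> 1 \<le> k \<Longrightarrow> (c * (p (real (Suc m)))\<^sup>2 / (real (Suc m))\<^sup>2) ^ k \<le> p (real (2 * m * k + 1))"
  shows "\<exists>L. ((\<lambda>t. 1 / t * ln (p t)) \<longlongrightarrow> L) at_top"
proof -
  define l where "l t = ln (p t)" for t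
  have l_mono: "l t \<le> l s" if "0 \<le> s" "s \<le> t" for s t
    using mono[OF that] pos[of s] pos[of t] that by (simp add: l_def)
  have l_le: "l t \<le> 0" if "0 \<le> t" for t using le1[of t] pos[OF that] by (simp add: l_def)
  define M where "M = max m0 1"
  define a where "a m = (ln c + 2 * l (real (Suc m)) - 2 * ln (real (Suc m))) / (2 * real m)" for m :: nat
  have key: "real k * (2 * real m) * a m \<le> l (real (2 * m * k + 1))" if m: "M \<le> m" and k: "1 \<le> k" for m k
  proof -
    let ?x = "c * (p (real (Suc m)))\<^sup>2 / (real (Suc m))\<^sup>2"
    have x: "0 < ?x" using c pos[of "real (Suc m)"] by simp
    have lnx: "ln ?x = 2 * real m * a m"
      using c pos[of "real (Suc m)"] m by (simp add: a_def l_def M_def ln_mult ln_div ln_realpow del: of_nat_Suc)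
    have "?x ^ k \<le> p (real (2 * m * k + 1))" using sup[of m k] m k by (simp add: M_def)
    then have "ln (?x ^ k) \<le> l (real (2 * m * k + 1))"
      using x pos[of "real (2 * m * k + 1)"] by (simp add: l_def del: of_nat_Suc of_nat_add)
    also have "ln (?x ^ k) = real k * ln ?x" by (rule ln_realpow)
    finally show ?thesis unfolding lnx by (simp only: mult.assoc)
  qed
  have a_le: "a m \<le> 0" if "M \<le> m" for m
  proof -
    have "(2 * real m) * a m \<le> 0"
      using key[OF that, of 1] l_le[of "real (2 * m * 1 + 1)"] by simp
    moreover have "0 < 2 * real m" using that by (simp add: M_def)
    ultimately show ?thesis by (simp add: mult_le_0_iff)
  qed
  have bdd: "bdd_above (a ` {M..})" using a_le by (intro bdd_aboveI[of _ 0]) auto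
  define L where "L = (SUP m\<in>{M..}. a m)"
  have aL: "a m \<le> L" if "M \<le> m" for m unfolding L_def using that by (intro cSUP_upper bdd) auto
  have L0: "L \<le> 0" unfolding L_def using a_le by (intro cSUP_least) auto
  have "((\<lambda>t. 1 / t * ln (p t)) \<longlongrightarrow> L) at_top"
  proof (rule order_tendstoI)
    fix x assume "x < L"
    then obtain m where m: "M \<le> m" "x < a m"
      unfolding L_def using bdd by (subst (asm) less_cSUP_iff) auto
    let ?f = "\<lambda>t. a m + (a m * (2 * real m - 1)) * inverse t"
    have "(?f \<longlongrightarrow> a m + (a m * (2 * real m - 1)) * 0) at_top"
      by (intro tendsto_intros tendsto_inverse_0_at_top filterlim_ident)
    then have "eventually (\<lambda>t. x < ?f t) at_top" using m by (intro order_tendstoD) auto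
    then show "eventually (\<lambda>t. x < 1 / t * ln (p t)) at_top"
      using eventually_gt_at_top[of 1]
    proof eventually_elim
      case (elim t)
      have m1: "1 \<le> real m" using m(1) by (simp add: M_def)
      define k where "k = nat \<lceil>(t - 1) / (2 * real m)\<rceil>"
      have "0 < (t - 1) / (2 * real m)" using elim m1 by simp
      then have cpos: "0 < \<lceil>(t - 1) / (2 * real m)\<rceil>" by simp
      then have "real k = real_of_int \<lceil>(t - 1) / (2 * real m)\<rceil>" by (simp add: k_def)
      then have k: "(t - 1) / (2 * real m) \<le> real k" "real k \<le> (t - 1) / (2 * real m) + 1" "1 \<le> k"
        using cpos by linarith+
      have k': "t - 1 \<le> real k * (2 * real m)" "real k * (2 * real m) \<le> t - 1 + 2 * real m"
        using k(1,2) m1 by (auto simp: field_simps)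
      have "(t - 1 + 2 * real m) * a m \<le> real k * (2 * real m) * a m"
        using k'(2) a_le[OF m(1)] by (rule mult_right_mono_neg)
      also have "\<dots> \<le> l (real (2 * m * k + 1))" by (rule key[OF m(1) k(3)])
      also have "\<dots> \<le> l t" using k'(1) elim by (intro l_mono) (auto simp: algebra_simps)
      finally have "(t - 1 + 2 * real m) * a m / t \<le> l t / t" using elim by (intro divide_right_mono) auto
      moreover have "(t - 1 + 2 * real m) * a m / t = ?f t" using elim by (simp add: field_simps)
      ultimately show ?case using elim by (simp add: l_def)
    qed
  next
    fix y assume y: "L < y"
    let ?f = "\<lambda>t. L + (\<bar>ln c\<bar> / 2 - 2 * L) * inverse t + ln t / t"
    have "(?f \<longlongrightarrow> L + (\<bar>ln c\<bar> / 2 - 2 * L) * 0 + 0) at_top"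
      by (intro tendsto_intros tendsto_inverse_0_at_top filterlim_ident ln_x_over_x_tendsto_0)
    then have "eventually (\<lambda>t. ?f t < y) at_top" using y by (intro order_tendstoD) auto
    then show "eventually (\<lambda>t. 1 / t * ln (p t) < y) at_top"
      using eventually_ge_at_top[of "real M + 2"]
    proof eventually_elim
      case (elim t)
      define m where "m = nat \<lfloor>t\<rfloor> - 1"
      have mt: "real (Suc m) \<le> t" "t - 2 \<le> real m" "M \<le> m" using elim by (auto simp: m_def) linarith+
      have m1: "1 \<le> m" using mt(3) by (simp add: M_def)
      have "l t \<le> l (real (Suc m))" using mt by (intro l_mono) auto
      also have "\<dots> = real m * a m - ln c / 2 + ln (real (Suc m))"
        using m1 by (simp add: a_def field_simps)
      also have "\<dots> \<le> (t - 2) * L + \<bar>ln c\<bar> / 2 + ln t"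
      proof -
        have "real m * a m \<le> real m * L" using aL[OF mt(3)] by (simp add: mult_left_mono)
        also have "\<dots> \<le> (t - 2) * L" using mt(2) L0 by (rule mult_right_mono_neg)
        finally have 1: "real m * a m \<le> (t - 2) * L" .
        have 2: "ln (real (Suc m)) \<le> ln t" using mt(1) by (subst ln_le_cancel_iff) auto
        show ?thesis using 1 2 by linarith
      qed
      finally have "l t / t \<le> ((t - 2) * L + \<bar>ln c\<bar> / 2 + ln t) / t" using elim by (intro divide_right_mono) auto
      also have "\<dots> = ?f t" using elim by (simp add: field_simps)
      finally show ?case using elim by (simp add: l_def)
    qed
  qed
  then show ?thesis by blast
qed

section \<open>Caloric functions\<close>

lemma cosh2_mono: "\<bar>c\<bar> \<le> c' \<Longrightarrow> cosh2 c z \<le> cosh2 c' z"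
proof -
  assume c: "\<bar>c\<bar> \<le> c'"
  have "cosh (c * x) \<le> cosh (c' * x)" for x :: real
  proof -
    have "cosh (c * x) = cosh \<bar>c * x\<bar>" "cosh (c' * x) = cosh \<bar>c' * x\<bar>" by (auto simp: abs_if)
    moreover have "\<bar>c * x\<bar> \<le> \<bar>c' * x\<bar>" using c by (auto simp: abs_mult intro!: mult_right_mono)
    then have "cosh \<bar>c * x\<bar> \<le> cosh \<bar>c' * x\<bar>" by (subst cosh_real_nonneg_le_iff) auto
    ultimately show ?thesis by (simp only:)
  qed
  then show ?thesis unfolding cosh2_def by (intro mult_mono) auto
qed

lemma caloricI:
  assumes cont: "continuous_on UNIV (\<lambda>p. u (fst p) (snd p))"
    and bound: "\<And>s z. 0 \<le> s \<Longrightarrow> s \<le> t \<Longrightarrow> \<bar>u s z\<bar> \<le> C * cosh2 c z"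
    and mean: "\<And>s d z. 0 \<le> s \<Longrightarrow> 0 < d \<Longrightarrow> s + d \<le> t \<Longrightarrow> (\<integral>y. u (s + d) (z + y) \<partial>gauss d) = u s z"
  shows "caloric t u"
  unfolding caloric_def subcaloric_def
proof (intro conjI)
  have "\<forall>s\<in>{0..t}. \<forall>z. \<bar>u s z\<bar> \<le> C * cosh2 c z" using bound by auto
  then show "\<exists>C c. \<forall>s\<in>{0..t}. \<forall>z. \<bar>u s z\<bar> \<le> C * cosh2 c z"
    "\<exists>C c. \<forall>s\<in>{0..t}. \<forall>z. \<bar>- u s z\<bar> \<le> C * cosh2 c z"
    unfolding abs_minus_cancel by blast+
qed (use cont mean in \<open>auto intro: continuous_on_minus\<close>)

lemma caloricE:
  assumes "caloric t u"
  obtains C c where "continuous_on UNIV (\<lambda>p. u (fst p) (snd p))" "0 \<le> C" "0 \<le> c"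
    "\<And>s z. 0 \<le> s \<Longrightarrow> s \<le> t \<Longrightarrow> \<bar>u s z\<bar> \<le> C * cosh2 c z"
    "\<And>s d z. 0 \<le> s \<Longrightarrow> 0 < d \<Longrightarrow> s + d \<le> t \<Longrightarrow> integrable (gauss d) (\<lambda>y. u (s + d) (z + y))"
    "\<And>s d z. 0 \<le> s \<Longrightarrow> 0 < d \<Longrightarrow> s + d \<le> t \<Longrightarrow> (\<integral>y. u (s + d) (z + y) \<partial>gauss d) = u s z"
proof -
  obtain C c where b: "\<And>s z. s \<in> {0..t} \<Longrightarrow> \<bar>u s z\<bar> \<le> C * cosh2 c z"
    and cont: "continuous_on UNIV (\<lambda>p. u (fst p) (snd p))"
    using assms unfolding caloric_def subcaloric_def by blast
  have b': "\<bar>u s z\<bar> \<le> \<bar>C\<bar> * cosh2 \<bar>c\<bar> z" if "0 \<le> s" "s \<le> t" for s z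
  proof -
    have "\<bar>u s z\<bar> \<le> C * cosh2 c z" using b that by simp
    also have "\<dots> \<le> \<bar>C\<bar> * cosh2 \<bar>c\<bar> z"
      using cosh2_ge_1[of c z] by (intro mult_mono cosh2_mono) auto
    finally show ?thesis .
  qed
  show thesis
  proof (rule that[OF cont _ _ b'])
    fix s d z assume s: "0 \<le> s" "0 < (d::real)" "s + d \<le> t"
    have [measurable]: "u (s + d) \<in> borel_measurable borel"
      using assms unfolding caloric_def subcaloric_def
      by (intro borel_measurable_continuous_onI continuous_on_compose2[OF cont, of UNIV "\<lambda>z. (s + d, z)", simplified] continuous_intros)
    show "integrable (gauss d) (\<lambda>y. u (s + d) (z + y))"
    proof (rule Bochner_Integration.integrable_bound)
      show "integrable (gauss d) (\<lambda>y. \<bar>C\<bar> * cosh2 \<bar>c\<bar> (z + y))"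
        using gauss_cosh2[OF s(2), of "\<bar>c\<bar>" z] by (simp add: has_bochner_integral_iff)
      show "AE y in gauss d. norm (u (s + d) (z + y)) \<le> norm (\<bar>C\<bar> * cosh2 \<bar>c\<bar> (z + y))"
        using b'[of "s + d"] s by (auto intro!: order_trans[OF b' abs_ge_self])
    qed simp
    have "u s z \<le> (\<integral>y. u (s + d) (z + y) \<partial>gauss d)" "- u s z \<le> (\<integral>y. - u (s + d) (z + y) \<partial>gauss d)"
      using assms s unfolding caloric_def subcaloric_def by blast+
    then show "(\<integral>y. u (s + d) (z + y) \<partial>gauss d) = u s z" by simp
  qed auto
qed

lemma caloric_add:
  assumes "caloric t u" "caloric t v"
  shows "caloric t (\<lambda>s z. u s z + v s z)"
  using assms(1)
proof (rule caloricE)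
  fix C c
  assume u: "continuous_on UNIV (\<lambda>p. u (fst p) (snd p))" "0 \<le> C" "0 \<le> c"
    "\<And>s z. 0 \<le> s \<Longrightarrow> s \<le> t \<Longrightarrow> \<bar>u s z\<bar> \<le> C * cosh2 c z"
    "\<And>s d z. 0 \<le> s \<Longrightarrow> 0 < d \<Longrightarrow> s + d \<le> t \<Longrightarrow> integrable (gauss d) (\<lambda>y. u (s + d) (z + y))"
    "\<And>s d z. 0 \<le> s \<Longrightarrow> 0 < d \<Longrightarrow> s + d \<le> t \<Longrightarrow> (\<integral>y. u (s + d) (z + y) \<partial>gauss d) = u s z"
  show ?thesis
    using assms(2)
  proof (rule caloricE)
    fix C' c'
    assume v: "continuous_on UNIV (\<lambda>p. v (fst p) (snd p))" "0 \<le> C'" "0 \<le> c'"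
      "\<And>s z. 0 \<le> s \<Longrightarrow> s \<le> t \<Longrightarrow> \<bar>v s z\<bar> \<le> C' * cosh2 c' z"
      "\<And>s d z. 0 \<le> s \<Longrightarrow> 0 < d \<Longrightarrow> s + d \<le> t \<Longrightarrow> integrable (gauss d) (\<lambda>y. v (s + d) (z + y))"
      "\<And>s d z. 0 \<le> s \<Longrightarrow> 0 < d \<Longrightarrow> s + d \<le> t \<Longrightarrow> (\<integral>y. v (s + d) (z + y) \<partial>gauss d) = v s z"
    show ?thesis
    proof (rule caloricI[where C = "C + C'" and c = "max c c'"])
      fix s z assume s: "0 \<le> s" "s \<le> t"
      have "\<bar>u s z + v s z\<bar> \<le> C * cosh2 c z + C' * cosh2 c' z"
        using u(4)[OF s, of z] v(4)[OF s, of z] by linarith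
      also have "\<dots> \<le> C * cosh2 (max c c') z + C' * cosh2 (max c c') z"
        using u(2,3) v(2,3) by (intro add_mono mult_left_mono cosh2_mono) auto
      finally show "\<bar>u s z + v s z\<bar> \<le> (C + C') * cosh2 (max c c') z" by (simp add: distrib_right)
    next
      show "continuous_on UNIV (\<lambda>p. u (fst p) (snd p) + v (fst p) (snd p))"
        by (rule continuous_on_add[OF u(1) v(1)])
    next
      fix s d z assume s: "0 \<le> s" "0 < (d::real)" "s + d \<le> t"
      show "(\<integral>y. u (s + d) (z + y) + v (s + d) (z + y) \<partial>gauss d) = u s z + v s z"
        using u(5,6)[OF s, of z] v(5,6)[OF s, of z] by (subst Bochner_Integration.integral_add) auto
    qed
  qed
qed

lemma caloric_cmult:
  assumes "caloric t u"
  shows "caloric t (\<lambda>s z. k * u s z)"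
  using assms
proof (rule caloricE)
  fix C c
  assume u: "continuous_on UNIV (\<lambda>p. u (fst p) (snd p))" "0 \<le> C" "0 \<le> c"
    "\<And>s z. 0 \<le> s \<Longrightarrow> s \<le> t \<Longrightarrow> \<bar>u s z\<bar> \<le> C * cosh2 c z"
    "\<And>s d z. 0 \<le> s \<Longrightarrow> 0 < d \<Longrightarrow> s + d \<le> t \<Longrightarrow> integrable (gauss d) (\<lambda>y. u (s + d) (z + y))"
    "\<And>s d z. 0 \<le> s \<Longrightarrow> 0 < d \<Longrightarrow> s + d \<le> t \<Longrightarrow> (\<integral>y. u (s + d) (z + y) \<partial>gauss d) = u s z"
  show ?thesis
  proof (rule caloricI[where C = "\<bar>k\<bar> * C" and c = c])
    fix s z assume "0 \<le> s" "s \<le> t"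
    then show "\<bar>k * u s z\<bar> \<le> (\<bar>k\<bar> * C) * cosh2 c z"
      using u(4)[of s z] by (simp add: abs_mult mult.assoc mult_left_mono)
  next
    show "continuous_on UNIV (\<lambda>p. k * u (fst p) (snd p))"
      by (rule continuous_on_mult_left[OF u(1)])
  next
    fix s d z assume s: "0 \<le> s" "0 < (d::real)" "s + d \<le> t"
    show "(\<integral>y. k * u (s + d) (z + y) \<partial>gauss d) = k * u s z"
      using u(6)[OF s, of z] by simp
  qed
qed

lemma caloric_zero: "caloric t (\<lambda>s z. 0)"
  by (rule caloricI[where C = 0 and c = 0]) auto

lemma caloric_sum:
  "(\<And>i. i \<in> I \<Longrightarrow> caloric t (u i)) \<Longrightarrow> caloric t (\<lambda>s z. \<Sum>i\<in>I. u i s z)"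
  by (induction I rule: infinite_finite_induct) (auto intro!: caloric_zero caloric_add)

lemma caloric_eigen:
  assumes f: "normal_eigen \<kappa> f" "\<And>x. \<bar>f x\<bar> \<le> B * cosh (c * x)"
    and g: "normal_eigen \<kappa>' g" "\<And>x. \<bar>g x\<bar> \<le> B * cosh (c * x)"
  shows "caloric t (\<lambda>s z. exp (- (\<kappa> + \<kappa>') * s) * (f (Re z) * g (Im z)))"
proof (rule caloricI)
  have [continuous_intros]: "continuous_on S h \<Longrightarrow> continuous_on S (\<lambda>x. f (h x))" "continuous_on S h \<Longrightarrow> continuous_on S (\<lambda>x. g (h x))"
    for S :: "(real \<times> complex) set" and h
    using f g by (auto simp: normal_eigen_def intro: continuous_on_compose2[of UNIV])
  show "continuous_on UNIV (\<lambda>p. exp (- (\<kappa> + \<kappa>') * fst p) * (f (Re (snd p)) * g (Im (snd p))))"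
    by (intro continuous_intros)
  have B: "0 \<le> B" using order_trans[OF abs_ge_zero f(2)[of 0]] by simp
  fix s z assume s: "0 \<le> s" "s \<le> t"
  have "\<bar>f (Re z) * g (Im z)\<bar> \<le> (B * cosh (c * Re z)) * (B * cosh (c * Im z))"
    unfolding abs_mult using f g B by (intro mult_mono) auto
  moreover have "exp (- (\<kappa> + \<kappa>') * s) \<le> exp (\<bar>\<kappa> + \<kappa>'\<bar> * t)"
  proof -
    have "- (\<kappa> + \<kappa>') * s \<le> \<bar>\<kappa> + \<kappa>'\<bar> * s" using s by (intro mult_right_mono) auto
    also have "\<dots> \<le> \<bar>\<kappa> + \<kappa>'\<bar> * t" using s by (intro mult_left_mono) auto
    finally show ?thesis by simp
  qed
  ultimately have "\<bar>exp (- (\<kappa> + \<kappa>') * s) * (f (Re z) * g (Im z))\<bar> \<le> exp (\<bar>\<kappa> + \<kappa>'\<bar> * t) * ((B * cosh (c * Re z)) * (B * cosh (c * Im z)))"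
    unfolding abs_mult[of "exp _"] by (intro mult_mono) auto
  then show "\<bar>exp (- (\<kappa> + \<kappa>') * s) * (f (Re z) * g (Im z))\<bar> \<le> (exp (\<bar>\<kappa> + \<kappa>'\<bar> * t) * (B * B)) * cosh2 c z"
    by (simp add: cosh2_def mult_ac)
next
  fix s d z assume s: "0 \<le> s" "0 < d" "s + d \<le> t"
  have "(\<integral>y. exp (- (\<kappa> + \<kappa>') * (s + d)) * (f (Re (z + y)) * g (Im (z + y))) \<partial>gauss d)
    = exp (- (\<kappa> + \<kappa>') * (s + d)) * (exp ((\<kappa> + \<kappa>') * d) * (f (Re z) * g (Im z)))"
    using gauss_eigen[OF s(2) f(1) g(1), of z] by (simp only: has_bochner_integral_iff integral_mult_right_zero)
  also have "\<dots> = exp (- (\<kappa> + \<kappa>') * s) * (f (Re z) * g (Im z))"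
  proof -
    have "- (\<kappa> + \<kappa>') * (s + d) + (\<kappa> + \<kappa>') * d = - (\<kappa> + \<kappa>') * s" by (simp add: algebra_simps)
    then show ?thesis by (simp only: mult.assoc[symmetric] exp_add[symmetric])
  qed
  finally show "(\<integral>y. exp (- (\<kappa> + \<kappa>') * (s + d)) * (f (Re (z + y)) * g (Im (z + y))) \<partial>gauss d)
    = exp (- (\<kappa> + \<kappa>') * s) * (f (Re z) * g (Im z))" .
qed

lemma caloric_cos_cos:
  "caloric t (\<lambda>s z. exp ((a\<^sup>2 + b\<^sup>2) / 2 * s) * (cos (a * Re z + p) * cos (b * Im z + q)))"
proof -
  have "\<bar>cos (a * x + p)\<bar> \<le> 1 * cosh (0 * x)" "\<bar>cos (b * x + q)\<bar> \<le> 1 * cosh (0 * x)" for x by auto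
  from caloric_eigen[OF normal_eigen_cos this(1) normal_eigen_cos this(2), of t]
  moreover have "- (- a\<^sup>2 / 2 + - b\<^sup>2 / 2) = (a\<^sup>2 + b\<^sup>2) / 2" by (simp add: field_simps)
  ultimately show ?thesis by (simp only:)
qed

lemma gauss_Re:
  assumes d: "0 < d"
  shows "has_bochner_integral (gauss d) Re 0" "has_bochner_integral (gauss d) (\<lambda>y. (Re y)\<^sup>2) d"
proof -
  interpret N: prob_space "normal d" using d by (intro prob_space_normal_density) auto
  have one: "integrable (normal d) (\<lambda>x. 1)" by simp
  have prob1: "N.prob UNIV = 1" using N.prob_space by simp
  have 1: "has_bochner_integral (normal d) (\<lambda>x. x) 0"
    using d normal_moment_nz_1[of "sqrt d" 0] by (intro has_bochner_integral_density) auto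
  have 2: "has_bochner_integral (normal d) (\<lambda>x. x\<^sup>2) d"
    using d normal_moment_even[of "sqrt d" 0 1] by (intro has_bochner_integral_density) auto
  show "has_bochner_integral (gauss d) Re 0"
    using gauss_product[OF d _ one, of "\<lambda>x. x"] 1 by (simp add: has_bochner_integral_iff)
  show "has_bochner_integral (gauss d) (\<lambda>y. (Re y)\<^sup>2) d"
    using gauss_product[OF d _ one, of "\<lambda>x. x\<^sup>2"] 2 by (simp add: has_bochner_integral_iff prob1)
qed

context planar_BM
begin

section \<open>Survival in rectangles and the existence of the rate\<close>

lemma survival_eq:
  assumes "open D" "0 \<le> t"
  shows "{\<omega>\<in>space M. exit_time W D \<omega> > ennreal t} = stays 0 t D"
  using exit_after_gt_iff[OF assms(1) order_refl assms(2)] unfolding exit_time_eq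
  by (auto simp: stays_def)

lemma stopped_in_closure:
  assumes D: "open D" and a: "0 \<le> a" "a \<le> t" and \<omega>: "\<omega> \<in> space M" and start: "W a \<omega> \<in> D"
  shows "stopped a D t \<omega> \<in> closure D"
  using D a \<omega>
proof (cases rule: stop_time_cases)
  case stay
  then have "W t \<omega> \<in> D" using a by (auto simp: stays_def)
  then show ?thesis using stay closure_subset by (auto simp: stopped_def)
next
  case (exit t0)
  have "a \<noteq> t0" using start exit(4) by auto
  then have at0: "a < t0" using exit(2) by simp
  then have cl: "closure {a..<t0} = {a..t0}" by simp
  have "(\<lambda>s. W s \<omega>) ` closure {a..<t0} \<subseteq> closure D"
  proof (rule image_closure_subset)
    show "continuous_on (closure {a..<t0}) (\<lambda>s. W s \<omega>)"
      unfolding cl by (rule continuous_on_subset[OF continuous_path[OF \<omega>]]) (use a in auto)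
    show "(\<lambda>s. W s \<omega>) ` {a..<t0} \<subseteq> closure D" using exit(5) closure_subset[of D] by auto
  qed simp
  then show ?thesis using exit at0 unfolding cl by (auto simp: stopped_def)
qed

lemma stopped_outside:
  assumes D: "open D" and a: "0 \<le> a" "a \<le> t" and \<omega>: "\<omega> \<in> space M" and "\<omega> \<notin> stays a t D"
  shows "stopped a D t \<omega> \<notin> D"
  using D a \<omega> by (cases rule: stop_time_cases) (use assms(5) in \<open>auto simp: stopped_def\<close>)

lemma stopped_stay:
  assumes D: "open D" and a: "0 \<le> a" "a \<le> t" and "\<omega> \<in> stays a t D"
  shows "stop_time a D t \<omega> = t" "stopped a D t \<omega> = W t \<omega>"
proof -
  have \<omega>: "\<omega> \<in> space M" using assms(4) by (simp add: stays_def)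
  show "stop_time a D t \<omega> = t"
    using D a \<omega> by (cases rule: stop_time_cases) (use assms(4) in auto)
  then show "stopped a D t \<omega> = W t \<omega>" by (simp add: stopped_def)
qed

text \<open>The path starts at \<open>0\<close> only almost surely. As this is an event of the past, it can be imposed when a statement
  needs the starting point to be exact.\<close>

definition start_set :: "'a set" where "start_set = W 0 -` {0} \<inter> space M"

lemma start_set_history: "start_set \<in> sets (history 0)"
  using measurable_sets[OF measurable_history_W[of 0 0], of "{0}"] by (simp add: start_set_def)

lemma AE_start_set: "AE \<omega> in M. \<omega> \<in> start_set"
  using AE_start AE_space by eventually_elim (simp add: start_set_def)

text \<open>The product of the two cosines is positive in the rectangle and vanishes on its boundary, and multiplied by
  \<open>exp ((a\<^sup>2 + b\<^sup>2) / 2 * s)\<close> it is caloric. When it is stopped at the exit, only the paths that are still inside contribute.\<close>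

lemma rectangle_survival:
  fixes x0 y0 w v t0 t :: real
  defines "Q \<equiv> {z. \<bar>Re z - x0\<bar> < w \<and> \<bar>Im z - y0\<bar> < v}" and "a \<equiv> pi / (2 * w)" and "b \<equiv> pi / (2 * v)"
  assumes w: "0 < w" "0 < v" and t: "0 \<le> t0" "t0 \<le> t"
    and H: "H \<in> sets (history t0)" and HQ: "\<And>\<omega>. \<omega> \<in> H \<Longrightarrow> W t0 \<omega> \<in> Q"
  shows "(\<integral>\<omega>. indicator H \<omega> * (cos (a * (Re (W t0 \<omega>) - x0)) * cos (b * (Im (W t0 \<omega>) - y0))) \<partial>M)
     \<le> exp ((a\<^sup>2 + b\<^sup>2) / 2 * (t - t0)) * prob (H \<inter> stays t0 t Q)"
proof -
  let ?\<kappa> = "(a\<^sup>2 + b\<^sup>2) / 2"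
  define f where "f z = cos (a * (Re z - x0)) * cos (b * (Im z - y0))" for z
  have "open Q" unfolding Q_def by (intro open_Collect_conj open_Collect_less continuous_intros)
  note Q = this
  have cal: "caloric t (\<lambda>s z. exp (?\<kappa> * s) * f z)"
    using caloric_cos_cos[of t a b "- a * x0" "- b * y0"] by (simp add: f_def algebra_simps)
  have ev: "H \<in> events" "stays t0 t Q \<in> events"
    by (rule history_sets[OF H]) (rule stays_events[OF Q t])
  have I: "integrable M (\<lambda>\<omega>. exp (?\<kappa> * stop_time t0 Q t \<omega>) * f (stopped t0 Q t \<omega>))"
    using optional_stopping(1)[OF Q t _ H] cal by (auto simp: caloric_def)
  have eq: "(\<integral>\<omega>. indicator H \<omega> * (exp (?\<kappa> * stop_time t0 Q t \<omega>) * f (stopped t0 Q t \<omega>)) \<partial>M)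
    = (\<integral>\<omega>. indicator H \<omega> * (exp (?\<kappa> * t0) * f (W t0 \<omega>)) \<partial>M)"
    by (rule optional_stopping_eq[OF Q t cal H])
  have ab: "a * w = pi / 2" "b * v = pi / 2" "0 < a" "0 < b" using w by (auto simp: a_def b_def)
  have clQ: "closure Q \<subseteq> {z. \<bar>Re z - x0\<bar> \<le> w \<and> \<bar>Im z - y0\<bar> \<le> v}"
    unfolding Q_def by (intro closure_minimal closed_Collect_conj closed_Collect_le continuous_intros) auto
  have zero: "f z = 0" if "z \<in> closure Q" "z \<notin> Q" for z
  proof -
    have *: "cos (c * x) = 0" if "\<bar>x\<bar> = y" "c * y = pi / 2" for c x y :: real
      using cos_mult_abs[of c x] unfolding that by simp
    have "\<bar>Re z - x0\<bar> = w \<or> \<bar>Im z - y0\<bar> = v" using that clQ by (auto simp: Q_def)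
    then show ?thesis using *[of "Re z - x0" w a] *[of "Im z - y0" v b] ab by (auto simp: f_def)
  qed
  have pw: "indicator H \<omega> * (exp (?\<kappa> * stop_time t0 Q t \<omega>) * f (stopped t0 Q t \<omega>))
     \<le> exp (?\<kappa> * t) * indicator (H \<inter> stays t0 t Q) \<omega>" if \<omega>: "\<omega> \<in> space M" for \<omega>
  proof (cases "\<omega> \<in> H")
    case inH: True
    show ?thesis
    proof (cases "\<omega> \<in> stays t0 t Q")
      case True
      have "f (W t \<omega>) \<le> 1" unfolding f_def
        by (rule order_trans[OF abs_ge_self]) (auto simp: abs_mult intro!: mult_le_one)
      then show ?thesis using True inH by (simp add: stopped_stay[OF Q t True])
    next
      case False
      have "f (stopped t0 Q t \<omega>) = 0"
        by (rule zero[OF stopped_in_closure[OF Q t \<omega> HQ[OF inH]] stopped_outside[OF Q t \<omega> False]])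
      then show ?thesis by simp
    qed
  qed simp
  have "exp (?\<kappa> * t0) * (\<integral>\<omega>. indicator H \<omega> * f (W t0 \<omega>) \<partial>M) = (\<integral>\<omega>. indicator H \<omega> * (exp (?\<kappa> * t0) * f (W t0 \<omega>)) \<partial>M)"
    by (subst Bochner_Integration.integral_mult_right_zero[symmetric]) (simp only: mult.left_commute)
  also have "\<dots> \<le> (\<integral>\<omega>. exp (?\<kappa> * t) * indicator (H \<inter> stays t0 t Q) \<omega> \<partial>M)"
    unfolding eq[symmetric]
  proof (rule integral_mono)
    show "integrable M (\<lambda>\<omega>. exp (?\<kappa> * t) * indicator (H \<inter> stays t0 t Q) \<omega> :: real)"
      using ev by (intro integrable_mult_right integrable_real_indicator) (auto simp: emeasure_eq_measure)
  qed (use pw indicator_mult_integrable[OF I ev(1)] in auto)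
  also have "\<dots> = exp (?\<kappa> * t) * prob (H \<inter> stays t0 t Q)"
    using ev by simp
  finally have "exp (?\<kappa> * t0) * (\<integral>\<omega>. indicator H \<omega> * f (W t0 \<omega>) \<partial>M) \<le> exp (?\<kappa> * t) * prob (H \<inter> stays t0 t Q)" .
  also have "exp (?\<kappa> * t) = exp (?\<kappa> * t0) * exp (?\<kappa> * (t - t0))"
    unfolding exp_add[symmetric] by (simp only: distrib_left[symmetric]) simp
  finally show ?thesis unfolding f_def by (simp only: mult.assoc mult_le_cancel_left_pos[OF exp_gt_zero])
qed

text \<open>A square around \<open>0\<close> fits into \<open>D\<close>.\<close>

lemma survival_lower_bound:
  assumes D: "open D" and 0: "0 \<in> D"
  shows "\<exists>C\<ge>0. \<forall>t\<ge>0. exp (- C * t) \<le> prob (stays 0 t D)"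
proof -
  obtain r where r: "0 < r" "ball 0 r \<subseteq> D" using D 0 by (meson open_contains_ball)
  define w where "w = r / 2"
  have w: "0 < w" using r by (simp add: w_def)
  define a where "a = pi / (2 * w)"
  let ?Q = "{z. \<bar>Re z - 0\<bar> < w \<and> \<bar>Im z - 0\<bar> < w}"
  have QD: "?Q \<subseteq> D"
  proof
    fix z assume "z \<in> ?Q"
    then have "norm z < r" using cmod_le[of z] by (auto simp: w_def)
    then show "z \<in> D" using r(2) by auto
  qed
  have st: "start_set \<in> events" by (rule history_sets[OF start_set_history])
  have "exp (- a\<^sup>2 * t) \<le> prob (stays 0 t D)" if t: "0 \<le> t" for t
  proof -
    have "1 = prob start_set"
      using prob_eq_1[OF st] AE_start_set by simp
    also have "\<dots> = (\<integral>\<omega>. indicator start_set \<omega> \<partial>M)" using st by simp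
    also have "\<dots> = (\<integral>\<omega>. indicator start_set \<omega> * (cos (a * (Re (W 0 \<omega>) - 0)) * cos (a * (Im (W 0 \<omega>) - 0))) \<partial>M)"
      by (intro Bochner_Integration.integral_cong) (auto simp: start_set_def indicator_def)
    also have "\<dots> \<le> exp ((a\<^sup>2 + a\<^sup>2) / 2 * (t - 0)) * prob (start_set \<inter> stays 0 t ?Q)"
      unfolding a_def by (rule rectangle_survival[OF w w order_refl t start_set_history]) (use w in \<open>simp add: start_set_def\<close>)
    also have "\<dots> \<le> exp (a\<^sup>2 * t) * prob (stays 0 t D)"
      using stays_events[OF D order_refl t] QD by (intro mult_mono finite_measure_mono) (auto simp: stays_def)
    finally show ?thesis by (simp add: exp_minus field_simps)
  qed
  then show ?thesis by (intro exI[of _ "a\<^sup>2"]) auto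
qed

theorem survival_rate_exists:
  assumes D: "open D" and 0: "0 \<in> D"
  shows "\<exists>L. ((\<lambda>t. 1 / t * ln (prob (stays 0 t D))) \<longlongrightarrow> L) at_top"
proof -
  define p where "p t = prob (stays 0 t D)" for t
  obtain C where C: "0 \<le> C" "\<And>t. 0 \<le> t \<Longrightarrow> exp (- C * t) \<le> p t"
    using survival_lower_bound[OF assms] unfolding p_def by blast
  \<comment> \<open>With this speed the path leaves the square of side \<open>2 * R * t\<close> with a probability of at most
     \<open>2 * exp (- (C + 1) * t)\<close>, which is small compared with the lower bound \<open>exp (- C * t)\<close> for survival.\<close>
  define R where "R = 2 * (C + 1)"
  have R: "0 < R" "C + 1 \<le> R\<^sup>2 / 4" using C by (auto simp: R_def power2_eq_square algebra_simps)
  obtain m0 :: nat where m0: "ln 4 \<le> real m0" using real_arch_simple by blast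
  define c where "c = 2 * pi / (16 * R\<^sup>2)"
  have "\<exists>L. ((\<lambda>t. 1 / t * ln (p t)) \<longlongrightarrow> L) at_top"
  proof (rule decay_rate_exists[where c = c and ?m0.0 = m0])
    show "p t \<le> p s" if "0 \<le> s" "s \<le> t" for s t
      unfolding p_def using stays_events[OF D order_refl that(1)] that by (intro finite_measure_mono) (auto simp: stays_def)
    show "p t \<le> 1" for t by (simp add: p_def)
    show "0 < p t" if "0 \<le> t" for t using C(2)[OF that] exp_gt_zero[of "- C * t"] by linarith
    show "0 < c" using R by (simp add: c_def)
    fix m k :: nat assume m: "m0 \<le> m" and k: "1 \<le> k"
    let ?T = "real (Suc m)"
    let ?G = "{z. \<bar>Re z\<bar> \<le> R * ?T \<and> \<bar>Im z\<bar> \<le> R * ?T}"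
    let ?e = "prob {\<omega>\<in>space M. W ?T \<omega> \<notin> ?G}"
    define V where "V = (2 * R * ?T)\<^sup>2"
    have V: "0 < V" using R by (simp add: V_def)
    have G: "?G = cbox (Complex (- R * ?T) (- R * ?T)) (Complex (R * ?T) (R * ?T))"
      by (auto simp: cbox_def Basis_complex_def simp del: of_nat_Suc)
    have "emeasure lborel ?G = ennreal (\<Prod>b\<in>Basis. (Complex (R * ?T) (R * ?T) - Complex (- R * ?T) (- R * ?T)) \<bullet> b)"
      unfolding G using R by (intro emeasure_lborel_cbox) (auto simp: Basis_complex_def)
    also have "(\<Prod>b\<in>Basis. (Complex (R * ?T) (R * ?T) - Complex (- R * ?T) (- R * ?T)) \<bullet> b) = V"
      by (simp add: Basis_complex_def V_def power2_eq_square algebra_simps)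
    finally have GV: "emeasure lborel ?G = ennreal V" .
    have Gm: "?G \<in> sets borel" unfolding G by simp
    have "?e \<le> 2 * exp (- R\<^sup>2 * ?T / 4)" by (rule prob_W_outside_square[OF R(1)]) simp
    also have "\<dots> \<le> 2 * exp (- (C + 1) * ?T)"
    proof -
      have "(C + 1) * ?T \<le> R\<^sup>2 / 4 * ?T" by (rule mult_right_mono[OF R(2)]) simp
      then have "- R\<^sup>2 * ?T / 4 \<le> - (C + 1) * ?T" by linarith
      then show ?thesis by (simp only: mult_le_cancel_left_pos[OF zero_less_numeral] exp_le_cancel_iff)
    qed
    also have "\<dots> = 2 * (exp (- ?T) * exp (- C * ?T))"
      unfolding exp_add[symmetric] by (simp add: algebra_simps)
    also have "\<dots> \<le> 2 * (1 / 4 * exp (- C * ?T))"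
    proof -
      have "exp (ln 4) \<le> exp ?T" using m0 m by (simp only: exp_le_cancel_iff)
      then have "1 / exp ?T \<le> 1 / 4" by (intro divide_left_mono) auto
      then have "exp (- ?T) \<le> 1 / 4" by (simp only: exp_minus inverse_eq_divide)
      then show ?thesis by (intro mult_left_mono mult_right_mono) auto
    qed
    also have "\<dots> \<le> p ?T / 2" using C(2)[of ?T] by simp
    finally have "?e \<le> p ?T / 2" .
    then have "p ?T / 2 \<le> p ?T - ?e" by linarith
    then have "p ?T / 2 \<le> max 0 (p ?T - ?e)" by (rule order_trans[OF _ max.cobounded2])
    then have "(p ?T / 2)\<^sup>2 \<le> (max 0 (p ?T - ?e))\<^sup>2" by (intro power_mono) (auto simp: p_def)
    then have "2 * pi * (p ?T / 2)\<^sup>2 / V \<le> 2 * pi * (max 0 (p ?T - ?e))\<^sup>2 / V"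
      using V by (intro divide_right_mono mult_left_mono) auto
    moreover have "c * (p ?T)\<^sup>2 / ?T\<^sup>2 = 2 * pi * (p ?T / 2)\<^sup>2 / V"
      using R by (simp add: c_def V_def power2_eq_square field_simps del: of_nat_Suc)
    ultimately have "(c * (p ?T)\<^sup>2 / ?T\<^sup>2) ^ k \<le> (2 * pi * (max 0 (p ?T - ?e))\<^sup>2 / V) ^ k"
      using V by (intro power_mono) auto
    also have "\<dots> \<le> p (real (2 * m * k + 1))"
      unfolding p_def by (rule survival_inequality[OF D k Gm GV V])
    finally show "(c * (p ?T)\<^sup>2 / ?T\<^sup>2) ^ k \<le> p (real (2 * m * k + 1))" .
  qed
  then show ?thesis by (simp add: p_def)
qed

section \<open>Confinement to a strip\<close>

lemma caloric_Re_square: "caloric t (\<lambda>s z. (Re z)\<^sup>2 - s)"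
proof (rule caloricI[where C = "4 + t" and c = 1])
  fix s :: real and z assume s: "0 \<le> s" "s \<le> t"
  have "(Re z)\<^sup>2 \<le> 4 * cosh (Re z)"
  proof -
    have "1 + \<bar>Re z\<bar> + \<bar>Re z\<bar>\<^sup>2 / 2 \<le> exp \<bar>Re z\<bar>" by (rule exp_lower_Taylor_quadratic) simp
    then have "(Re z)\<^sup>2 / 2 \<le> exp \<bar>Re z\<bar>" by simp
    also have "\<dots> \<le> 2 * cosh (Re z)" by (rule exp_abs_le_cosh)
    finally show ?thesis by simp
  qed
  also have "\<dots> \<le> 4 * cosh2 1 z"
    using cosh_real_ge_1[of "Im z"] by (simp add: cosh2_def)
  finally have "(Re z)\<^sup>2 \<le> 4 * cosh2 1 z" .
  moreover have "s \<le> t * cosh2 1 z"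
    using s mult_mono[OF s(2) cosh2_ge_1[of 1 z]] by simp
  ultimately have "- ((4 + t) * cosh2 1 z) \<le> (Re z)\<^sup>2 - s" "(Re z)\<^sup>2 - s \<le> (4 + t) * cosh2 1 z"
    using s zero_le_power2[of "Re z"] cosh2_ge_1[of 1 z] order_trans[OF s]
      mult_nonneg_nonneg[of t "cosh2 1 z"] unfolding distrib_right by linarith+
  then show "\<bar>(Re z)\<^sup>2 - s\<bar> \<le> (4 + t) * cosh2 1 z" by linarith
next
  fix s d :: real and z assume d: "0 < d"
  note G = gauss_Re[OF d]
  interpret G: prob_space "gauss d" by (rule prob_space_gauss[OF d])
  have "has_bochner_integral (gauss d) (\<lambda>y. (Re z)\<^sup>2 + 2 * Re z * Re y + (Re y)\<^sup>2 - (s + d)) ((Re z)\<^sup>2 + 2 * Re z * 0 + d - (s + d))"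
    using G G.prob_space
    by (intro has_bochner_integral_add has_bochner_integral_diff has_bochner_integral_mult_right)
       (auto simp: has_bochner_integral_iff)
  then show "(\<integral>y. (Re (z + y))\<^sup>2 - (s + d) \<partial>gauss d) = (Re z)\<^sup>2 - s"
    by (simp add: has_bochner_integral_iff power2_sum algebra_simps)
qed (intro continuous_intros)

text \<open>The horizontal distance to the strip \<open>\<bar>Re z\<bar> \<le> 1\<close>. It is a maximum of affine functions, hence its mean along Brownian
  motion does not decrease.\<close>

definition excess :: "complex \<Rightarrow> real" where
  "excess z = max 0 (max (Re z - 1) (- Re z - 1))"

lemma excess_le: "0 \<le> excess z" "excess z \<le> \<bar>Re z\<bar>" "excess z = 0 \<longleftrightarrow> \<bar>Re z\<bar> \<le> 1"
  by (auto simp: excess_def)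

lemma continuous_on_excess [continuous_intros]: "continuous_on S f \<Longrightarrow> continuous_on S (\<lambda>x. excess (f x))"
  unfolding excess_def by (intro continuous_intros)

lemma subcaloric_excess: "subcaloric t (\<lambda>s. excess)"
  unfolding subcaloric_def
proof (intro conjI allI impI)
  show "\<exists>C c. \<forall>s\<in>{0..t}. \<forall>z. \<bar>excess z\<bar> \<le> C * cosh2 c z"
  proof (rule exI[of _ 2], rule exI[of _ 1], intro ballI allI)
    fix z
    have "\<bar>excess z\<bar> \<le> \<bar>Re z\<bar>" using excess_le[of z] by simp
    also have "\<dots> \<le> exp \<bar>Re z\<bar>" using exp_ge_add_one_self[of "\<bar>Re z\<bar>"] by linarith
    also have "\<dots> \<le> 2 * cosh (Re z)" by (rule exp_abs_le_cosh)
    also have "\<dots> \<le> 2 * cosh2 1 z"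
      using cosh_real_ge_1[of "Im z"] by (simp add: cosh2_def)
    finally show "\<bar>excess z\<bar> \<le> 2 * cosh2 1 z" .
  qed
  fix s d :: real and z assume d: "0 < d"
  interpret G: prob_space "gauss d" by (rule prob_space_gauss[OF d])
  have R: "integrable (gauss d) Re" "(\<integral>y. Re y \<partial>gauss d) = 0"
    using gauss_Re(1)[OF d] by (auto simp: has_bochner_integral_iff)
  have I: "integrable (gauss d) (\<lambda>y. excess (z + y))"
    unfolding excess_def using R by (intro integrable_max) auto
  have "(\<integral>y. 0 \<partial>gauss d) \<le> (\<integral>y. excess (z + y) \<partial>gauss d)"
    by (intro integral_mono I) (auto simp: excess_def)
  moreover have "(\<integral>y. Re z + Re y - 1 \<partial>gauss d) \<le> (\<integral>y. excess (z + y) \<partial>gauss d)"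
    using R by (intro integral_mono I) (auto simp: excess_def)
  moreover have "(\<integral>y. - Re z - Re y - 1 \<partial>gauss d) \<le> (\<integral>y. excess (z + y) \<partial>gauss d)"
    using R by (intro integral_mono I) (auto simp: excess_def)
  ultimately show "excess z \<le> (\<integral>y. excess (z + y) \<partial>gauss d)"
    using R G.prob_space by (simp add: excess_def)
qed (intro continuous_intros)

lemma stop_time_nonneg: "0 \<le> stop_time a D t \<omega>"
  by (simp add: stop_time_def)

lemma integrable_stop_time:
  assumes "open D" "0 \<le> t"
  shows "integrable M (stop_time 0 D t)"
  by (rule integrable_const_bound[of _ t])
     (use stop_time_bounds[OF assms(1) order_refl assms(2)] measurable_stop_time[OF assms(1) order_refl] in auto)

lemma stopped_second_moment:
  assumes D: "open D" and t: "0 \<le> t"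
  shows "integrable M (\<lambda>\<omega>. (Re (stopped 0 D t \<omega>))\<^sup>2)"
    and "(\<integral>\<omega>. (Re (stopped 0 D t \<omega>))\<^sup>2 \<partial>M) = (\<integral>\<omega>. stop_time 0 D t \<omega> \<partial>M)"
proof -
  have "integrable M (\<lambda>\<omega>. (Re (stopped 0 D t \<omega>))\<^sup>2 - stop_time 0 D t \<omega>)"
    using optional_stopping(1)[OF D order_refl t _ space_in_history] caloric_Re_square[of t] by (auto simp: caloric_def)
  from Bochner_Integration.integrable_add[OF this integrable_stop_time[OF D t]]
  show I: "integrable M (\<lambda>\<omega>. (Re (stopped 0 D t \<omega>))\<^sup>2)" by simp
  have "(\<integral>\<omega>. (Re (stopped 0 D t \<omega>))\<^sup>2 - stop_time 0 D t \<omega> \<partial>M) = 0"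
    using optional_stopping_start[OF D t caloric_Re_square] by simp
  then show "(\<integral>\<omega>. (Re (stopped 0 D t \<omega>))\<^sup>2 \<partial>M) = (\<integral>\<omega>. stop_time 0 D t \<omega> \<partial>M)"
    using I integrable_stop_time[OF D t] by simp
qed

text \<open>Once \<open>n\<close> is larger than the exit time the two sides agree.\<close>

lemma stopped_tendsto_exit_position:
  assumes D: "open D" and fin: "exit_time W D \<omega> < \<infinity>" and \<omega>: "\<omega> \<in> space M"
  shows "eventually (\<lambda>n. stopped 0 D (real n) \<omega> = exit_position W D \<omega>) sequentially"
  using D order_refl \<omega>
proof (cases rule: exit_after_cases)
  case never then show ?thesis using fin by (simp add: exit_time_eq)
next
  case (exit t0)
  have "eventually (\<lambda>n. t0 \<le> real n) sequentially" using eventually_ge_at_top filterlim_real_sequentially by (rule eventually_compose_filterlim)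
  then show ?thesis
    by eventually_elim (use exit in \<open>simp add: stopped_def stop_time_def exit_position_def exit_time_eq min_def ennreal_le_iff\<close>)
qed

text \<open>At time \<open>t\<close> the mean of \<open>excess\<close> over the paths that are still inside \<open>D\<close> is at most the mean over the same paths at
  any later time, stopped at the exit. The second moment of the stopped real part is the mean of the stopped time, which
  integrability of the exit time bounds. Therefore the later means converge to the mean of \<open>excess\<close> at the exit, which is \<open>0\<close>.\<close>

lemma confined_to_strip:
  assumes D: "open D" and fin: "(\<integral>\<^sup>+\<omega>. exit_time W D \<omega> \<partial>M) < \<infinity>"
    and exit: "AE \<omega> in M. \<bar>Re (exit_position W D \<omega>)\<bar> \<le> 1" and t: "0 \<le> t"
  shows "AE \<omega> in M. \<omega> \<in> stays 0 t D \<longrightarrow> \<bar>Re (W t \<omega>)\<bar> \<le> 1"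
proof -
  have [measurable]: "stopped 0 D s \<in> borel_measurable M" for s by (rule measurable_stopped[OF D order_refl])
  have [measurable]: "excess \<in> borel_measurable borel"
    by (rule borel_measurable_continuous_onI) (intro continuous_intros)
  define H where "H = stays 0 t D"
  have H: "H \<in> sets (history t)" unfolding H_def by (rule stays_in_history[OF D order_refl t])
  have [measurable]: "H \<in> events" by (rule history_sets[OF H])
  define B where "B = enn2real (\<integral>\<^sup>+\<omega>. exit_time W D \<omega> \<partial>M)"
  have stop_B: "(\<integral>\<omega>. stop_time 0 D s \<omega> \<partial>M) \<le> B" if s: "0 \<le> s" for s
  proof -
    have "ennreal (\<integral>\<omega>. stop_time 0 D s \<omega> \<partial>M) = (\<integral>\<^sup>+\<omega>. ennreal (stop_time 0 D s \<omega>) \<partial>M)"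
      by (rule nn_integral_eq_integral[symmetric, OF integrable_stop_time[OF D s]]) (simp add: stop_time_nonneg)
    also have "\<dots> \<le> (\<integral>\<^sup>+\<omega>. exit_time W D \<omega> \<partial>M)"
    proof (rule nn_integral_mono)
      fix \<omega>
      have "min (exit_after 0 D \<omega>) (ennreal s) < \<infinity>" by (simp add: min_less_iff_disj)
      then have "ennreal (stop_time 0 D s \<omega>) = min (exit_after 0 D \<omega>) (ennreal s)"
        by (simp add: stop_time_def)
      then show "ennreal (stop_time 0 D s \<omega>) \<le> exit_time W D \<omega>" by (simp add: exit_time_eq)
    qed
    also have "\<dots> = ennreal B" using fin by (simp add: B_def)
    finally show ?thesis by (simp add: ennreal_le_iff B_def)
  qed
  let ?X = "\<lambda>n \<omega>. indicator H \<omega> * excess (stopped 0 D (real n) \<omega>)"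
  have X2: "(?X n \<omega>)\<^sup>2 \<le> (Re (stopped 0 D (real n) \<omega>))\<^sup>2" for n \<omega>
    using power_mono[OF excess_le(2,1), of "stopped 0 D (real n) \<omega>" 2] by (auto simp: indicator_def)
  have X2i: "integrable M (\<lambda>\<omega>. (?X n \<omega>)\<^sup>2)" for n
    by (rule Bochner_Integration.integrable_bound[OF stopped_second_moment(1)[OF D, of "real n"]]) (use X2 in auto)
  have lim: "(\<lambda>n. \<integral>\<omega>. ?X n \<omega> \<partial>M) \<longlonglongrightarrow> (\<integral>\<omega>. 0 \<partial>M)"
  proof (rule L2_bounded_convergence(2)[where B = B])
    show "AE \<omega> in M. (\<lambda>n. ?X n \<omega>) \<longlonglongrightarrow> 0"
      using AE_exit_time_finite[OF D fin] exit AE_space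
    proof eventually_elim
      case (elim \<omega>)
      have "eventually (\<lambda>n. ?X n \<omega> = 0) sequentially"
      proof (rule eventually_mono)
        show "eventually (\<lambda>n. stopped 0 D (real n) \<omega> = exit_position W D \<omega>) sequentially"
          using elim(1) by (intro stopped_tendsto_exit_position[OF D _ elim(3)]) (simp add: less_top)
        have "excess (exit_position W D \<omega>) = 0" using elim(2) by (simp add: excess_le(3))
        then show "?X n \<omega> = 0" if "stopped 0 D (real n) \<omega> = exit_position W D \<omega>" for n
          using that by simp
      qed
      then show ?case by (rule tendsto_eventually)
    qed
    show "(\<integral>\<omega>. (?X n \<omega>)\<^sup>2 \<partial>M) \<le> B" for n
    proof -
      have "(\<integral>\<omega>. (?X n \<omega>)\<^sup>2 \<partial>M) \<le> (\<integral>\<omega>. (Re (stopped 0 D (real n) \<omega>))\<^sup>2 \<partial>M)"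
        by (intro integral_mono X2i X2 stopped_second_moment(1)[OF D]) simp
      then show ?thesis using stop_B[of "real n"] stopped_second_moment(2)[OF D, of "real n"] by simp
    qed
  qed (use X2i in auto)
  have le: "(\<integral>\<omega>. indicator H \<omega> * excess (W t \<omega>) \<partial>M) \<le> (\<integral>\<omega>. ?X n \<omega> \<partial>M)" if n: "t \<le> real n" for n
  proof -
    have "(\<integral>\<omega>. indicator H \<omega> * excess (W t \<omega>) \<partial>M) \<le> (\<integral>\<omega>. indicator H \<omega> * excess (stopped t D (real n) \<omega>) \<partial>M)"
      by (rule optional_stopping(2)[OF D t n subcaloric_excess H])
    also have "\<dots> = (\<integral>\<omega>. ?X n \<omega> \<partial>M)"
    proof (intro Bochner_Integration.integral_cong refl)
      fix \<omega> assume \<omega>: "\<omega> \<in> space M"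
      show "indicator H \<omega> * excess (stopped t D (real n) \<omega>) = ?X n \<omega>"
      proof (cases "\<omega> \<in> H")
        case True
        have "{s. 0 \<le> s \<and> W s \<omega> \<notin> D} = {s. t \<le> s \<and> W s \<omega> \<notin> D}"
          using True t unfolding H_def stays_def by force
        then have "exit_after t D \<omega> = exit_after 0 D \<omega>" by (simp add: exit_after_def)
        then show ?thesis by (simp add: stopped_def stop_time_def)
      qed simp
    qed
    finally show ?thesis .
  qed
  obtain n0 :: nat where "t \<le> real n0" using real_arch_simple by blast
  then have "(\<integral>\<omega>. indicator H \<omega> * excess (W t \<omega>) \<partial>M) \<le> (\<integral>\<omega>. 0 \<partial>M)"
    using le by (intro LIMSEQ_le_const[OF lim] exI[of _ n0]) (auto intro: order_trans)
  moreover have I: "integrable M (\<lambda>\<omega>. indicator H \<omega> * excess (W t \<omega>))"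
    using subcaloric_integrable[OF subcaloric_excess, of t t] t by (intro indicator_mult_integrable) auto
  moreover have "0 \<le> (\<integral>\<omega>. indicator H \<omega> * excess (W t \<omega>) \<partial>M)"
    by (intro Bochner_Integration.integral_nonneg) (auto simp: excess_le)
  ultimately have "(\<integral>\<omega>. indicator H \<omega> * excess (W t \<omega>) \<partial>M) = 0" by simp
  then have "AE \<omega> in M. indicator H \<omega> * excess (W t \<omega>) = 0"
    using integral_nonneg_eq_0_iff_AE[OF I] by (auto simp: excess_le)
  then show ?thesis
    by eventually_elim (auto simp: H_def excess_le(3))
qed

text \<open>\<open>exp (c\<^sup>2 / 2 * s) * cos (c * Re z)\<close> is caloric, and since \<open>c < pi / 2\<close> the cosine is at least \<open>cos c > 0\<close> on the
  closed strip, where the stopped path remains.\<close>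

lemma strip_survival_le:
  assumes D: "open D" and exit: "AE \<omega> in M. \<bar>Re (exit_position W D \<omega>)\<bar> \<le> 1"
    and stay: "AE \<omega> in M. \<omega> \<in> stays 0 t D \<longrightarrow> \<bar>Re (W t \<omega>)\<bar> \<le> 1" and t: "0 \<le> t" and c: "0 < c" "c < pi / 2"
  shows "prob (stays 0 t D) \<le> exp (- c\<^sup>2 / 2 * t) / cos c"
proof -
  define u where "u s z = exp (c\<^sup>2 / 2 * s) * cos (c * Re z)" for s :: real and z
  have cal: "caloric t u"
    using caloric_cos_cos[of t c 0 0 0] by (simp add: u_def[abs_def])
  have cc: "0 < cos c" using c by (intro cos_gt_zero_pi) auto
  have cosge: "cos c \<le> cos (c * x)" if "\<bar>x\<bar> \<le> 1" for x
  proof -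
    have "cos c \<le> cos (c * \<bar>x\<bar>)" using that c by (intro cos_monotone_0_pi_le) (auto intro: mult_left_le)
    then show ?thesis by (simp only: cos_mult_abs)
  qed
  have ev: "stays 0 t D \<in> events" by (rule stays_events[OF D order_refl t])
  have "exp (c\<^sup>2 / 2 * t) * cos c * prob (stays 0 t D) = (\<integral>\<omega>. exp (c\<^sup>2 / 2 * t) * cos c * indicator (stays 0 t D) \<omega> \<partial>M)"
    using ev by simp
  also have "\<dots> \<le> (\<integral>\<omega>. u (stop_time 0 D t \<omega>) (stopped 0 D t \<omega>) \<partial>M)"
  proof (rule integral_mono_AE)
    show "integrable M (\<lambda>\<omega>. exp (c\<^sup>2 / 2 * t) * cos c * indicator (stays 0 t D) \<omega> :: real)"
      using ev by (intro integrable_mult_right integrable_real_indicator) (auto simp: emeasure_eq_measure)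
    show "integrable M (\<lambda>\<omega>. u (stop_time 0 D t \<omega>) (stopped 0 D t \<omega>))"
      using optional_stopping(1)[OF D order_refl t _ space_in_history] cal by (auto simp: caloric_def)
    show "AE \<omega> in M. exp (c\<^sup>2 / 2 * t) * cos c * indicator (stays 0 t D) \<omega> \<le> u (stop_time 0 D t \<omega>) (stopped 0 D t \<omega>)"
      using exit stay AE_space
    proof eventually_elim
      case (elim \<omega>)
      show ?case
        using D order_refl t elim(3)
      proof (cases rule: stop_time_cases)
        case stay
        then show ?thesis using elim(2) cosge[of "Re (W t \<omega>)"] by (simp add: u_def stopped_def)
      next
        case (exit t0)
        have "exit_position W D \<omega> = stopped 0 D t \<omega>"
          using exit by (simp add: exit_position_def exit_time_eq stopped_def)
        then have "cos c \<le> cos (c * Re (stopped 0 D t \<omega>))" using elim(1) cosge by simp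
        then show ?thesis using exit(7) cc by (simp add: u_def)
      qed
    qed
  qed
  also have "\<dots> = 1"
    by (subst optional_stopping_start[OF D t cal]) (simp add: u_def)
  finally have "exp (c\<^sup>2 / 2 * t) * cos c * prob (stays 0 t D) \<le> 1" .
  then have "prob (stays 0 t D) \<le> 1 / (exp (c\<^sup>2 / 2 * t) * cos c)"
    using cc by (simp add: pos_le_divide_eq mult.commute)
  also have "\<dots> = exp (- c\<^sup>2 / 2 * t) / cos c" by (simp add: exp_minus field_simps)
  finally show ?thesis .
qed

end

section \<open>The uniform distribution and its Fourier coefficients\<close>

text \<open>The image on the unit circle under \<open>\<lambda>x. cis (pi * x)\<close> has the Fourier coefficients of the uniform distribution.
  The points \<open>-1\<close> and \<open>1\<close> have the same image; they must be null sets for the law to be determined.\<close>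

definition trig_uniform :: "real measure \<Rightarrow> bool" where
  "trig_uniform P \<longleftrightarrow> real_distribution P \<and> (AE x in P. \<bar>x\<bar> < 1) \<and>
     (\<forall>n\<ge>1. (\<integral>x. cos (real n * pi * x) \<partial>P) = 0 \<and> (\<integral>x. sin (real n * pi * x) \<partial>P) = 0)"

lemma trig_uniform_cos:
  fixes j :: int
  assumes "trig_uniform P"
  shows "(\<integral>x. cos (of_int j * (pi * (x - m))) \<partial>P) = (if j = 0 then 1 else 0)"
proof -
  interpret P: real_distribution P using assms by (simp add: trig_uniform_def)
  show ?thesis
  proof (cases "j = 0")
    case True then show ?thesis using P.prob_space by simp
  next
    case False
    define n where "n = nat \<bar>j\<bar>"
    have n: "1 \<le> n" "real n = \<bar>of_int j\<bar>" using False by (auto simp: n_def)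
    have eq: "cos (of_int j * (pi * (x - m))) = cos (real n * pi * m) * cos (real n * pi * x) + sin (real n * pi * m) * sin (real n * pi * x)" for x
    proof -
      have "cos (of_int j * (pi * (x - m))) = cos (\<bar>of_int j\<bar> * (pi * (x - m)))" by (auto simp: abs_if)
      also have "\<bar>of_int j\<bar> * (pi * (x - m)) = real n * pi * x - real n * pi * m" by (simp add: n(2) algebra_simps)
      finally show ?thesis by (simp add: cos_diff mult.commute)
    qed
    have "integrable P (\<lambda>x. cos (real n * pi * x))" "integrable P (\<lambda>x. sin (real n * pi * x))"
      by (auto intro!: P.integrable_const_bound[of _ 1])
    then have "(\<integral>x. cos (of_int j * (pi * (x - m))) \<partial>P) = cos (real n * pi * m) * (\<integral>x. cos (real n * pi * x) \<partial>P) + sin (real n * pi * m) * (\<integral>x. sin (real n * pi * x) \<partial>P)"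
      unfolding eq by simp
    then show ?thesis using assms n(1) False by (simp add: trig_uniform_def)
  qed
qed

lemma trig_uniform_moments:
  fixes j :: int
  assumes P: "trig_uniform P" and Q: "trig_uniform Q"
  shows "(\<integral>x. cos (pi * (x - m)) ^ k * cos (of_int j * (pi * (x - m))) \<partial>P)
    = (\<integral>x. cos (pi * (x - m)) ^ k * cos (of_int j * (pi * (x - m))) \<partial>Q)"
proof (induction k arbitrary: j)
  case 0
  show ?case using trig_uniform_cos[OF P, of j m] trig_uniform_cos[OF Q, of j m] by simp
next
  case (Suc k)
  have eq: "cos (pi * (x - m)) ^ Suc k * cos (of_int j * (pi * (x - m))) =
     (cos (pi * (x - m)) ^ k * cos (of_int (j + 1) * (pi * (x - m))) + cos (pi * (x - m)) ^ k * cos (of_int (j - 1) * (pi * (x - m)))) / 2" for x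
  proof -
    have "cos (of_int (j + 1) * (pi * (x - m))) + cos (of_int (j - 1) * (pi * (x - m))) = 2 * cos (pi * (x - m)) * cos (of_int j * (pi * (x - m)))"
    proof -
      have "of_int (j + 1) * (pi * (x - m)) = of_int j * (pi * (x - m)) + pi * (x - m)"
        "of_int (j - 1) * (pi * (x - m)) = of_int j * (pi * (x - m)) - pi * (x - m)"
        by (auto simp: algebra_simps)
      then show ?thesis by (simp only: cos_add cos_diff) (simp add: algebra_simps)
    qed
    then show ?thesis by (simp add: distrib_left[symmetric])
  qed
  have I: "integrable P (\<lambda>x. cos (pi * (x - m)) ^ k * cos (of_int i * (pi * (x - m))))" if "trig_uniform P" for i :: int and P
  proof -
    interpret P: real_distribution P using that by (simp add: trig_uniform_def)
    show ?thesis
      by (rule P.integrable_const_bound[of _ 1]) (auto simp: abs_mult power_abs intro!: mult_le_one power_le_one)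
  qed
  show ?case
    unfolding eq Bochner_Integration.integral_divide_zero
      Bochner_Integration.integral_add[OF I[OF P] I[OF P]] Bochner_Integration.integral_add[OF I[OF Q] I[OF Q]]
    by (simp only: Suc.IH)
qed

text \<open>The moments of \<open>cos (pi * (x - m))\<close> are combinations of trigonometric moments, and the characteristic function of a bounded
  random variable is the sum of its moment series.\<close>

lemma trig_uniform_distr_cos:
  assumes P: "trig_uniform P" and Q: "trig_uniform Q"
  shows "distr P borel (\<lambda>x. cos (pi * (x - m))) = distr Q borel (\<lambda>x. cos (pi * (x - m)))"
proof (rule Levy_uniqueness)
  let ?T = "\<lambda>x. cos (pi * (x - m))"
  have rd: "real_distribution (distr P borel ?T)" if "trig_uniform P" for P
  proof -
    interpret P: real_distribution P using that by (simp add: trig_uniform_def)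
    show ?thesis by (intro P.real_distribution_distr) auto
  qed
  show "real_distribution (distr P borel ?T)" "real_distribution (distr Q borel ?T)" using rd P Q by auto
  have char_eq: "char (distr P borel ?T) t = (\<Sum>k. (\<i> * t) ^ k /\<^sub>R fact k * of_real (\<integral>x. ?T x ^ k \<partial>P))" if "trig_uniform P" for P t
  proof -
    interpret P: real_distribution P using that by (simp add: trig_uniform_def)
    have "char (distr P borel ?T) t = (CLINT x|P. exp (\<i> * of_real (t * ?T x)))"
      unfolding char_def by (subst integral_distr) auto
    also have "\<dots> = (CLINT x|P. (\<Sum>k. (\<i> * t) ^ k /\<^sub>R fact k * of_real (?T x ^ k)))"
    proof (rule Bochner_Integration.integral_cong[OF refl])
      fix x
      show "exp (\<i> * of_real (t * ?T x)) = (\<Sum>k. (\<i> * t) ^ k /\<^sub>R fact k * of_real (?T x ^ k))"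
        unfolding exp_def by (simp add: power_mult_distrib mult_ac)
    qed
    also have "\<dots> = (\<Sum>k. CLINT x|P. (\<i> * t) ^ k /\<^sub>R fact k * of_real (?T x ^ k))"
    proof (rule integral_suminf)
      have bound: "norm ((\<i> * t) ^ k /\<^sub>R fact k * of_real (?T x ^ k)) \<le> \<bar>t\<bar> ^ k /\<^sub>R fact k" for k x
      proof -
        have "\<bar>?T x\<bar> ^ k \<le> 1" by (intro power_le_one) auto
        then have "\<bar>t\<bar> ^ k / fact k * \<bar>?T x\<bar> ^ k \<le> \<bar>t\<bar> ^ k / fact k * 1" by (intro mult_left_mono) auto
        then show ?thesis by (simp add: norm_mult norm_power power_abs divide_inverse mult_ac)
      qed
      have sm: "summable (\<lambda>k. \<bar>t\<bar> ^ k /\<^sub>R fact k)" by (rule summable_exp_generic)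
      show I: "integrable P (\<lambda>x. (\<i> * t) ^ k /\<^sub>R fact k * of_real (?T x ^ k))" for k
        by (rule P.integrable_const_bound[of _ "\<bar>t\<bar> ^ k /\<^sub>R fact k"]) (use bound in auto)
      show "AE x in P. summable (\<lambda>k. norm ((\<i> * t) ^ k /\<^sub>R fact k * of_real (?T x ^ k)))"
        by (intro AE_I2 summable_comparison_test'[OF sm]) (use bound in auto)
      show "summable (\<lambda>k. \<integral>x. norm ((\<i> * t) ^ k /\<^sub>R fact k * of_real (?T x ^ k)) \<partial>P)"
      proof (rule summable_comparison_test'[OF sm])
        fix k :: nat
        have "(\<integral>x. norm ((\<i> * t) ^ k /\<^sub>R fact k * of_real (?T x ^ k)) \<partial>P) \<le> (\<integral>x. \<bar>t\<bar> ^ k /\<^sub>R fact k \<partial>P)"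
          by (intro integral_mono bound integrable_norm I) simp
        then show "norm (\<integral>x. norm ((\<i> * t) ^ k /\<^sub>R fact k * of_real (?T x ^ k)) \<partial>P) \<le> \<bar>t\<bar> ^ k /\<^sub>R fact k"
          using P.prob_space by simp
      qed
    qed
    also have "\<dots> = (\<Sum>k. (\<i> * t) ^ k /\<^sub>R fact k * of_real (\<integral>x. ?T x ^ k \<partial>P))"
      by (simp add: integral_complex_of_real[symmetric] del: of_real_power integral_complex_of_real)
    finally show ?thesis .
  qed
  show "char (distr P borel ?T) = char (distr Q borel ?T)"
    using trig_uniform_moments[OF P Q, of m _ 0] by (intro ext) (simp add: char_eq P Q)
qed

text \<open>An arc of the circle is a superlevel set of the cosine of the angle measured from the midpoint of the arc. The interval
  \<open>(-1, x]\<close> corresponds to the arc with midpoint \<open>(x - 1) / 2\<close> and half-width \<open>(x + 1) / 2\<close>, up to a factor \<open>pi\<close>.\<close>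

lemma trig_uniform_unique:
  assumes P: "trig_uniform P" and Q: "trig_uniform Q"
  shows "P = Q"
proof -
  have PQ: "real_distribution P" "real_distribution Q" using P Q by (auto simp: trig_uniform_def)
  have cdf: "cdf P x = measure (distr P borel (\<lambda>y. cos (pi * (y - (x - 1) / 2)))) {cos (pi * ((x + 1) / 2))..}"
    if x: "-1 < x" "x < 1" and P': "trig_uniform P" for x P
  proof -
    interpret P: real_distribution P using P' by (simp add: trig_uniform_def)
    define m where "m = (x - 1) / 2"
    define r where "r = (x + 1) / 2"
    have r: "0 < r" "r < 1" using x by (auto simp: r_def)
    have iff: "y \<le> x \<longleftrightarrow> cos (pi * r) \<le> cos (pi * (y - m))" if "\<bar>y\<bar> < 1" for y
    proof -
      define s where "s = y - m"
      have s: "- r < s" "s < 2 - r" "y \<le> x \<longleftrightarrow> s \<le> r" using that by (auto simp: s_def m_def r_def field_simps)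
      show ?thesis
      proof (cases "s \<le> r")
        case True
        have "cos (pi * r) \<le> cos (pi * \<bar>s\<bar>)"
          using True s r by (intro cos_monotone_0_pi_le mult_left_mono mult_left_le) auto
        then show ?thesis using True s by (simp add: s_def cos_mult_abs)
      next
        case False
        have "cos (pi * s) < cos (pi * r)"
        proof (cases "s \<le> 1")
          case True
          then show ?thesis using False r by (intro cos_monotone_0_pi) auto
        next
          case s1: False
          have "pi * s = 2 * pi - pi * (2 - s)" by (simp add: algebra_simps)
          then have "cos (pi * s) = cos (pi * (2 - s))" by (simp only: cos_2pi_minus)
          also have "\<dots> < cos (pi * r)" using s1 s r by (intro cos_monotone_0_pi) auto
          finally show ?thesis .
        qed
        then show ?thesis using False s by (simp add: s_def)
      qed
    qed
    have "cdf P x = P.prob {y. cos (pi * r) \<le> cos (pi * (y - m))}"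
      unfolding cdf_def
    proof (rule P.finite_measure_eq_AE)
      have "AE y in P. \<bar>y\<bar> < 1" using P' by (simp add: trig_uniform_def)
      then show "AE y in P. y \<in> {..x} \<longleftrightarrow> y \<in> {y. cos (pi * r) \<le> cos (pi * (y - m))}"
        by eventually_elim (simp add: iff)
    qed auto
    then show ?thesis by (simp add: measure_distr vimage_def m_def r_def)
  qed
  have lo: "cdf P x = 0" if "x \<le> -1" "trig_uniform P" for x P
  proof -
    interpret P: real_distribution P using that by (simp add: trig_uniform_def)
    have "P.prob {..x} = P.prob {}"
    proof (rule P.finite_measure_eq_AE)
      have "AE y in P. \<bar>y\<bar> < 1" using that by (simp add: trig_uniform_def)
      then show "AE y in P. y \<in> {..x} \<longleftrightarrow> y \<in> {}" by eventually_elim (use that in auto)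
    qed auto
    then show ?thesis by (simp add: cdf_def)
  qed
  have hi: "cdf P x = 1" if "1 \<le> x" "trig_uniform P" for x P
  proof -
    interpret P: real_distribution P using that by (simp add: trig_uniform_def)
    have "P.prob {..x} = P.prob (space P)"
    proof (rule P.finite_measure_eq_AE)
      have "AE y in P. \<bar>y\<bar> < 1" using that by (simp add: trig_uniform_def)
      then show "AE y in P. y \<in> {..x} \<longleftrightarrow> y \<in> space P" by eventually_elim (use that in auto)
    qed auto
    then show ?thesis using P.prob_space by (simp add: cdf_def)
  qed
  show ?thesis
  proof (rule cdf_unique[OF PQ], rule ext)
    fix x :: real
    consider "x \<le> -1" | "-1 < x" "x < 1" | "1 \<le> x" by linarith
    then show "cdf P x = cdf Q x"
      by cases (use cdf[OF _ _ P] cdf[OF _ _ Q] trig_uniform_distr_cos[OF P Q] lo[OF _ P] lo[OF _ Q] hi[OF _ P] hi[OF _ Q] in auto)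
  qed
qed

abbreviation U11 :: "real measure" where
  "U11 \<equiv> uniform_measure lborel {-1..1}"

lemma prob_space_U11: "prob_space U11"
  by (rule prob_space_uniform_measure) auto

lemma U11_integral:
  assumes F: "\<And>x. DERIV F x :> f x" and f: "continuous_on UNIV f"
  shows "has_bochner_integral U11 f ((F 1 - F (-1)) / 2)"
proof -
  have [measurable]: "f \<in> borel_measurable borel" using f by (rule borel_measurable_continuous_onI)
  have d: "U11 = density lborel (\<lambda>x. ennreal (indicator {-1..1} x / 2))"
    unfolding uniform_measure_def
    by (intro density_cong) (auto simp: indicator_def divide_ennreal[symmetric])
  have "has_bochner_integral lborel (\<lambda>x. f x * indicator {-1..1} x) (F 1 - F (-1))"
    using F f by (intro has_bochner_integral_FTC_Icc_real) (auto simp: continuous_on_eq_continuous_at)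
  then have "has_bochner_integral lborel (\<lambda>x. f x * indicator {-1..1} x / 2) ((F 1 - F (-1)) / 2)"
    by (rule has_bochner_integral_divide_zero)
  then show ?thesis
    unfolding d by (intro has_bochner_integral_density) (auto simp: mult_ac)
qed

lemma trig_uniform_U11: "trig_uniform U11"
proof -
  interpret prob_space U11 by (rule prob_space_U11)
  have "real_distribution U11" by unfold_locales auto
  moreover have "AE x in U11. \<bar>x\<bar> < 1"
  proof (rule AE_uniform_measureI)
    have "AE x in lborel. x \<noteq> (1::real)" "AE x in lborel. x \<noteq> (-1::real)" by (rule AE_lborel_singleton)+
    then show "AE x in lborel. x \<in> {-1..1} \<longrightarrow> \<bar>x\<bar> < (1::real)" by eventually_elim auto
  qed simp
  moreover have "(\<integral>x. cos (real n * pi * x) \<partial>U11) = 0 \<and> (\<integral>x. sin (real n * pi * x) \<partial>U11) = 0" if n: "1 \<le> n" for n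
  proof
    have npi: "real n * pi \<noteq> 0" using n by simp
    have "has_bochner_integral U11 (\<lambda>x. cos (real n * pi * x)) ((sin (real n * pi * 1) / (real n * pi) - sin (real n * pi * (-1)) / (real n * pi)) / 2)"
      using npi by (intro U11_integral) (auto intro!: derivative_eq_intros continuous_intros)
    then show "(\<integral>x. cos (real n * pi * x) \<partial>U11) = 0"
      by (simp add: has_bochner_integral_iff mult.commute)
    have "has_bochner_integral U11 (\<lambda>x. sin (real n * pi * x)) ((- cos (real n * pi * 1) / (real n * pi) - - cos (real n * pi * (-1)) / (real n * pi)) / 2)"
      using npi by (intro U11_integral) (auto intro!: derivative_eq_intros continuous_intros)
    then show "(\<integral>x. sin (real n * pi * x) \<partial>U11) = 0"
      by (simp add: has_bochner_integral_iff)
  qed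
  ultimately show ?thesis by (simp add: trig_uniform_def)
qed

lemma CSEP_target_U11: "CSEP_target U11"
proof -
  have 1: "has_bochner_integral U11 (\<lambda>x. x) ((1\<^sup>2 / 2 - (-1)\<^sup>2 / 2) / 2)"
    by (rule U11_integral) (auto intro!: derivative_eq_intros continuous_intros)
  have 2: "has_bochner_integral U11 (\<lambda>x. x\<^sup>2) ((1 ^ 3 / 3 - (-1) ^ 3 / 3) / 2)"
    by (rule U11_integral) (auto intro!: derivative_eq_intros continuous_intros)
  show ?thesis
    using 1 2 prob_space_U11 by (simp add: CSEP_target_def has_bochner_integral_iff)
qed

section \<open>The domain\<close>

lemma cos_half_pi_pos: "\<bar>x\<bar> < 1 \<Longrightarrow> 0 < cos (pi / 2 * x)"
proof -
  assume "\<bar>x\<bar> < 1"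
  then show ?thesis
    using mult_strict_left_mono[of x 1 "pi / 2"] mult_strict_left_mono[of "-1" x "pi / 2"]
    by (intro cos_gt_zero_pi) auto
qed

lemma h_U_less_iff:
  assumes "\<bar>x\<bar> < 1"
  shows "h_U x < y \<longleftrightarrow> exp (- (pi / 2 * y)) < 2 * cos (pi / 2 * x)"
proof -
  have pos: "0 < 2 * cos (pi / 2 * x)" using cos_half_pi_pos[OF assms] by simp
  have "h_U x < y \<longleftrightarrow> - (pi / 2 * y) < ln (2 * cos (pi / 2 * x))"
    by (simp add: h_U_def field_simps) (rule minus_less_iff)
  also have "\<dots> \<longleftrightarrow> exp (- (pi / 2 * y)) < exp (ln (2 * cos (pi / 2 * x)))" by (simp only: exp_less_cancel_iff)
  finally show ?thesis using pos by (simp only: exp_ln)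
qed

lemma U_domain_iff: "z \<in> U_domain \<longleftrightarrow> \<bar>Re z\<bar> < 1 \<and> exp (- (pi / 2 * Im z)) < 2 * cos (pi / 2 * Re z)"
  using h_U_less_iff by (auto simp: U_domain_def)

lemma open_U_domain: "open U_domain"
proof -
  have eq: "U_domain = {z. \<bar>Re z\<bar> < 1 \<and> exp (- (pi / 2 * Im z)) < 2 * cos (pi / 2 * Re z)}"
    using U_domain_iff by auto
  show ?thesis unfolding eq by (intro open_Collect_conj open_Collect_less continuous_intros)
qed

lemma zero_in_U_domain: "0 \<in> U_domain"
  by (simp add: U_domain_iff)

text \<open>On the vertical lines \<open>\<bar>Re z\<bar> = 1\<close> the cosine vanishes and the exponential does not, so the closure does not meet them.\<close>

lemma closure_U_domain:
  assumes "z \<in> closure U_domain"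
  shows "\<bar>Re z\<bar> < 1" "exp (- (pi / 2 * Im z)) \<le> 2 * cos (pi / 2 * Re z)"
proof -
  have "closure U_domain \<subseteq> {z. \<bar>Re z\<bar> \<le> 1 \<and> exp (- (pi / 2 * Im z)) \<le> 2 * cos (pi / 2 * Re z)}"
  proof (rule closure_minimal)
    show "U_domain \<subseteq> {z. \<bar>Re z\<bar> \<le> 1 \<and> exp (- (pi / 2 * Im z)) \<le> 2 * cos (pi / 2 * Re z)}"
      by (auto simp: U_domain_iff)
    show "closed {z. \<bar>Re z\<bar> \<le> 1 \<and> exp (- (pi / 2 * Im z)) \<le> 2 * cos (pi / 2 * Re z)}"
      by (intro closed_Collect_conj closed_Collect_le continuous_intros)
  qed
  then have z: "\<bar>Re z\<bar> \<le> 1" "exp (- (pi / 2 * Im z)) \<le> 2 * cos (pi / 2 * Re z)" using assms by auto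
  show "exp (- (pi / 2 * Im z)) \<le> 2 * cos (pi / 2 * Re z)" by (rule z)
  have "\<bar>Re z\<bar> \<noteq> 1"
  proof
    assume "\<bar>Re z\<bar> = 1"
    then have "Re z = 1 \<or> Re z = -1" by auto
    then have "cos (pi / 2 * Re z) = 0" by auto
    then show False using z(2) exp_gt_zero[of "- (pi / 2 * Im z)"] by simp
  qed
  then show "\<bar>Re z\<bar> < 1" using z(1) by simp
qed

text \<open>The boundary curve is convex, with derivative \<open>tan (pi / 2 * x)\<close>, and the domain lies above it.\<close>

lemma convex_U_domain: "convex U_domain"
proof -
  have "convex_on {-1<..<1} h_U"
  proof (rule f''_ge0_imp_convex[where f' = "\<lambda>x. tan (pi / 2 * x)" and f'' = "\<lambda>x. pi / 2 * inverse ((cos (pi / 2 * x))\<^sup>2)"])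
    fix x :: real assume "x \<in> {-1<..<1}"
    then have c: "0 < cos (pi / 2 * x)" using cos_half_pi_pos[of x] by auto
    show "(h_U has_real_derivative tan (pi / 2 * x)) (at x)"
      unfolding h_U_def[abs_def] using c
      by (auto intro!: derivative_eq_intros simp: tan_def field_simps)
    show "((\<lambda>x. tan (pi / 2 * x)) has_real_derivative pi / 2 * inverse ((cos (pi / 2 * x))\<^sup>2)) (at x)"
      using c by (auto intro!: derivative_eq_intros simp: field_simps)
    show "0 \<le> pi / 2 * inverse ((cos (pi / 2 * x))\<^sup>2)" by simp
  qed simp
  note h = this
  show ?thesis
  proof (rule convexI)
    fix z w :: complex and u v :: real
    assume *: "z \<in> U_domain" "w \<in> U_domain" and uv: "0 \<le> u" "0 \<le> v" "u + v = 1"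
    then have zw: "Re z \<in> {-1<..<1}" "Re w \<in> {-1<..<1}" "h_U (Re z) < Im z" "h_U (Re w) < Im w"
      by (auto simp: U_domain_def)
    have "u *\<^sub>R Re z + v *\<^sub>R Re w \<in> {-1<..<1}"
      using zw uv by (intro convexD) auto
    moreover have "h_U (u *\<^sub>R Re z + v *\<^sub>R Re w) \<le> u * h_U (Re z) + v * h_U (Re w)"
    proof -
      have u: "u = 1 - v" using uv by simp
      show ?thesis unfolding u using convex_onD[OF h, of v "Re z" "Re w"] zw uv by simp
    qed
    moreover have "u * h_U (Re z) + v * h_U (Re w) < u * Im z + v * Im w"
    proof (cases "u = 0")
      case True then show ?thesis using zw uv by simp
    next
      case False
      then have "u * h_U (Re z) < u * Im z" using zw uv by simp
      moreover have "v * h_U (Re w) \<le> v * Im w" using zw uv by (intro mult_left_mono) auto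
      ultimately show ?thesis by linarith
    qed
    ultimately show "u *\<^sub>R z + v *\<^sub>R w \<in> U_domain"
      by (auto simp: U_domain_def)
  qed
qed

text \<open>The conformal map of the domain onto the unit disc that fixes \<open>0\<close>. Only its values on the closure of the domain
  and its expression by exponentials are used.\<close>

definition disc_map :: "complex \<Rightarrow> complex" where
  "disc_map z = exp (\<i> * of_real (pi / 2) * z) - 1"

lemma disc_map_eq: "disc_map z = of_real (exp (- (pi / 2 * Im z))) * cis (pi / 2 * Re z) - 1"
proof -
  have "\<i> * of_real (pi / 2) * z = Complex (- (pi / 2 * Im z)) (pi / 2 * Re z)"
    by (simp add: complex_eq_iff)
  then show ?thesis by (simp add: disc_map_def exp_eq_polar)
qed

lemma norm_disc_map_le:
  assumes "z \<in> closure U_domain"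
  shows "norm (disc_map z) \<le> 1"
proof -
  let ?e = "exp (- (pi / 2 * Im z))" and ?c = "cos (pi / 2 * Re z)" and ?s = "sin (pi / 2 * Re z)"
  have "(norm (disc_map z))\<^sup>2 = (?e * ?c - 1)\<^sup>2 + (?e * ?s)\<^sup>2"
    by (simp add: disc_map_eq cmod_power2)
  also have "\<dots> = 1 - ?e * (2 * ?c - ?e)"
  proof -
    have "(e * c - 1)\<^sup>2 + (e * s)\<^sup>2 = e\<^sup>2 * (s\<^sup>2 + c\<^sup>2) - 2 * e * c + 1" for e c s :: real
      by (simp add: power2_eq_square algebra_simps)
    then show ?thesis
      by (simp only: sin_cos_squared_add) (simp add: power2_eq_square algebra_simps)
  qed
  also have "\<dots> \<le> 1" using closure_U_domain(2)[OF assms] by simp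
  finally show ?thesis by (simp add: power_le_one_iff abs_square_le_1[symmetric])
qed

lemma disc_map_boundary:
  assumes "z \<in> closure U_domain" "z \<notin> U_domain"
  shows "disc_map z = cis (pi * Re z)"
proof -
  define a where "a = pi / 2 * Re z"
  have e: "exp (- (pi / 2 * Im z)) = 2 * cos a"
    using closure_U_domain[OF assms(1)] assms(2) by (auto simp: U_domain_iff a_def)
  have "pi * Re z = 2 * a" by (simp add: a_def)
  then have "cis (pi * Re z) = Complex (cos (2 * a)) (sin (2 * a))" by (simp add: complex_eq_iff)
  also have "\<dots> = of_real (2 * cos a) * cis a - 1"
    by (simp add: complex_eq_iff cos_double_cos sin_double power2_eq_square)
  finally show ?thesis by (simp only: disc_map_eq e a_def)
qed

lemma caloric_exp_Re_Im:
  fixes c :: real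
  shows "caloric t (\<lambda>s z. Re (exp (\<i> * of_real c * z)))" "caloric t (\<lambda>s z. Im (exp (\<i> * of_real c * z)))"
proof -
  have exp_eq: "exp (\<i> * of_real c * z) = of_real (exp ((-c) * Im z)) * cis (c * Re z)" for z
  proof -
    have "\<i> * of_real c * z = Complex ((-c) * Im z) (c * Re z)" by (simp add: complex_eq_iff)
    then show ?thesis by (simp add: exp_eq_polar)
  qed
  have b1: "\<bar>cos (c * x + p)\<bar> \<le> 2 * cosh (c * x)" for x p
    using order_trans[OF abs_cos_le_one cosh_real_ge_1, of "c * x + p" "c * x"] cosh_real_ge_1[of "c * x"] by linarith
  have b2: "\<bar>exp ((-c) * x)\<bar> \<le> 2 * cosh (c * x)" for x
    by (simp add: cosh_field_def)
  have cal: "caloric t (\<lambda>s z. cos (c * Re z + p) * exp ((-c) * Im z))" for p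
    using caloric_eigen[OF normal_eigen_cos b1 normal_eigen_exp b2, of t p] by simp
  have re_im: "Re (exp (\<i> * of_real c * z)) = cos (c * Re z + 0) * exp ((-c) * Im z)"
    "Im (exp (\<i> * of_real c * z)) = cos (c * Re z + - (pi / 2)) * exp ((-c) * Im z)" for z
    unfolding exp_eq by (simp_all add: cos_diff)
  show "caloric t (\<lambda>s z. Re (exp (\<i> * of_real c * z)))" "caloric t (\<lambda>s z. Im (exp (\<i> * of_real c * z)))"
    unfolding re_im by (rule cal)+
qed

text \<open>By the binomial theorem the power is a combination of the functions \<open>exp (\<i> * c * z)\<close> with real coefficients.\<close>

lemma caloric_disc_map_power:
  "caloric t (\<lambda>s z. Re (disc_map z ^ n))" "caloric t (\<lambda>s z. Im (disc_map z ^ n))"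
proof -
  have eq: "disc_map z ^ n = (\<Sum>k\<le>n. of_real (real (n choose k) * (-1) ^ (n - k)) * exp (\<i> * of_real (real k * (pi / 2)) * z))" for z
  proof -
    have "disc_map z ^ n = (exp (\<i> * of_real (pi / 2) * z) + (-1)) ^ n" by (simp add: disc_map_def)
    also have "\<dots> = (\<Sum>k\<le>n. of_nat (n choose k) * exp (\<i> * of_real (pi / 2) * z) ^ k * (-1) ^ (n - k))"
      by (rule binomial_ring)
    also have "\<dots> = (\<Sum>k\<le>n. of_real (real (n choose k) * (-1) ^ (n - k)) * exp (\<i> * of_real (real k * (pi / 2)) * z))"
      by (intro sum.cong refl) (simp add: exp_of_nat_mult[symmetric] mult_ac)
    finally show ?thesis .
  qed
  have re: "Re (of_real r * w) = r * Re w" "Im (of_real r * w) = r * Im w" for r w by simp_all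
  show "caloric t (\<lambda>s z. Re (disc_map z ^ n))" "caloric t (\<lambda>s z. Im (disc_map z ^ n))"
    unfolding eq Re_sum Im_sum re by (intro caloric_sum caloric_cmult caloric_exp_Re_Im)+
qed

context planar_BM
begin

section \<open>The law of the exit position\<close>

lemma exit_position_boundary:
  assumes D: "open D" and 0: "0 \<in> D" and fin: "(\<integral>\<^sup>+\<omega>. exit_time W D \<omega> \<partial>M) < \<infinity>"
  shows "AE \<omega> in M. exit_time W D \<omega> < \<infinity> \<and> exit_position W D \<omega> \<in> closure D - D"
proof -
  show ?thesis
    using AE_exit_time_finite[OF D fin] AE_start AE_space
  proof eventually_elim
    case (elim \<omega>)
    show ?case
      using D order_refl elim(3)
    proof (cases rule: exit_after_cases)
      case never then show ?thesis using elim(1) by (simp add: exit_time_eq)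
    next
      case (exit t0)
      then have pos: "exit_position W D \<omega> = stopped 0 D t0 \<omega>"
        by (simp add: exit_position_def exit_time_eq stopped_def stop_time_def)
      have "stopped 0 D t0 \<omega> \<in> closure D"
        using exit(2) elim(2,3) 0 by (intro stopped_in_closure[OF D]) auto
      moreover have "stopped 0 D t0 \<omega> \<notin> D"
        using exit by (simp add: stopped_def stop_time_def)
      ultimately show ?thesis using pos exit(1) by (simp add: exit_time_eq)
    qed
  qed
qed

lemma AE_stopped_closure:
  assumes D: "open D" and 0: "0 \<in> D" and t: "0 \<le> t"
  shows "AE \<omega> in M. stopped 0 D t \<omega> \<in> closure D"
  using AE_start AE_space
  by eventually_elim (use 0 in \<open>auto intro: stopped_in_closure[OF D order_refl t]\<close>)

text \<open>The mean of the stopped time is the second moment of the stopped real part, which is at most \<open>1\<close> in the strip.\<close>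

lemma exit_time_U_le: "(\<integral>\<^sup>+\<omega>. exit_time W U_domain \<omega> \<partial>M) \<le> 1"
proof -
  note D = open_U_domain
  have le: "(\<integral>\<^sup>+\<omega>. ennreal (stop_time 0 U_domain (real n) \<omega>) \<partial>M) \<le> 1" for n
  proof -
    have "(\<integral>\<omega>. stop_time 0 U_domain (real n) \<omega> \<partial>M) = (\<integral>\<omega>. (Re (stopped 0 U_domain (real n) \<omega>))\<^sup>2 \<partial>M)"
      using stopped_second_moment(2)[OF D, of "real n"] by simp
    also have "\<dots> \<le> (\<integral>\<omega>. 1 \<partial>M)"
    proof (rule integral_mono_AE)
      show "AE \<omega> in M. (Re (stopped 0 U_domain (real n) \<omega>))\<^sup>2 \<le> 1"
        using AE_stopped_closure[OF D zero_in_U_domain, of "real n"]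
        by (rule AE_mp) (use closure_U_domain(1) in \<open>auto simp: abs_square_le_1 intro: less_imp_le\<close>)
    qed (use stopped_second_moment(1)[OF D, of "real n"] in auto)
    finally have "(\<integral>\<omega>. stop_time 0 U_domain (real n) \<omega> \<partial>M) \<le> 1" using prob_space by simp
    then show ?thesis
      by (subst nn_integral_eq_integral[OF integrable_stop_time[OF D]]) (auto simp: stop_time_nonneg)
  qed
  have st: "ennreal (stop_time 0 U_domain (real n) \<omega>) = min (exit_time W U_domain \<omega>) (ennreal (real n))" for n \<omega>
  proof -
    have "min (exit_after 0 U_domain \<omega>) (ennreal (real n)) < \<infinity>" by (simp add: min_less_iff_disj)
    then show ?thesis by (simp add: stop_time_def exit_time_eq)
  qed
  have sup: "(SUP n. min x (ennreal (real n))) = x" for x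
  proof -
    have "(SUP n. min x (ennreal (real n))) = min x (SUP n. ennreal (real n))"
      by (simp add: inf_SUP inf_min[symmetric])
    then show ?thesis by (simp add: ennreal_SUP_of_nat_eq_top ennreal_of_nat_eq_real_of_nat[symmetric])
  qed
  have [measurable]: "stop_time 0 U_domain t \<in> borel_measurable M" for t by (rule measurable_stop_time[OF D order_refl])
  have "(\<integral>\<^sup>+\<omega>. exit_time W U_domain \<omega> \<partial>M) = (\<integral>\<^sup>+\<omega>. (SUP n. ennreal (stop_time 0 U_domain (real n) \<omega>)) \<partial>M)"
    unfolding st sup ..
  also have "\<dots> = (SUP n. \<integral>\<^sup>+\<omega>. ennreal (stop_time 0 U_domain (real n) \<omega>) \<partial>M)"
  proof (rule nn_integral_monotone_convergence_SUP)
    show "incseq (\<lambda>n \<omega>. ennreal (stop_time 0 U_domain (real n) \<omega>))"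
      unfolding st incseq_def le_fun_def
      by (intro allI impI min.mono[OF order_refl ennreal_leI]) simp
  qed simp
  also have "\<dots> \<le> 1" by (intro SUP_least le)
  finally show ?thesis .
qed

text \<open>The power of the disc map vanishes at \<open>0\<close>, has modulus at most \<open>1\<close> on the closure of the domain, and equals
  \<open>cis (n * pi * Re z)\<close> on the boundary.\<close>

lemma exit_U_trig:
  assumes n: "1 \<le> n" and f: "f = Re \<or> f = Im"
  shows "(\<integral>\<omega>. f (cis (real n * pi * Re (exit_position W U_domain \<omega>))) \<partial>M) = 0"
proof -
  note D = open_U_domain
  have fin: "(\<integral>\<^sup>+\<omega>. exit_time W U_domain \<omega> \<partial>M) < \<infinity>" by (rule le_less_trans[OF exit_time_U_le]) simp
  let ?F = "\<lambda>z. f (disc_map z ^ n)"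
  have cal: "caloric t (\<lambda>s. ?F)" for t using f caloric_disc_map_power by auto
  have [measurable]: "?F \<in> borel_measurable borel"
    using cal[of 0] unfolding caloric_def by (auto dest: subcaloric_meas[of 0 "\<lambda>s. ?F" 0])
  have [measurable]: "stopped 0 U_domain s \<in> borel_measurable M" for s by (rule measurable_stopped[OF D order_refl])
  have [measurable]: "exit_position W U_domain \<in> borel_measurable M" by (rule measurable_exit_position[OF D])
  have F0: "?F 0 = 0" using n f by (auto simp: disc_map_def)
  have zero: "(\<integral>\<omega>. ?F (stopped 0 U_domain (real k) \<omega>) \<partial>M) = 0" for k
    using optional_stopping_start[OF D _ cal, of "real k"] F0 by simp
  have bound: "\<bar>?F z\<bar> \<le> 1" if "z \<in> closure U_domain" for z
  proof -
    have "\<bar>?F z\<bar> \<le> norm (disc_map z ^ n)" using f abs_Re_le_cmod abs_Im_le_cmod by auto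
    also have "\<dots> \<le> 1" using norm_disc_map_le[OF that] by (simp add: norm_power power_le_one)
    finally show ?thesis .
  qed
  have "(\<lambda>k. \<integral>\<omega>. ?F (stopped 0 U_domain (real k) \<omega>) \<partial>M) \<longlonglongrightarrow> (\<integral>\<omega>. ?F (exit_position W U_domain \<omega>) \<partial>M)"
  proof (rule integral_dominated_convergence[where w = "\<lambda>_. 1"])
    show "AE \<omega> in M. (\<lambda>k. ?F (stopped 0 U_domain (real k) \<omega>)) \<longlonglongrightarrow> ?F (exit_position W U_domain \<omega>)"
      using exit_position_boundary[OF D zero_in_U_domain fin] AE_space
    proof eventually_elim
      case (elim \<omega>)
      then have "eventually (\<lambda>k. stopped 0 U_domain (real k) \<omega> = exit_position W U_domain \<omega>) sequentially"
        by (intro stopped_tendsto_exit_position[OF D]) auto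
      then show ?case by (intro tendsto_eventually) (auto elim: eventually_mono)
    qed
    show "AE \<omega> in M. norm (?F (stopped 0 U_domain (real k) \<omega>)) \<le> 1" for k
      using AE_stopped_closure[OF D zero_in_U_domain, of "real k"]
      by (rule AE_mp) (use bound in auto)
  qed auto
  then have "(\<integral>\<omega>. ?F (exit_position W U_domain \<omega>) \<partial>M) = 0"
    unfolding zero by (simp add: LIMSEQ_const_iff)
  also have "(\<integral>\<omega>. ?F (exit_position W U_domain \<omega>) \<partial>M) = (\<integral>\<omega>. f (cis (real n * pi * Re (exit_position W U_domain \<omega>))) \<partial>M)"
  proof (rule integral_cong_AE)
    have [measurable]: "f \<in> borel_measurable borel" using f by auto
    show "(\<lambda>\<omega>. f (cis (real n * pi * Re (exit_position W U_domain \<omega>)))) \<in> borel_measurable M"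
      unfolding cis_conv_exp by measurable
    show "AE \<omega> in M. ?F (exit_position W U_domain \<omega>) = f (cis (real n * pi * Re (exit_position W U_domain \<omega>)))"
      using exit_position_boundary[OF D zero_in_U_domain fin]
    proof eventually_elim
      case (elim \<omega>)
      then have "disc_map (exit_position W U_domain \<omega>) = cis (pi * Re (exit_position W U_domain \<omega>))"
        by (intro disc_map_boundary) auto
      then show ?case by (simp only: Complex.DeMoivre mult.assoc)
    qed
  qed measurable
  finally show ?thesis .
qed

lemma exit_U_law: "has_law M (\<lambda>\<omega>. Re (exit_position W U_domain \<omega>)) U11"
proof -
  let ?X = "\<lambda>\<omega>. Re (exit_position W U_domain \<omega>)"
  have fin: "(\<integral>\<^sup>+\<omega>. exit_time W U_domain \<omega> \<partial>M) < \<infinity>" by (rule le_less_trans[OF exit_time_U_le]) simp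
  have [measurable]: "exit_position W U_domain \<in> borel_measurable M" by (rule measurable_exit_position[OF open_U_domain])
  have X [measurable]: "?X \<in> borel_measurable M" by measurable
  have "trig_uniform (distr M borel ?X)"
    unfolding trig_uniform_def
  proof (intro conjI allI impI)
    show "real_distribution (distr M borel ?X)" by (rule real_distribution_distr) simp
    show "AE x in distr M borel ?X. \<bar>x\<bar> < 1"
    proof (subst AE_distr_iff)
      show "AE \<omega> in M. \<bar>?X \<omega>\<bar> < 1"
        using exit_position_boundary[OF open_U_domain zero_in_U_domain fin]
        by eventually_elim (auto intro: closure_U_domain(1))
    qed auto
    fix n :: nat assume n: "1 \<le> n"
    show "(\<integral>x. cos (real n * pi * x) \<partial>distr M borel ?X) = 0"
      using exit_U_trig[OF n, of Re] by (subst integral_distr) auto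
    show "(\<integral>x. sin (real n * pi * x) \<partial>distr M borel ?X) = 0"
      using exit_U_trig[OF n, of Im] by (subst integral_distr) auto
  qed
  from trig_uniform_unique[OF this trig_uniform_U11] show ?thesis
    using X by (simp add: has_law_def)
qed

lemma U_solves_CSEP: "solves_CSEP M W U11 U_domain"
  using CSEP_target_U11 open_U_domain convex_connected[OF convex_U_domain]
    convex_imp_simply_connected[OF convex_U_domain] zero_in_U_domain exit_U_law
    le_less_trans[OF exit_time_U_le, of \<infinity>]
  by (simp add: solves_CSEP_def)

end

section \<open>Survival in the domain\<close>

lemma h_U_exp: "\<bar>w\<bar> < 1 \<Longrightarrow> exp (- (pi / 2 * h_U w)) = 2 * cos (pi / 2 * w)"
  using cos_half_pi_pos[of w] by (simp add: h_U_def)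

lemma in_U_domain_above:
  assumes w: "w < 1" and z: "\<bar>Re z\<bar> < w" "h_U w \<le> Im z"
  shows "z \<in> U_domain"
proof -
  have "exp (- (pi / 2 * Im z)) \<le> exp (- (pi / 2 * h_U w))" using z(2) by simp
  also have "\<dots> = 2 * cos (pi / 2 * w)" using w z by (intro h_U_exp) auto
  also have "\<dots> < 2 * cos (pi / 2 * \<bar>Re z\<bar>)"
    using w z by (intro mult_strict_left_mono cos_monotone_0_pi) auto
  also note cos_mult_abs
  finally show ?thesis using w z by (simp add: U_domain_iff)
qed

context planar_BM
begin

text \<open>The two lowest modes of the vertical motion are \<open>sin \<theta>\<close> and \<open>sin (2 * \<theta>)\<close>, where \<open>\<theta>\<close> runs from \<open>0\<close> to \<open>pi\<close> along the
  height. The second decays faster, so after a long time a combination that is positive only for \<open>\<theta> > pi / 3\<close> still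
  has a positive mean over the paths inside.\<close>

lemma reaches_upper_part:
  assumes w: "0 < w" and y: "y1 < 0" "0 < y2"
  defines "Q \<equiv> {z. \<bar>Re z\<bar> < w \<and> y1 < Im z \<and> Im z < y2}"
  shows "\<exists>T\<ge>0. 0 < prob (stays 0 T Q \<inter> (W T -` {z. y1 + (y2 - y1) / 3 < Im z} \<inter> space M))"
proof -
  define a where "a = pi / (2 * w)"
  define b where "b = pi / (y2 - y1)"
  have ab: "a * w = pi / 2" "b * (y2 - y1) = pi" "0 < a" "0 < b" using w y by (auto simp: a_def b_def)
  define \<theta> where "\<theta> z = b * (Im z - y1)" for z
  define k1 where "k1 = (a\<^sup>2 + b\<^sup>2) / 2"
  define k2 where "k2 = (a\<^sup>2 + (2 * b)\<^sup>2) / 2"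
  have k: "k1 < k2" using ab by (simp add: k1_def k2_def power2_eq_square)
  \<comment> \<open>After this time the second mode has lost a factor \<open>4\<close> against the first.\<close>
  define T where "T = ln 4 / (k2 - k1)"
  have T: "0 \<le> T" using k by (simp add: T_def)
  have "exp (k2 * T) = exp (k1 * T) * exp ((k2 - k1) * T)" by (simp add: exp_add[symmetric] algebra_simps)
  also have "exp ((k2 - k1) * T) = 4" using k by (simp add: T_def)
  finally have kT: "exp (k2 * T) = 4 * exp (k1 * T)" by simp
  define u where "u s z = exp (k1 * s) * (cos (a * Re z) * sin (\<theta> z)) - 1 / 4 * (exp (k2 * s) * (cos (a * Re z) * sin (2 * \<theta> z)))" for s z
  have sin1: "sin (\<theta> z) = cos (b * Im z + (- b * y1 - pi / 2))"
    and sin2: "sin (2 * \<theta> z) = cos (2 * b * Im z + (- 2 * b * y1 - pi / 2))" for z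
  proof -
    have "b * Im z + (- b * y1 - pi / 2) = \<theta> z - pi / 2" "2 * b * Im z + (- 2 * b * y1 - pi / 2) = 2 * \<theta> z - pi / 2"
      by (auto simp: \<theta>_def algebra_simps)
    then show "sin (\<theta> z) = cos (b * Im z + (- b * y1 - pi / 2))" "sin (2 * \<theta> z) = cos (2 * b * Im z + (- 2 * b * y1 - pi / 2))"
      by (simp_all only: cos_diff) simp_all
  qed
  have cal: "caloric T u"
    using caloric_add[OF caloric_cos_cos[of T a b 0 "- b * y1 - pi / 2"]
        caloric_cmult[OF caloric_cos_cos[of T a "2 * b" 0 "- 2 * b * y1 - pi / 2"], of "- (1 / 4)"]]
    unfolding u_def[abs_def] k1_def k2_def sin1 sin2 by simp
  have Q: "open Q" unfolding Q_def by (intro open_Collect_conj open_Collect_less continuous_intros)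
  have clQ: "closure Q \<subseteq> {z. \<bar>Re z\<bar> \<le> w \<and> y1 \<le> Im z \<and> Im z \<le> y2}"
    unfolding Q_def by (intro closure_minimal closed_Collect_conj closed_Collect_le continuous_intros) auto
  have zero: "u s z = 0" if "z \<in> closure Q" "z \<notin> Q" for s z
  proof -
    have "\<bar>Re z\<bar> = w \<or> Im z = y1 \<or> Im z = y2" using that clQ by (auto simp: Q_def)
    moreover have "cos (a * Re z) = 0" if "\<bar>Re z\<bar> = w"
      using cos_mult_abs[of a "Re z"] unfolding that ab by simp
    moreover have "sin (\<theta> z) = 0 \<and> sin (2 * \<theta> z) = 0" if "Im z = y1 \<or> Im z = y2"
      using that ab(2) by (auto simp: \<theta>_def)
    ultimately show ?thesis by (auto simp: u_def)
  qed
  define G where "G = W T -` {z. y1 + (y2 - y1) / 3 < Im z} \<inter> space M"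
  have G: "G \<in> events" unfolding G_def by (intro measurable_sets[OF measurable_W[OF T]]) measurable
  have st: "stays 0 T Q \<in> events" by (rule stays_events[OF Q order_refl T])
  \<comment> \<open>at time \<open>T\<close> the two modes combine to a multiple of \<open>sin \<theta> * (1 - 2 * cos \<theta>)\<close>, which is
     positive only in the upper two thirds of the rectangle\<close>
  have inside: "u T z \<le> 3 * exp (k1 * T) * indicator {z. y1 + (y2 - y1) / 3 < Im z} z" if z: "z \<in> Q" for z
  proof -
    have "\<theta> z < b * (y2 - y1)" "0 < \<theta> z" using z ab(4) by (auto simp: \<theta>_def Q_def)
    then have \<theta>: "0 < \<theta> z" "\<theta> z < pi" using ab by auto
    have "a * \<bar>Re z\<bar> < a * w" using z ab by (auto simp: Q_def)
    then have "\<bar>a * Re z\<bar> < pi / 2" using ab by (simp add: abs_mult)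
    then have c: "0 < cos (a * Re z)" by (intro cos_gt_zero_pi) linarith+
    have s: "0 < sin (\<theta> z)" using \<theta> by (intro sin_gt_zero)
    have eq: "u T z = exp (k1 * T) * (cos (a * Re z) * sin (\<theta> z)) * (1 - 2 * cos (\<theta> z))"
      unfolding u_def kT sin_double by (simp add: algebra_simps)
    show ?thesis
    proof (cases "y1 + (y2 - y1) / 3 < Im z")
      case True
      have "cos (a * Re z) * sin (\<theta> z) \<le> 1 * 1" using c s by (intro mult_mono) auto
      then have "(cos (a * Re z) * sin (\<theta> z)) * (1 - 2 * cos (\<theta> z)) \<le> 1 * 3"
      proof (cases "0 \<le> 1 - 2 * cos (\<theta> z)")
        case nonneg: True
        have "1 - 2 * cos (\<theta> z) \<le> 3" using cos_ge_minus_one[of "\<theta> z"] by linarith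
        with nonneg \<open>cos (a * Re z) * sin (\<theta> z) \<le> 1 * 1\<close> show ?thesis by (intro mult_mono) auto
      next
        case False
        then have "(cos (a * Re z) * sin (\<theta> z)) * (1 - 2 * cos (\<theta> z)) \<le> 0"
          using c s by (intro mult_nonneg_nonpos) auto
        then show ?thesis by simp
      qed
      from mult_left_mono[OF this, of "exp (k1 * T)"] show ?thesis unfolding eq using True by (simp add: mult.assoc)
    next
      case False
      have "Im z - y1 \<le> (y2 - y1) / 3" using False by linarith
      then have "b * (Im z - y1) \<le> b * ((y2 - y1) / 3)" using ab(4) by (intro mult_left_mono) auto
      then have "\<theta> z \<le> pi / 3" using ab(2) by (simp add: \<theta>_def)
      then have "cos (pi / 3) \<le> cos (\<theta> z)" using \<theta> by (intro cos_monotone_0_pi_le) auto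
      then have "1 - 2 * cos (\<theta> z) \<le> 0" by (simp add: cos_60)
      then have "u T z \<le> 0" unfolding eq using c s by (intro mult_nonneg_nonpos) auto
      then show ?thesis using False by simp
    qed
  qed
  have "\<theta> 0 = b * (0 - y1)" by (simp add: \<theta>_def)
  moreover have "b * (0 - y1) < b * (y2 - y1)" using y ab(4) by (intro mult_strict_left_mono) auto
  moreover have "0 < b * (0 - y1)" using y ab(4) by (intro mult_pos_pos) auto
  ultimately have \<theta>0: "0 < sin (\<theta> 0)" using ab by (intro sin_gt_zero) simp_all
  have "u 0 0 = sin (\<theta> 0) * (1 - cos (\<theta> 0) / 2)" unfolding u_def sin_double by (simp add: algebra_simps)
  also have "\<dots> > 0"
  proof (rule mult_pos_pos[OF \<theta>0])
    show "0 < 1 - cos (\<theta> 0) / 2" using cos_le_one[of "\<theta> 0"] by linarith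
  qed
  finally have "0 < (\<integral>\<omega>. u (stop_time 0 Q T \<omega>) (stopped 0 Q T \<omega>) \<partial>M)"
    using optional_stopping_start[OF Q T cal] by simp
  also have "\<dots> \<le> (\<integral>\<omega>. 3 * exp (k1 * T) * indicator (stays 0 T Q \<inter> G) \<omega> \<partial>M)"
  proof (rule integral_mono_AE)
      show "integrable M (\<lambda>\<omega>. u (stop_time 0 Q T \<omega>) (stopped 0 Q T \<omega>))"
      using optional_stopping(1)[OF Q order_refl T _ space_in_history] cal by (auto simp: caloric_def)
    show "integrable M (\<lambda>\<omega>. 3 * exp (k1 * T) * indicator (stays 0 T Q \<inter> G) \<omega> :: real)"
      using G st by (intro integrable_mult_right integrable_real_indicator) (auto simp: emeasure_eq_measure)
    show "AE \<omega> in M. u (stop_time 0 Q T \<omega>) (stopped 0 Q T \<omega>) \<le> 3 * exp (k1 * T) * indicator (stays 0 T Q \<inter> G) \<omega>"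
      using AE_start AE_space
    proof eventually_elim
      case (elim \<omega>)
      have W0: "W 0 \<omega> \<in> Q" using elim(1) w y by (simp add: Q_def)
      show ?case
      proof (cases "\<omega> \<in> stays 0 T Q")
        case True
        then have "W T \<omega> \<in> Q" using T by (auto simp: stays_def)
        from inside[OF this] show ?thesis
          using True elim(2) by (simp add: stopped_stay[OF Q order_refl T True] G_def indicator_def)
      next
        case False
        then show ?thesis
          using zero[OF stopped_in_closure[OF Q order_refl T elim(2) W0] stopped_outside[OF Q order_refl T elim(2) False]] by simp
      qed
    qed
  qed
  also have "\<dots> = 3 * exp (k1 * T) * prob (stays 0 T Q \<inter> G)" using G st by simp
  finally have "0 < prob (stays 0 T Q \<inter> G)" by (simp add: zero_less_mult_iff)
  then show ?thesis using T unfolding G_def by blast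
qed

text \<open>The path climbs inside a rectangle of width \<open>2 / 3\<close> and, if at time \<open>T\<close> it is high enough, it is inside a rectangle of
  width \<open>2 * w\<close> and height \<open>2 * v\<close> that lies in the domain. From then on \<open>rectangle_survival\<close> applies. Both \<open>w\<close> and \<open>v\<close> are
  chosen so that, as \<open>n\<close> grows, the rate tends to that of the strip.\<close>

lemma survival_U_lower:
  fixes n :: nat
  defines "w \<equiv> 1 - inverse (real (n + 2))"
  shows "\<exists>v \<kappa> T. real (Suc n) \<le> v \<and> 0 < \<kappa> \<and> 0 \<le> T \<and>
    (\<forall>t\<ge>T. \<kappa> \<le> exp (((pi / (2 * w))\<^sup>2 + (pi / (2 * v))\<^sup>2) / 2 * (t - T)) * prob (stays 0 t U_domain))"
proof -
  have "inverse (real (n + 2)) \<le> inverse 2" by (intro le_imp_inverse_le) auto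
  then have w: "1 / 3 < w" "w < 1" by (auto simp: w_def)
  \<comment> \<open>Above this level the domain contains the strip \<open>\<bar>Re z\<bar> < 1 / 3\<close>; it is below \<open>0\<close>.\<close>
  define y1 where "y1 = h_U (1 / 3)"
  have "1 < 2 * cos (pi / 2 * (1 / 3))"
  proof -
    have *: "cos (pi / 2 * (1 / 3)) = sqrt 3 / 2" using cos_30 by simp
    have "1 < sqrt (3::real)" by (rule real_less_rsqrt) simp
    then show ?thesis unfolding * by simp
  qed
  then have y1: "y1 < 0" by (simp add: y1_def h_U_def)
  have hw: "y1 \<le> h_U w"
  proof -
    have "cos (pi / 2 * w) \<le> cos (pi / 2 * (1 / 3))" using w by (intro cos_monotone_0_pi_le) auto
    moreover have "0 < cos (pi / 2 * w)" using w by (intro cos_half_pi_pos) auto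
    ultimately have "ln (2 * cos (pi / 2 * w)) \<le> ln (2 * cos (pi / 2 * (1 / 3)))" by simp
    from mult_left_mono[OF this, of "2 / pi"] show ?thesis by (simp add: y1_def h_U_def)
  qed
  \<comment> \<open>A third of the height of the first rectangle: large enough that its upper two thirds lie above the level \<open>h_U w\<close> and
     that the rectangle contains \<open>0\<close>.\<close>
  define c where "c = h_U w - y1 + 1 + \<bar>y1\<bar>"
  have c: "1 \<le> c" "\<bar>y1\<bar> \<le> c" "h_U w < y1 + c" using hw by (auto simp: c_def)
  define y2 where "y2 = y1 + 3 * c"
  have y2: "0 < y2" using c by (auto simp: y2_def)
  define v where "v = 3 * c + real (Suc n)"
  define Q1 where "Q1 = {z. \<bar>Re z\<bar> < 1 / 3 \<and> y1 < Im z \<and> Im z < y2}"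
  define Q2 where "Q2 = {z. \<bar>Re z - 0\<bar> < w \<and> \<bar>Im z - (h_U w + v)\<bar> < v}"
  have Q1U: "Q1 \<subseteq> U_domain" using in_U_domain_above[of "1/3"] by (auto simp: Q1_def y1_def)
  have Q2U: "Q2 \<subseteq> U_domain"
  proof
    fix z assume "z \<in> Q2"
    then have "\<bar>Re z\<bar> < w" "h_U w \<le> Im z" by (auto simp: Q2_def)
    then show "z \<in> U_domain" by (rule in_U_domain_above[OF w(2)])
  qed
  obtain T where T: "0 \<le> T" "0 < prob (stays 0 T Q1 \<inter> (W T -` {z. y1 + (y2 - y1) / 3 < Im z} \<inter> space M))"
    using reaches_upper_part[of "1/3" y1 y2] y1 y2 unfolding Q1_def by auto
  define H where "H = stays 0 T Q1 \<inter> (W T -` {z. y1 + (y2 - y1) / 3 < Im z} \<inter> space M)"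
  have Q1o: "open Q1" unfolding Q1_def by (intro open_Collect_conj open_Collect_less continuous_intros)
  have H: "H \<in> sets (history T)"
  proof -
    have "W T -` {z. y1 + (y2 - y1) / 3 < Im z} \<inter> space (history T) \<in> sets (history T)"
      by (rule measurable_sets[OF measurable_history_W]) (use T in auto)
    then show ?thesis unfolding H_def using stays_in_history[OF Q1o order_refl T(1)] by auto
  qed
  have He: "H \<in> events" by (rule history_sets[OF H])
  have HQ2: "W T \<omega> \<in> Q2" if "\<omega> \<in> H" for \<omega>
  proof -
    have "W T \<omega> \<in> Q1" "y1 + c < Im (W T \<omega>)" using that T(1) by (auto simp: H_def stays_def y2_def)
    then show ?thesis using w c hw by (auto simp: Q1_def Q2_def y2_def v_def abs_less_iff)
  qed
  define f where "f z = cos (pi / (2 * w) * (Re z - 0)) * cos (pi / (2 * v) * (Im z - (h_U w + v)))" for z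
  have v: "0 < v" using c by (simp add: v_def)
  have fpos: "0 < f z" if "z \<in> Q2" for z
  proof -
    have *: "0 < cos (pi / (2 * r) * x)" if "\<bar>x\<bar> < r" for x r :: real
    proof -
      have r: "0 < r" using that by linarith
      have "pi / (2 * r) * \<bar>x\<bar> < pi / (2 * r) * r" using that r by (intro mult_strict_left_mono) auto
      then have "pi / (2 * r) * \<bar>x\<bar> < pi / 2" using r by simp
      then have "0 < cos (pi / (2 * r) * \<bar>x\<bar>)" using r by (intro cos_gt_zero_pi) (auto intro: less_le_trans[of _ 0])
      then show ?thesis by (simp only: cos_mult_abs)
    qed
    show ?thesis unfolding f_def using that by (intro mult_pos_pos * ) (auto simp: Q2_def)
  qed
  define \<kappa> where "\<kappa> = (\<integral>\<omega>. indicator H \<omega> * f (W T \<omega>) \<partial>M)"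
  have fm [measurable]: "f \<in> borel_measurable borel" unfolding f_def by measurable
  note [measurable] = measurable_W[OF T(1)]
  have fi: "integrable M (\<lambda>\<omega>. indicator H \<omega> * f (W T \<omega>))"
    using He by (intro indicator_mult_integrable integrable_const_bound[of _ 1]) (auto simp: f_def abs_mult intro!: mult_le_one)
  have fnn: "0 \<le> indicator H \<omega> * f (W T \<omega>)" for \<omega>
    using fpos[OF HQ2, of \<omega>] by (auto simp: indicator_def)
  have \<kappa>: "0 < \<kappa>"
  proof -
    have "0 \<le> \<kappa>" unfolding \<kappa>_def using fnn by (intro Bochner_Integration.integral_nonneg) auto
    moreover have "\<kappa> \<noteq> 0"
    proof
      assume "\<kappa> = 0"
      then have "AE \<omega> in M. indicator H \<omega> * f (W T \<omega>) = 0"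
        unfolding \<kappa>_def using integral_nonneg_eq_0_iff_AE[OF fi] fnn by auto
      then have "AE \<omega> in M. \<omega> \<notin> H"
        by eventually_elim (use fpos HQ2 in \<open>force simp: indicator_def\<close>)
      then have "prob H = 0" using He by (simp add: prob_eq_0)
      then show False using T(2) by (simp add: H_def)
    qed
    ultimately show ?thesis by simp
  qed
  have "\<kappa> \<le> exp (((pi / (2 * w))\<^sup>2 + (pi / (2 * v))\<^sup>2) / 2 * (t - T)) * prob (stays 0 t U_domain)" if t: "T \<le> t" for t
  proof -
    have "\<kappa> \<le> exp (((pi / (2 * w))\<^sup>2 + (pi / (2 * v))\<^sup>2) / 2 * (t - T)) * prob (H \<inter> stays T t Q2)"
      unfolding \<kappa>_def f_def Q2_def
      by (rule rectangle_survival[OF _ v T(1) t H]) (use w HQ2 in \<open>auto simp: Q2_def\<close>)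
    also have "\<dots> \<le> exp (((pi / (2 * w))\<^sup>2 + (pi / (2 * v))\<^sup>2) / 2 * (t - T)) * prob (stays 0 t U_domain)"
    proof (intro mult_left_mono finite_measure_mono)
      show "stays 0 t U_domain \<in> events" using T t by (intro stays_events[OF open_U_domain]) auto
      show "H \<inter> stays T t Q2 \<subseteq> stays 0 t U_domain"
      proof
        fix \<omega> assume \<omega>: "\<omega> \<in> H \<inter> stays T t Q2"
        have "W r \<omega> \<in> U_domain" if "r \<in> {0..t}" for r
          using that \<omega> Q1U Q2U by (cases "r \<le> T") (auto simp: H_def stays_def)
        then show "\<omega> \<in> stays 0 t U_domain" using \<omega> by (auto simp: stays_def)
      qed
    qed simp
    finally show ?thesis .
  qed
  moreover have "real (Suc n) \<le> v" using c by (simp add: v_def)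
  ultimately show ?thesis using \<kappa> T(1) by blast
qed

section \<open>The rates\<close>

lemma inverse_add_2_tendsto_0: "(\<lambda>n. inverse (real (n + 2))) \<longlonglongrightarrow> 0"
  using LIMSEQ_ignore_initial_segment[OF LIMSEQ_inverse_real_of_nat, of 1] by simp

lemma rate_eq:
  assumes D: "open D" and lim: "((\<lambda>t. 1 / t * ln (prob (stays 0 t D))) \<longlongrightarrow> L) at_top"
  shows "rate M W D = - L"
proof -
  have "((\<lambda>t. 1 / t * ln (prob {\<omega>\<in>space M. exit_time W D \<omega> > ennreal t})) \<longlongrightarrow> L) at_top"
  proof (rule Lim_transform_eventually[OF lim])
    show "eventually (\<lambda>t. 1 / t * ln (prob (stays 0 t D)) = 1 / t * ln (prob {\<omega>\<in>space M. exit_time W D \<omega> > ennreal t})) at_top"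
      using eventually_ge_at_top[of 0] by eventually_elim (simp add: survival_eq[OF D])
  qed
  then show ?thesis unfolding rate_def by (subst tendsto_Lim) auto
qed

lemma prob_stays_pos:
  assumes "open D" "0 \<in> D" "0 \<le> t"
  shows "0 < prob (stays 0 t D)"
  using survival_lower_bound[OF assms(1,2)] assms(3) by (meson exp_gt_zero less_le_trans)

lemma rate_U_le: "rate M W U_domain \<le> pi\<^sup>2 / 8"
proof -
  obtain L where L: "((\<lambda>t. 1 / t * ln (prob (stays 0 t U_domain))) \<longlongrightarrow> L) at_top"
    using survival_rate_exists[OF open_U_domain zero_in_U_domain] by blast
  define w where "w n = 1 - inverse (real (n + 2))" for n :: nat
  have le: "- L \<le> ((pi / (2 * w n))\<^sup>2 + (pi / (2 * real (Suc n)))\<^sup>2) / 2" for n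
  proof -
    obtain v \<kappa> T where v: "real (Suc n) \<le> v" and \<kappa>: "0 < \<kappa>" and T: "0 \<le> T"
      and lower: "\<And>t. T \<le> t \<Longrightarrow> \<kappa> \<le> exp (((pi / (2 * w n))\<^sup>2 + (pi / (2 * v))\<^sup>2) / 2 * (t - T)) * prob (stays 0 t U_domain)"
      using survival_U_lower[of n] unfolding w_def by blast
    define k where "k = ((pi / (2 * w n))\<^sup>2 + (pi / (2 * v))\<^sup>2) / 2"
    have lim: "((\<lambda>t. (ln \<kappa> + k * T) * inverse t + - k) \<longlongrightarrow> (ln \<kappa> + k * T) * 0 + - k) at_top"
      by (intro tendsto_intros tendsto_inverse_0_at_top filterlim_ident)
    have ev: "eventually (\<lambda>t. (ln \<kappa> + k * T) * inverse t + - k \<le> 1 / t * ln (prob (stays 0 t U_domain))) at_top"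
      using eventually_ge_at_top[of T] eventually_gt_at_top[of 0]
    proof eventually_elim
      case (elim t)
      have pp: "0 < prob (stays 0 t U_domain)" using elim by (intro prob_stays_pos open_U_domain zero_in_U_domain) auto
      have "\<kappa> \<le> exp (k * (t - T)) * prob (stays 0 t U_domain)"
        using lower[OF elim(1)] unfolding k_def .
      moreover have "0 < exp (k * (t - T)) * prob (stays 0 t U_domain)" using pp by simp
      ultimately have "ln \<kappa> \<le> ln (exp (k * (t - T)) * prob (stays 0 t U_domain))"
        using \<kappa> by (simp only: ln_le_cancel_iff)
      also have "\<dots> = k * (t - T) + ln (prob (stays 0 t U_domain))" using pp by (simp add: ln_mult)
      finally have "ln \<kappa> + k * T - k * t \<le> ln (prob (stays 0 t U_domain))"
        unfolding right_diff_distrib by linarith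
      then have "(ln \<kappa> + k * T - k * t) / t \<le> ln (prob (stays 0 t U_domain)) / t" using elim by (intro divide_right_mono) auto
      moreover have "(ln \<kappa> + k * T - k * t) / t = (ln \<kappa> + k * T) * inverse t + - k"
        using elim by (simp add: divide_inverse left_diff_distrib)
      ultimately show ?case by simp
    qed
    have "(ln \<kappa> + k * T) * 0 + - k \<le> L"
      by (rule tendsto_le[OF trivial_limit_at_top_linorder L lim ev])
    then have "- L \<le> k" by simp
    also have "k \<le> ((pi / (2 * w n))\<^sup>2 + (pi / (2 * real (Suc n)))\<^sup>2) / 2"
    proof -
      have "pi / (2 * v) \<le> pi / (2 * real (Suc n))"
        by (rule divide_left_mono) (use v in \<open>simp_all del: of_nat_Suc\<close>)
      moreover have "0 \<le> pi / (2 * v)" using v by simp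
      ultimately have "(pi / (2 * v))\<^sup>2 \<le> (pi / (2 * real (Suc n)))\<^sup>2" by (rule power_mono)
      then show ?thesis unfolding k_def by (intro divide_right_mono add_left_mono) auto
    qed
    finally show ?thesis .
  qed
  from inverse_add_2_tendsto_0 have wlim: "w \<longlonglongrightarrow> 1 - 0" unfolding w_def[abs_def] by (intro tendsto_intros)
  have vlim: "(\<lambda>n. pi / 2 * inverse (real (Suc n))) \<longlonglongrightarrow> pi / 2 * 0"
    by (intro tendsto_intros LIMSEQ_inverse_real_of_nat)
  have "(\<lambda>n. pi / (2 * w n)) \<longlonglongrightarrow> pi / (2 * (1 - 0))"
    by (rule tendsto_divide[OF tendsto_const tendsto_mult[OF tendsto_const wlim]]) simp
  from tendsto_divide[OF tendsto_add[OF tendsto_power[OF this, of 2] tendsto_power[OF vlim, of 2]] tendsto_const, of 2]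
  have "(\<lambda>n. ((pi / (2 * w n))\<^sup>2 + (pi / 2 * inverse (real (Suc n)))\<^sup>2) / 2) \<longlonglongrightarrow> ((pi / (2 * (1 - 0)))\<^sup>2 + (pi / 2 * 0)\<^sup>2) / 2"
    by simp
  then have "- L \<le> ((pi / (2 * (1 - 0)))\<^sup>2 + (pi / 2 * 0)\<^sup>2) / 2"
  proof (rule LIMSEQ_le_const, intro exI allI impI)
    fix n
    have "pi / (2 * real (Suc n)) = pi / 2 * inverse (real (Suc n))" by (simp add: inverse_eq_divide)
    then show "- L \<le> ((pi / (2 * w n))\<^sup>2 + (pi / 2 * inverse (real (Suc n)))\<^sup>2) / 2"
      using le[of n] by (simp only:)
  qed
  then show ?thesis unfolding rate_eq[OF open_U_domain L] by (simp add: power_divide)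
qed

text \<open>The rate is at least \<open>c\<^sup>2 / 2\<close> for every \<open>c < pi / 2\<close>, by confinement to the strip.\<close>

lemma rate_CSEP_ge:
  assumes "solves_CSEP M W U11 D"
  shows "pi\<^sup>2 / 8 \<le> rate M W D"
proof -
  have D: "open D" and 0: "0 \<in> D" and fin: "(\<integral>\<^sup>+\<omega>. exit_time W D \<omega> \<partial>M) < \<infinity>"
    and law: "has_law M (\<lambda>\<omega>. Re (exit_position W D \<omega>)) U11"
    using assms by (auto simp: solves_CSEP_def)
  have exit: "AE \<omega> in M. \<bar>Re (exit_position W D \<omega>)\<bar> \<le> 1"
  proof -
    have "AE x in U11. \<bar>x\<bar> \<le> 1" using trig_uniform_U11 by (auto simp: trig_uniform_def)
    moreover have "distr M borel (\<lambda>\<omega>. Re (exit_position W D \<omega>)) = U11"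
      using law unfolding has_law_def by (rule conjunct2)
    ultimately have "AE x in distr M borel (\<lambda>\<omega>. Re (exit_position W D \<omega>)). \<bar>x\<bar> \<le> 1"
      by (simp only:)
    then show ?thesis using law by (subst (asm) AE_distr_iff) (auto simp: has_law_def)
  qed
  obtain L where L: "((\<lambda>t. 1 / t * ln (prob (stays 0 t D))) \<longlongrightarrow> L) at_top"
    using survival_rate_exists[OF D 0] by blast
  have le: "L \<le> - (c\<^sup>2 / 2)" if c: "0 < c" "c < pi / 2" for c
  proof -
    have cc: "0 < cos c" using c by (intro cos_gt_zero_pi) auto
    have lim: "((\<lambda>t. (- ln (cos c)) * inverse t + - (c\<^sup>2 / 2)) \<longlongrightarrow> (- ln (cos c)) * 0 + - (c\<^sup>2 / 2)) at_top"
      by (intro tendsto_intros tendsto_inverse_0_at_top filterlim_ident)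
    have ev: "eventually (\<lambda>t. 1 / t * ln (prob (stays 0 t D)) \<le> (- ln (cos c)) * inverse t + - (c\<^sup>2 / 2)) at_top"
      using eventually_gt_at_top[of 0]
    proof eventually_elim
      case (elim t)
      have pp: "0 < prob (stays 0 t D)" using elim by (intro prob_stays_pos D 0) auto
      have "prob (stays 0 t D) \<le> exp (- c\<^sup>2 / 2 * t) / cos c"
        using elim by (intro strip_survival_le[OF D exit confined_to_strip[OF D fin exit]] c) auto
      then have "ln (prob (stays 0 t D)) \<le> ln (exp (- c\<^sup>2 / 2 * t) / cos c)" using pp cc by simp
      also have "\<dots> = - c\<^sup>2 / 2 * t - ln (cos c)" using cc by (simp add: ln_div)
      finally have "ln (prob (stays 0 t D)) / t \<le> (- c\<^sup>2 / 2 * t - ln (cos c)) / t" using elim by (intro divide_right_mono) auto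
      then show ?case using elim by (simp add: field_simps)
    qed
    have "L \<le> (- ln (cos c)) * 0 + - (c\<^sup>2 / 2)"
      by (rule tendsto_le[OF trivial_limit_at_top_linorder lim L ev])
    then show ?thesis by simp
  qed
  from inverse_add_2_tendsto_0 have "(\<lambda>n. - ((pi / 2 * (1 - inverse (real (n + 2))))\<^sup>2 / 2)) \<longlonglongrightarrow> - ((pi / 2 * (1 - 0))\<^sup>2 / 2)"
    by (intro tendsto_minus tendsto_divide tendsto_power tendsto_mult tendsto_diff tendsto_const) simp_all
  then have "L \<le> - ((pi / 2 * (1 - 0))\<^sup>2 / 2)"
  proof (rule LIMSEQ_le_const, intro exI allI impI)
    fix n :: nat
    have "inverse (real (n + 2)) \<le> inverse 2" by (intro le_imp_inverse_le) auto
    moreover have "0 < inverse (real (n + 2))" by simp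
    ultimately show "L \<le> - ((pi / 2 * (1 - inverse (real (n + 2))))\<^sup>2 / 2)"
      by (intro le mult_pos_pos) auto
  qed
  then show ?thesis unfolding rate_eq[OF D L] by (simp add: power_divide)
qed

end

theorem theorem3:
  fixes M :: "'a measure" and W :: "real \<Rightarrow> 'a \<Rightarrow> complex"
  assumes "std_complex_BM M W"
  shows "has_law M (\<lambda>\<omega>. Re (exit_position W U_domain \<omega>)) (uniform_measure lborel {-1..1}) \<and>
         minimal_rate_solution M W (uniform_measure lborel {-1..1}) U_domain"
proof -
  interpret planar_BM M W by unfold_locales (rule assms)
  show ?thesis
    unfolding minimal_rate_solution_def
    by (intro conjI allI impI exit_U_law U_solves_CSEP order_trans[OF rate_U_le rate_CSEP_ge])
qed

end
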